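(* Consider the scalar plant $x_{t+1}=ax_t+u_t+w_t$, $0\le t\le T$, an error-free discrete channel of variable alphabet size in which at each time $t$ the encoder chooses causally the alphabet size $\eta_t$ and the codeword $\nu_t\in\{1,\dots,\eta_t\}$, with channel output $z_t=(\eta_t,\nu_t)$, and the performance cost $$J=\mathbb{E}\Big[x_{T+1}^2+p\sum_{i=1}^{T}x_i^2+q\sum_{i=0}^{T}u_i^2\Big]+J^{\rm Comm},\qquad p>0,\ q>0,$$ where $$J^{\rm Comm}=\begin{cases} m\cdot\mathbb{E}\big[\sum_{i=0}^T\varphi(\eta_i)\big] & \text{if }\sum_{i=0}^T\varphi(\eta_i)\le\mathscr{R}\cdot(T+1),\\ +\infty & \text{if }\sum_{i=0}^T\varphi(\eta_i)>\mathscr{R}\cdot(T+1),\end{cases}\qquad \varphi(\eta)=\begin{cases}\log_2\eta&\text{if }\eta\le\overline{\eta},\\+\infty&\text{if }\eta>\overline{\eta}.\end{cases}$$ For the dynamic encoder-controller design problem, i.e. the problem of picking causal sequences of encoding policies $\{\mathcal{E}_t\}_0^T$ and control policies $\{\mathcal{K}_t\}_0^T$ to minimize $J$, the cost $J$ is minimized by applying the linear control laws $$u_t^*=-k_t^*\,\widehat{x}_{t|t}$$ in combination with the following encoder, which is controls-forgetting from time $0$: $$\epsilon_t^*\big(\zeta_t\,;\{z_i\}_0^{t-1},\{\epsilon_i(\cdot)\}_0^{t-1}\big)=\underset{\epsilon(\cdot)}{\arg\inf}\ \Gamma_t\big(\epsilon(\cdot)\,;\{z_i\}_0^{t-1},\{\epsilon_i(\cdot)\}_0^{t-1}\big),$$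 where $$k_i^*=a\,\frac{\beta_{i+1}}{q+\beta_{i+1}},\quad \beta_i=p+\frac{a^2q\,\beta_{i+1}}{q+\beta_{i+1}},\quad \beta_{T+1}=1,\quad \lambda_i=\frac{a^2\beta_{i+1}^2}{q+\beta_{i+1}},$$ and where $$\Gamma_T=\begin{cases}+\infty & \text{if }\sum_{i=0}^T\varphi(\eta_i)>\mathscr{R}\cdot(T+1),\\ \mathbb{E}\Big[(\zeta_T-\widehat{\zeta}_{T|T})^2+m\cdot\varphi(\eta_T)\,\Big|\,\epsilon_T(\cdot),\{z_i,\epsilon_i(\cdot)\}_0^{T-1}\Big] & \text{otherwise,}\end{cases}$$ $$\Gamma_t=\lambda_t\,\mathbb{E}\Big[(\zeta_t-\widehat{\zeta}_{t|t})^2+m\cdot\varphi(\eta_t)\,\Big|\,\epsilon_t(\cdot),\mathscr{D}^{\rm con}_{(t-1)^+}\Big]+\mathbb{E}\Big[\Gamma_{t+1}^*\big(\{z_i,\epsilon_i(\cdot)\}_0^{t}\big)\Big]\quad(t<T),$$ $$\Gamma_t^*=\inf_{\epsilon(\cdot)}\Gamma_t(\epsilon).$$ Moreover, this control law is a certainty equivalence law.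
   Context: Plant and noise: all plant signals are real valued. $\{w_t\}$ is a sequence of independent random variables with zero means and constant variance $\sigma_w^2$; $x_0$ has mean $\overline{x}_0$ and variance $\sigma_0^2$; at any time $t$, $w_t$ is independent of all state, control, channel input and channel output data up to and including time $t$. The encoder observes the state perfectly. Communication parameters: $m$ is a fixed non-negative scalar, the positive integer $\overline{\eta}$ is an upper limit on the alphabet size at any time, and the positive real number $\mathscr{R}\le\overline{\eta}$ is an upper limit on the average data rate over the horizon. Policies: the encoder is a causal map $(t,\{x_i\}_0^t,\{z_i\}_0^{t-1},\{\mathcal{K}_i(\cdot)\}_0^{t-1})\mapsto z_t$; it knows the entire set of control policies and the statistical parameters of the plant, and the channel output is at all times perfectly visible to it. The controller is a causal map $\mathcal{K}_t:(t,\{z_i\}_0^t,\{u_i\}_0^{t-1})\mapsto u_t\in\mathbb{R}$. It is a standing assumption that measurable policies minimizing the cost exist. Notation: at time $t$ the encoder is viewed as a map $\xi_t(\cdot)$ of the current state (or $\epsilon_t(\cdot)$ of $\zeta_t$ below) whose shape depends on past data. $\mathscr{D}^{\rm con}_{t^-}=\{\{z_i\}_0^t,\{\xi_i(\cdot)\}_0^t,\{u_i\}_0^{t-1}\}$ is the data at the controller just after it reads $z_t$ and just before it generates $u_t$; $\mathscr{D}^{\rm con}_{t^+}=\{\mathscr{D}^{\rm con}_{t^-},u_t\}$; $\widehat{x}_{t|t}=\mathbb{E}[x_t\mid\mathscr{D}^{\rm con}_{t^-}]$. The control-free part of the state is $\zeta_0=x_0$, $\zeta_{i+1}=x_{i+1}-\sum_{j=0}^{i}a^{i-j}u_j$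 for $i\ge0$, so that $\zeta_{t+1}=a\zeta_t+w_t$. $\widehat{\zeta}_{t|t}$ is the corresponding conditional mean of $\zeta_t$ given the controller's data at $t^-$, so that $\zeta_t-\widehat{\zeta}_{t|t}=x_t-\widehat{x}_{t|t}$. The infima are over admissible encoding maps at the given time (choice of alphabet size and quantization map). Controls-forgetting encoder from time $\tau$: an admissible encoding strategy which for $t\le\tau$ is any admissible policy $\xi_t^\dagger(x_t;\mathscr{D}^{\rm con}_{(t-1)^-})$, and for $t\ge\tau+1$ has the form $\epsilon_t(\zeta_t;\rho^\zeta_{\tau|\tau-1}(\cdot),\{z_i\}_\tau^{t-1},\{\epsilon_i(\cdot)\}_\tau^{t-1})$, where $\rho^\zeta_{\tau|\tau-1}$ is the conditional density of $\zeta_\tau$ given $\mathscr{D}^{\rm con}_{(\tau-1)^-}$, the policies $\epsilon_t$ are adapted to the data $(\rho^\zeta_{\tau|\tau-1}(\cdot),\{z_i\}_\tau^{t-1},\{\epsilon_i(\cdot)\}_\tau^{t-1})$, and for fixed values of these data the map $\epsilon_t(\cdot)$ produces the same output regardless of both the controls $\{u_i\}_\tau^t$ and the control policies $\{\mathcal{K}_i(\cdot)\}_{t+1}^T$. Certainty equivalence law: let $L=x_{T+1}^2+p\sum_{i=1}^Tx_i^2+q\sum_{i=0}^Tu_i^2$. Suppose that at time $t$ the exact sample point $\omega$ (hence all primitive random variables) were known, and let $u_t^*(\omega)$ be an optimal control for the deterministic problem $\inf_u L\big(\{x_i(\omega)\},\{u_i(\omega)\}_0^{t-1},u,\{u_i(\omega)\}_{t+1}^{T}\big)$.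 A certainty equivalence control law has the form $\mathbb{E}[u_t^*(\omega)\mid\{z_i(\omega)\}_0^t,\{u_i(\omega)\}_0^{t-1}]$.
   Formalization: The weights in Γ are corrected: for every t ≤ T, including t = T, λ_t multiplies only the squared error (ζ_t − ζ̂_{t|t})², not m·φ(η_t). With the printed weights the arg inf encoder need not minimize J. *)

theory Defs
  imports "HOL-Probability.Probability"
begin

(* A channel output (eta, nu): the alphabet size and the codeword in {1..eta}. *)
type_synonym sym = "nat \<times> nat"

definition symbols :: "sym set" where
  "symbols = {(\<eta>, \<nu>). 1 \<le> \<nu> \<and> \<nu> \<le> \<eta>}"

record 'w lq_problem =
  prob :: "'w measure"
  init :: "'w \<Rightarrow> real"
  noise :: "nat \<Rightarrow> 'w \<Rightarrow> real"
  gain :: real                  (* a *)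
  wt_state :: real              (* p *)
  wt_ctrl :: real               (* q *)
  wt_comm :: real               (* m *)
  max_alph :: nat               (* upper limit on the alphabet size *)
  rate :: real                  (* upper limit on the average data rate *)
  horizon :: nat                (* T *)

(* Policies read histories, represented as functions that are "undefined" off their index
   set, as in PiE and PiM. At time t a controller reads z on {..t} and u on {..<t}; an encoder
   reads x on {..t}, z on {..<t} and the control policies on {..<t}. *)
type_synonym controller = "nat \<Rightarrow> (nat \<Rightarrow> sym) \<Rightarrow> (nat \<Rightarrow> real) \<Rightarrow> real"
type_synonym encoder = "nat \<Rightarrow> (nat \<Rightarrow> real) \<Rightarrow> (nat \<Rightarrow> sym) \<Rightarrow> controller \<Rightarrow> sym"

definition admissible_controller :: "'w lq_problem \<Rightarrow> controller \<Rightarrow> bool" where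
  "admissible_controller P K \<longleftrightarrow>
     (\<forall>t\<le>horizon P. \<forall>z. K t z \<in> borel_measurable (PiM {..<t} (\<lambda>_. borel)))"

definition admissible_encoder :: "'w lq_problem \<Rightarrow> encoder \<Rightarrow> bool" where
  "admissible_encoder P E \<longleftrightarrow>
     (\<forall>t\<le>horizon P. \<forall>z Ks.
        (\<lambda>x. E t x z Ks) \<in> PiM {..t} (\<lambda>_. borel) \<rightarrow>\<^sub>M count_space UNIV \<and>
        (\<forall>x. E t x z Ks \<in> symbols))"

(* Stage n of the closed loop holds x on {..n} and z, u on {..<n}. *)
primrec loop :: "'w lq_problem \<Rightarrow> encoder \<Rightarrow> controller \<Rightarrow> 'w \<Rightarrow> nat \<Rightarrow>
    (nat \<Rightarrow> real) \<times> (nat \<Rightarrow> sym) \<times> (nat \<Rightarrow> real)" where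
  "loop P E K \<omega> 0 = ((\<lambda>_. undefined)(0 := init P \<omega>), (\<lambda>_. undefined), (\<lambda>_. undefined))"
| "loop P E K \<omega> (Suc n) =
     (case loop P E K \<omega> n of (x, z, u) \<Rightarrow>
        let z' = z(n := E n x z (restrict K {..<n}));
            u' = u(n := K n z' u)
        in (x(Suc n := gain P * x n + u' n + noise P n \<omega>), z', u'))"

definition state :: "'w lq_problem \<Rightarrow> encoder \<Rightarrow> controller \<Rightarrow> nat \<Rightarrow> 'w \<Rightarrow> real" where
  "state P E K t \<omega> = fst (loop P E K \<omega> t) t"

definition chan :: "'w lq_problem \<Rightarrow> encoder \<Rightarrow> controller \<Rightarrow> nat \<Rightarrow> 'w \<Rightarrow> sym" where
  "chan P E K t \<omega> = fst (snd (loop P E K \<omega> (Suc t))) t"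

definition ctrl :: "'w lq_problem \<Rightarrow> encoder \<Rightarrow> controller \<Rightarrow> nat \<Rightarrow> 'w \<Rightarrow> real" where
  "ctrl P E K t \<omega> = snd (snd (loop P E K \<omega> (Suc t))) t"

lemma restrict_insert_upd: "b = f a \<Longrightarrow> (restrict f A)(a := b) = restrict f (insert a A)"
  by (simp add: fun_eq_iff restrict_def)

lemma loop_eq:
  "loop P E K \<omega> n = ((\<lambda>i\<in>{..n}. state P E K i \<omega>),
     (\<lambda>i\<in>{..<n}. chan P E K i \<omega>), (\<lambda>i\<in>{..<n}. ctrl P E K i \<omega>))"
proof (induction n)
  case 0
  show ?case by (simp add: state_def restrict_def fun_eq_iff)
next
  case (Suc n)
  obtain x z u where l: "loop P E K \<omega> (Suc n) = (x, z, u)" by (metis prod_cases3)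
  have v: "x (Suc n) = state P E K (Suc n) \<omega>" "z n = chan P E K n \<omega>" "u n = ctrl P E K n \<omega>"
    unfolding state_def chan_def ctrl_def l by simp_all
  have "x = (\<lambda>i\<in>{..n}. state P E K i \<omega>)(Suc n := x (Suc n))"
    "z = (\<lambda>i\<in>{..<n}. chan P E K i \<omega>)(n := z n)"
    "u = (\<lambda>i\<in>{..<n}. ctrl P E K i \<omega>)(n := u n)"
    using l unfolding loop.simps Suc Let_def prod.case by fastforce+
  then have "x = (\<lambda>i\<in>{..Suc n}. state P E K i \<omega>)"
    "z = (\<lambda>i\<in>{..<Suc n}. chan P E K i \<omega>)" "u = (\<lambda>i\<in>{..<Suc n}. ctrl P E K i \<omega>)"
    unfolding v atMost_Suc lessThan_Suc by (simp_all only: restrict_insert_upd)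
  then show ?case unfolding l by (simp only:)
qed

lemma state_0: "state P E K 0 \<omega> = init P \<omega>"
  by (simp add: state_def)

lemma chan_eq:
  "chan P E K t \<omega> = E t (\<lambda>i\<in>{..t}. state P E K i \<omega>) (\<lambda>i\<in>{..<t}. chan P E K i \<omega>)
     (restrict K {..<t})"
  unfolding chan_def[of P E K t \<omega>] loop.simps loop_eq[of P E K \<omega> t] Let_def prod.case
    fst_conv snd_conv fun_upd_same ..

lemma ctrl_eq:
  "ctrl P E K t \<omega> = K t (\<lambda>i\<in>{..t}. chan P E K i \<omega>) (\<lambda>i\<in>{..<t}. ctrl P E K i \<omega>)"
proof -
  have "(\<lambda>i\<in>{..t}. chan P E K i \<omega>)
      = (\<lambda>i\<in>{..<t}. chan P E K i \<omega>)(t := chan P E K t \<omega>)"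
    unfolding lessThan_Suc_atMost[symmetric] lessThan_Suc by (simp only: restrict_insert_upd)
  then show ?thesis
    unfolding ctrl_def[of P E K t \<omega>] loop.simps loop_eq[of P E K \<omega> t] Let_def prod.case
      fst_conv snd_conv fun_upd_same chan_eq[of P E K t \<omega>]
    by (simp only:)
qed

lemma state_Suc:
  "state P E K (Suc t) \<omega> = gain P * state P E K t \<omega> + ctrl P E K t \<omega> + noise P t \<omega>"
  unfolding state_def[of P E K "Suc t" \<omega>] ctrl_def[of P E K t \<omega>] loop.simps
    loop_eq[of P E K \<omega> t] Let_def prod.case fst_conv snd_conv fun_upd_same by simp

definition quad_cost :: "'w lq_problem \<Rightarrow> (nat \<Rightarrow> real) \<Rightarrow> (nat \<Rightarrow> real) \<Rightarrow> real" where
  "quad_cost P x u = (x (Suc (horizon P)))\<^sup>2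
     + wt_state P * (\<Sum>i=1..horizon P. (x i)\<^sup>2) + wt_ctrl P * (\<Sum>i\<le>horizon P. (u i)\<^sup>2)"

definition phi :: "'w lq_problem \<Rightarrow> nat \<Rightarrow> ennreal" where
  "phi P \<eta> = (if \<eta> \<le> max_alph P then ennreal (log 2 (real \<eta>)) else \<top>)"

definition rate_budget :: "'w lq_problem \<Rightarrow> ennreal" where
  "rate_budget P = ennreal (rate P * (real (horizon P) + 1))"

(* The alphabet sizes are random, so the rate constraint is imposed almost surely. *)
definition comm_cost :: "'w lq_problem \<Rightarrow> encoder \<Rightarrow> controller \<Rightarrow> ennreal" where
  "comm_cost P E K =
     (if AE \<omega> in prob P. (\<Sum>i\<le>horizon P. phi P (fst (chan P E K i \<omega>))) \<le> rate_budget P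
      then ennreal (wt_comm P) * (\<integral>\<^sup>+\<omega>. (\<Sum>i\<le>horizon P. phi P (fst (chan P E K i \<omega>))) \<partial>prob P)
      else \<top>)"

definition total_cost :: "'w lq_problem \<Rightarrow> encoder \<Rightarrow> controller \<Rightarrow> ennreal" where
  "total_cost P E K =
     (\<integral>\<^sup>+\<omega>. ennreal (quad_cost P (\<lambda>i. state P E K i \<omega>) (\<lambda>i. ctrl P E K i \<omega>)) \<partial>prob P)
     + comm_cost P E K"

definition optimal_design :: "'w lq_problem \<Rightarrow> encoder \<Rightarrow> controller \<Rightarrow> bool" where
  "optimal_design P E K \<longleftrightarrow> admissible_encoder P E \<and> admissible_controller P K \<and>
     (\<forall>E' K'. admissible_encoder P E' \<and> admissible_controller P K' \<longrightarrow>
        total_cost P E K \<le> total_cost P E' K')"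

(* The sigma-algebra of {z_i}_0^t, {u_i}_0^{t-1}. For the encoders forget_enc below, the shapes
   of the encoding maps up to time t are functions of these data and add no information. *)
definition ctrl_info :: "'w lq_problem \<Rightarrow> encoder \<Rightarrow> controller \<Rightarrow> nat \<Rightarrow> 'w measure" where
  "ctrl_info P E K t = vimage_algebra (space (prob P))
     (\<lambda>\<omega>. (\<lambda>i\<in>{..t}. chan P E K i \<omega>, \<lambda>i\<in>{..<t}. ctrl P E K i \<omega>))
     (PiM {..t} (\<lambda>_. count_space UNIV) \<Otimes>\<^sub>M PiM {..<t} (\<lambda>_. borel))"

definition state_est :: "'w lq_problem \<Rightarrow> encoder \<Rightarrow> controller \<Rightarrow> nat \<Rightarrow> 'w \<Rightarrow> real" where
  "state_est P E K t = real_cond_exp (prob P) (ctrl_info P E K t) (state P E K t)"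

function beta :: "'w lq_problem \<Rightarrow> nat \<Rightarrow> real" where
  "beta P i =
     (if i \<le> horizon P
      then wt_state P + (gain P)\<^sup>2 * wt_ctrl P * beta P (Suc i) / (wt_ctrl P + beta P (Suc i))
      else 1)"
  by auto
termination by (relation "Wellfounded.measure (\<lambda>(P, i). Suc (horizon P) - i)") auto

declare beta.simps [simp del]

definition kgain :: "'w lq_problem \<Rightarrow> nat \<Rightarrow> real" where
  "kgain P i = gain P * beta P (Suc i) / (wt_ctrl P + beta P (Suc i))"

definition lam :: "'w lq_problem \<Rightarrow> nat \<Rightarrow> real" where
  "lam P i = (gain P)\<^sup>2 * (beta P (Suc i))\<^sup>2 / (wt_ctrl P + beta P (Suc i))"

definition linear_law :: "'w lq_problem \<Rightarrow> encoder \<Rightarrow> controller \<Rightarrow> bool" where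
  "linear_law P E K \<longleftrightarrow> (\<forall>t\<le>horizon P. AE \<omega> in prob P.
     ctrl P E K t \<omega> = - kgain P t * state_est P E K t \<omega>)"

(* The control-free part of the state; see state_minus_controls. *)
primrec zeta :: "'w lq_problem \<Rightarrow> nat \<Rightarrow> 'w \<Rightarrow> real" where
  "zeta P 0 \<omega> = init P \<omega>"
| "zeta P (Suc t) \<omega> = gain P * zeta P t \<omega> + noise P t \<omega>"

lemma state_minus_controls:
  "zeta P t \<omega> = state P E K t \<omega> - (\<Sum>j<t. gain P ^ (t - 1 - j) * ctrl P E K j \<omega>)"
proof (induction t)
  case 0
  show ?case by (simp add: state_0)
next
  case (Suc t)
  have "(\<Sum>j<t. gain P ^ (t - j) * ctrl P E K j \<omega>)
      = gain P * (\<Sum>j<t. gain P ^ (t - 1 - j) * ctrl P E K j \<omega>)"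
    unfolding sum_distrib_left
  proof (intro sum.cong refl)
    fix j assume "j \<in> {..<t}"
    then have "t - j = Suc (t - 1 - j)" by auto
    then show "gain P ^ (t - j) * ctrl P E K j \<omega>
        = gain P * (gain P ^ (t - 1 - j) * ctrl P E K j \<omega>)"
      by simp
  qed
  then show ?case by (simp add: Suc state_Suc algebra_simps)
qed

definition quant_maps :: "(real \<Rightarrow> sym) set" where
  "quant_maps = {e \<in> borel \<rightarrow>\<^sub>M count_space UNIV. range e \<subseteq> symbols}"

(* Conditioning on z_i, epsilon_i(.) for i < t: the channel outputs are discrete, so this is
   conditioning on the event that the quantization maps es produced the outputs z. On a null
   history the conditional measure is the zero measure. *)
definition cond_meas ::
    "'w lq_problem \<Rightarrow> nat \<Rightarrow> (nat \<Rightarrow> sym) \<Rightarrow> (nat \<Rightarrow> real \<Rightarrow> sym) \<Rightarrow> 'w measure" where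
  "cond_meas P t z es =
     uniform_measure (prob P) {\<omega> \<in> space (prob P). \<forall>i<t. es i (zeta P i \<omega>) = z i}"

(* The conditional mean of zeta_t given z and the maps es on {..t}. *)
definition zeta_est ::
    "'w lq_problem \<Rightarrow> nat \<Rightarrow> (nat \<Rightarrow> sym) \<Rightarrow> (nat \<Rightarrow> real \<Rightarrow> sym) \<Rightarrow> real" where
  "zeta_est P t z es = (\<integral>\<omega>. zeta P t \<omega> \<partial>cond_meas P (Suc t) z es)"

definition stage_cost :: "'w lq_problem \<Rightarrow> nat \<Rightarrow> (real \<Rightarrow> sym) \<Rightarrow>
    (nat \<Rightarrow> sym) \<Rightarrow> (nat \<Rightarrow> real \<Rightarrow> sym) \<Rightarrow> ennreal" where
  "stage_cost P t e z es =
     (\<integral>\<^sup>+\<omega>. ennreal (lam P t *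
              (zeta P t \<omega> - zeta_est P t (z(t := e (zeta P t \<omega>))) (es(t := e)))\<^sup>2)
            + ennreal (wt_comm P) * phi P (fst (e (zeta P t \<omega>)))
        \<partial>cond_meas P t z es)"

(* The weight lam P t, for every t \<le> T, multiplies the squared error only: the identity
   J = const + E[Sum lam_t (zeta_t - zeta_est_t)^2] + J_comm for the linear law forces this. *)
function Gamma :: "'w lq_problem \<Rightarrow> nat \<Rightarrow> (real \<Rightarrow> sym) \<Rightarrow>
    (nat \<Rightarrow> sym) \<Rightarrow> (nat \<Rightarrow> real \<Rightarrow> sym) \<Rightarrow> ennreal" where
  "Gamma P t e z es =
     (if t < horizon P then
        stage_cost P t e z es
        + (\<integral>\<^sup>+\<omega>. (INF e'\<in>quant_maps. Gamma P (Suc t) e' (z(t := e (zeta P t \<omega>))) (es(t := e)))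
             \<partial>cond_meas P t z es)
      else if AE \<omega> in cond_meas P t z es.
          (\<Sum>i<t. phi P (fst (z i))) + phi P (fst (e (zeta P t \<omega>))) \<le> rate_budget P
        then stage_cost P t e z es
      else \<top>)"
  by auto
termination by (relation "Wellfounded.measure (\<lambda>(P, t, _). horizon P - t)") auto

declare Gamma.simps [simp del]

(* eps t z is the map used at time t after the channel outputs z on {..<t}. The earlier maps are
   determined by z and the prior of zeta_0 is fixed, so neither is an extra argument. *)
type_synonym strategy = "nat \<Rightarrow> (nat \<Rightarrow> sym) \<Rightarrow> real \<Rightarrow> sym"

definition quant_strategy :: "'w lq_problem \<Rightarrow> strategy \<Rightarrow> bool" where
  "quant_strategy P \<epsilon> \<longleftrightarrow> (\<forall>t\<le>horizon P. \<forall>z. \<epsilon> t z \<in> quant_maps)"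

definition argmin_strategy :: "'w lq_problem \<Rightarrow> strategy \<Rightarrow> bool" where
  "argmin_strategy P \<epsilon> \<longleftrightarrow> quant_strategy P \<epsilon> \<and>
     (\<forall>t\<le>horizon P. \<forall>z \<in> {..<t} \<rightarrow>\<^sub>E symbols.
        is_arg_min (\<lambda>e. Gamma P t e z (\<lambda>i\<in>{..<t}. \<epsilon> i (restrict z {..<i})))
          (\<lambda>e. e \<in> quant_maps) (\<epsilon> t z))"

(* Controls on {..<n} recomputed from the control policies and the channel outputs. *)
primrec replay :: "controller \<Rightarrow> (nat \<Rightarrow> sym) \<Rightarrow> nat \<Rightarrow> nat \<Rightarrow> real" where
  "replay Ks z 0 = (\<lambda>_. undefined)"
| "replay Ks z (Suc n) = (replay Ks z n)(n := Ks n (restrict z {..n}) (replay Ks z n))"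

(* The encoder that recovers zeta_t from x_t and applies eps to it. *)
definition forget_enc :: "'w lq_problem \<Rightarrow> strategy \<Rightarrow> encoder" where
  "forget_enc P \<epsilon> t x z Ks =
     \<epsilon> t z (x t - (\<Sum>j<t. gain P ^ (t - 1 - j) * replay Ks z t j))"

definition controls_forgetting :: "'w lq_problem \<Rightarrow> encoder \<Rightarrow> bool" where
  "controls_forgetting P E \<longleftrightarrow> (\<exists>\<epsilon>. quant_strategy P \<epsilon> \<and>
     (\<forall>K. \<forall>t\<le>horizon P. \<forall>\<omega>.
        chan P E K t \<omega> = \<epsilon> t (\<lambda>i\<in>{..<t}. chan P E K i \<omega>) (zeta P t \<omega>)))"

lemma replay_eq:
  assumes "n \<le> t"
  shows "replay (restrict K {..<t}) (\<lambda>i\<in>{..<t}. chan P E K i \<omega>) n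
     = (\<lambda>i\<in>{..<n}. ctrl P E K i \<omega>)"
  using assms
proof (induction n)
  case 0
  show ?case by (simp add: restrict_def)
next
  case (Suc n)
  have "restrict (\<lambda>i\<in>{..<t}. chan P E K i \<omega>) {..n} = (\<lambda>i\<in>{..n}. chan P E K i \<omega>)"
    using Suc.prems by (auto simp: fun_eq_iff restrict_def)
  moreover have "replay (restrict K {..<t}) (\<lambda>i\<in>{..<t}. chan P E K i \<omega>) n
      = (\<lambda>i\<in>{..<n}. ctrl P E K i \<omega>)"
    using Suc.IH Suc.prems by (meson Suc_leD)
  moreover have "restrict K {..<t} n = K n" using Suc.prems by simp
  ultimately show ?case
    unfolding replay.simps lessThan_Suc
    by (simp only: ctrl_eq[of P E K n \<omega>, symmetric] restrict_insert_upd)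
qed

lemma chan_forget_enc:
  "chan P (forget_enc P \<epsilon>) K t \<omega>
     = \<epsilon> t (\<lambda>i\<in>{..<t}. chan P (forget_enc P \<epsilon>) K i \<omega>) (zeta P t \<omega>)"
proof -
  let ?E = "forget_enc P \<epsilon>"
  have "chan P ?E K t \<omega> = ?E t (\<lambda>i\<in>{..t}. state P ?E K i \<omega>)
      (\<lambda>i\<in>{..<t}. chan P ?E K i \<omega>) (restrict K {..<t})"
    by (rule chan_eq)
  also have "\<dots> = \<epsilon> t (\<lambda>i\<in>{..<t}. chan P ?E K i \<omega>)
      (state P ?E K t \<omega> - (\<Sum>j<t. gain P ^ (t - 1 - j) * ctrl P ?E K j \<omega>))"
    unfolding forget_enc_def[of P \<epsilon> t] replay_eq[OF le_refl] by simp
  finally show ?thesis unfolding state_minus_controls[symmetric] .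
qed

(* The state trajectory at the sample point w under the control values v. *)
primrec trajectory :: "'w lq_problem \<Rightarrow> 'w \<Rightarrow> (nat \<Rightarrow> real) \<Rightarrow> nat \<Rightarrow> real" where
  "trajectory P \<omega> v 0 = init P \<omega>"
| "trajectory P \<omega> v (Suc t) = gain P * trajectory P \<omega> v t + v t + noise P t \<omega>"

(* ustar is the optimal time-t control when the sample point is known and the controls at all
   other times keep the values they take in the closed loop. *)
definition certainty_equivalent :: "'w lq_problem \<Rightarrow> encoder \<Rightarrow> controller \<Rightarrow> bool" where
  "certainty_equivalent P E K \<longleftrightarrow> (\<forall>t\<le>horizon P. \<exists>ustar.
     integrable (prob P) ustar \<and>
     (\<forall>\<omega>\<in>space (prob P).
        is_arg_min (\<lambda>v. let u = (\<lambda>i. ctrl P E K i \<omega>)(t := v)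
                        in quad_cost P (trajectory P \<omega> u) u)
          (\<lambda>_. True) (ustar \<omega>)) \<and>
     (AE \<omega> in prob P. ctrl P E K t \<omega>
        = real_cond_exp (prob P) (ctrl_info P E K t) ustar \<omega>))"

end

theory Submission
  imports Defs
begin

text \<open>
  Completing the square along the Riccati recursion for \<open>beta\<close> turns the quadratic cost
  into a constant, cross terms with the noise, and non-negative terms
  \<open>(q + \<beta>\<^bsub>t+1\<^esub>) (u\<^bsub>t\<^esub> + k\<^bsub>t\<^esub> x\<^bsub>t\<^esub>)\<^sup>2\<close> (\<open>complete_squares\<close>). The cross terms have mean zero because the noise
  is independent of the past. A control is a function of the channel outputs, and the state is the
  control-free part \<open>\<zeta>\<^bsub>t\<^esub>\<close> plus earlier controls, so each non-negative term is at least
  \<open>\<lambda>\<^bsub>t\<^esub> (\<zeta>\<^bsub>t\<^esub> - D\<^bsub>t\<^esub>(z))\<^sup>2\<close> for some decoder \<open>D\<close> of the output words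
  (\<open>excess_implied_decoder\<close>). Hence a design costs at least the constant, plus the weighted decoding
  error, plus the communication cost (\<open>design_cost_lower_bound\<close>). Under the linear law the decoder is the
  conditional mean, and the bound is an equality (\<open>linear_law_cost\<close>).

  What remains is to encode \<open>\<zeta>\<close>, a Markov process that no control affects. Fix the decoder of an
  arbitrary design. Its encoder then faces a Markov decision problem with the fully observed state
  \<open>(\<zeta>\<^bsub>t\<^esub>, z\<^bsub>0\<^esub> \<dots> z\<^bsub>t-1\<^esub>)\<close>, and dynamic programming gives an encoder that reads only this
  state and is at least as good (\<open>forgetting_encoder_suffices\<close>). The finite alphabet makes the choices
  attainable and measurable. Passing to the conditional mean as decoder can only lower the cost further
  (\<open>process_cost_cmean_least\<close>). So every design is dominated by a controls-forgetting strategy with a linear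
  law (\<open>design_dominated_by_strategy\<close>).

  The cost of such a strategy satisfies the recursion of \<open>Gamma\<close> with each infimum replaced by the map that the
  strategy uses (\<open>Gamma_eq\<close>, \<open>strategy_cost_process\<close>). It is therefore at least the optimal value
  \<open>\<Gamma>\<^sub>0\<^sup>*\<close>, with equality for an \<open>argmin_strategy\<close>, which proves optimality
  (\<open>argmin_strategy_optimal\<close>). For the existence of an \<open>argmin_strategy\<close>, an optimal design yields a strategy of
  least cost; near-optimal choices of maps show that this least cost is \<open>\<Gamma>\<^sub>0\<^sup>*\<close>
  (\<open>best_eq_of_minimal\<close>). The value is finite, so the inequality between infimum and cost must be an equality
  after every output word of positive probability; after the other words the conditional measure
  vanishes and every map is a minimizer (\<open>minimal_strategy_argmin\<close>).

  Certainty equivalence is the first-order condition. With the other controls held at their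
  closed-loop values the cost is a parabola in \<open>u\<^bsub>t\<^esub>\<close>, and its derivative at the closed-loop value has
  conditional mean zero given the controller's data. This follows by backward induction from the identity
  that the conditional mean of the costate is \<open>\<beta>\<^bsub>t+1\<^esub>\<close> times that of the next state
  (\<open>event_costate\<close>).
\<close>

section \<open>Measurable choice among finitely many alternatives\<close>

text \<open>
  Finiteness replaces a measurable selection theorem: the minimizer is built by comparing one new
  alternative at a time with the best of the others, and each comparison is a measurable event.
\<close>
lemma finite_measurable_argmin:
  fixes g :: "'s \<Rightarrow> 'x \<Rightarrow> 'b :: {second_countable_topology, linorder_topology}"
  assumes "finite S" "S \<noteq> {}" and g: "\<And>s. s \<in> S \<Longrightarrow> g s \<in> borel_measurable N"
  shows "\<exists>e \<in> N \<rightarrow>\<^sub>M count_space UNIV. range e \<subseteq> S \<and> (\<forall>x. \<forall>s\<in>S. g (e x) x \<le> g s x)"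
  using assms
proof (induction S rule: finite_ne_induct)
  case (singleton r)
  then show ?case by (intro bexI[of _ "\<lambda>_. r"]) auto
next
  case (insert r S)
  then obtain e where e: "e \<in> N \<rightarrow>\<^sub>M count_space UNIV" "range e \<subseteq> S" "\<And>x s. s \<in> S \<Longrightarrow> g (e x) x \<le> g s x"
    by (metis insertCI)
  have "e \<in> N \<rightarrow>\<^sub>M count_space S"
    using e(1,2) measurable_count_space_eq2[OF \<open>finite S\<close>, of e N]
    by (auto intro: measurable_sets)
  then have [measurable]: "(\<lambda>x. g (e x) x) \<in> borel_measurable N"
    by (rule measurable_compose_countable'[rotated]) (use insert in \<open>simp_all add: countable_finite\<close>)
  have [measurable]: "g r \<in> borel_measurable N" using insert.prems by simp
  note e(1)[measurable]
  let ?e = "\<lambda>x. if g r x \<le> g (e x) x then r else e x"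
  have "?e \<in> N \<rightarrow>\<^sub>M count_space UNIV" by measurable
  moreover have "range ?e \<subseteq> insert r S" using e(2) by auto
  moreover have "g (?e x) x \<le> g s x" if "s \<in> insert r S" for x s
  proof (cases "s = r")
    case True
    then show ?thesis by (simp add: linear not_le_imp_less less_imp_le)
  next
    case False
    then have "g (e x) x \<le> g s x" using that e(3) by blast
    then show ?thesis by auto
  qed
  ultimately show ?case by (intro bexI[of _ ?e]) auto
qed

section \<open>The plant and its past\<close>

locale lq_plant = prob_space "prob P" for P :: "'w lq_problem" +
  assumes primitives: "indep_vars (\<lambda>_. borel) (case_nat (init P) (noise P)) {..Suc (horizon P)}"
    and init_L2: "integrable (lq_problem.prob P) (\<lambda>\<omega>. (init P \<omega>)\<^sup>2)"
    and noise_L2: "\<And>t. t \<le> horizon P \<Longrightarrow> integrable (lq_problem.prob P) (\<lambda>\<omega>. (noise P t \<omega>)\<^sup>2)"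
    and noise_mean: "\<And>t. t \<le> horizon P \<Longrightarrow> expectation (noise P t) = 0"
    and wt_state_pos: "wt_state P > 0"
    and wt_ctrl_pos: "wt_ctrl P > 0"
    and wt_comm_nonneg: "wt_comm P \<ge> 0"
    and alphabet: "max_alph P > 0"
begin

abbreviation "M \<equiv> lq_problem.prob P"
abbreviation "T \<equiv> horizon P"
abbreviation "a \<equiv> gain P"

text \<open>
  The information generated by the initial state and the noises before time \<open>t\<close>. Index \<open>0\<close> of the
  combined family is the initial state and index \<open>Suc i\<close> is the noise at time \<open>i\<close>, so the indices up to
  \<open>t\<close> exclude the noise at time \<open>t\<close>.
\<close>
definition past :: "nat \<Rightarrow> 'w measure" where
  "past t = vimage_algebra (space M) (\<lambda>\<omega>. \<lambda>i\<in>{..t}. case_nat (init P) (noise P) i \<omega>)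
     (PiM {..t} (\<lambda>_. borel))"

lemma space_past [simp]: "space (past t) = space M"
  by (simp add: past_def)

lemma primitive_past: "i \<le> t \<Longrightarrow> case_nat (init P) (noise P) i \<in> borel_measurable (past t)"
proof -
  assume "i \<le> t"
  have "(\<lambda>\<omega>. \<lambda>i\<in>{..t}. case_nat (init P) (noise P) i \<omega>) \<in> past t \<rightarrow>\<^sub>M PiM {..t} (\<lambda>_. borel)"
    unfolding past_def by (rule measurable_vimage_algebra1) (auto simp: space_PiM)
  then have "(\<lambda>\<omega>. (\<lambda>i\<in>{..t}. case_nat (init P) (noise P) i \<omega>) i) \<in> borel_measurable (past t)"
    by (rule measurable_compose[OF _ measurable_component_singleton]) (use \<open>i \<le> t\<close> in auto)
  with \<open>i \<le> t\<close> show ?thesis by simp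
qed

lemma init_past: "init P \<in> borel_measurable (past t)"
  using primitive_past[of 0 t] by simp

lemma noise_past: "i < t \<Longrightarrow> noise P i \<in> borel_measurable (past t)"
  using primitive_past[of "Suc i" t] by simp

lemma primitive_measurable:
  "i \<le> Suc T \<Longrightarrow> case_nat (init P) (noise P) i \<in> borel_measurable M"
  using primitives by (auto simp: indep_vars_def2)

lemma init_measurable [measurable]: "init P \<in> borel_measurable M"
  using primitive_measurable[of 0] by simp

lemma noise_measurable [measurable]: "t \<le> T \<Longrightarrow> noise P t \<in> borel_measurable M"
  using primitive_measurable[of "Suc t"] by simp

lemma past_le: 
  assumes "t \<le> Suc T" shows "sets (past t) \<subseteq> sets M"
  unfolding past_def
  by (rule sets_image_in_sets) (use assms primitive_measurable in \<open>auto intro!: measurable_restrict\<close>)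

lemma past_mono:
  assumes "s \<le> t" shows "sets (past s) \<subseteq> sets (past t)"
  unfolding past_def[of s]
  by (rule sets_image_in_sets) (use assms primitive_past in \<open>auto intro!: measurable_restrict\<close>)

lemma from_past: "f \<in> past t \<rightarrow>\<^sub>M N \<Longrightarrow> t \<le> Suc T \<Longrightarrow> f \<in> M \<rightarrow>\<^sub>M N"
  using past_le[of t] by (auto simp: measurable_def)

lemma past_later: "f \<in> past s \<rightarrow>\<^sub>M N \<Longrightarrow> s \<le> t \<Longrightarrow> f \<in> past t \<rightarrow>\<^sub>M N"
  using past_mono[of s t] by (auto simp: measurable_def)

lemma zeta_past: "s \<le> t \<Longrightarrow> zeta P s \<in> borel_measurable (past t)"
proof (induction s)
  case 0
  show ?case using init_past by (simp cong: measurable_cong)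
next
  case (Suc s)
  then have [measurable]: "zeta P s \<in> borel_measurable (past t)" "noise P s \<in> borel_measurable (past t)"
    using noise_past by auto
  have "(\<lambda>\<omega>. a * zeta P s \<omega> + noise P s \<omega>) \<in> borel_measurable (past t)" by measurable
  then show ?case by simp
qed

lemma zeta_measurable [measurable]: "t \<le> Suc T \<Longrightarrow> zeta P t \<in> borel_measurable M"
  using zeta_past from_past by blast

text \<open>
  The independence is phrased for set systems since \<open>indep_var\<close> relates only variables of one type, whereas
  histories take values in function spaces.
\<close>
lemma noise_indep_past:
  assumes t: "t \<le> T"
  shows "indep_set (sets (past t)) {noise P t -` A \<inter> space M | A. A \<in> sets borel}"
proof -
  let ?X = "case_nat (init P) (noise P)"
  let ?gen = "\<lambda>S X. {X -` A \<inter> space M | A. A \<in> sets S}"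
  have ind: "indep_var (PiM {..t} (\<lambda>_. borel)) (\<lambda>\<omega>. restrict (\<lambda>i. ?X i \<omega>) {..t})
      (PiM {Suc t} (\<lambda>_. borel)) (\<lambda>\<omega>. restrict (\<lambda>i. ?X i \<omega>) {Suc t})"
    by (rule indep_var_restrict[OF primitives]) (use t in auto)
  have "?gen borel (noise P t) \<subseteq> ?gen (PiM {Suc t} (\<lambda>_. borel)) (\<lambda>\<omega>. restrict (\<lambda>i. ?X i \<omega>) {Suc t})"
  proof clarify
    fix A :: "real set" assume A: "A \<in> sets borel"
    have "(\<lambda>f. f (Suc t)) -` A \<inter> space (PiM {Suc t} (\<lambda>_. borel)) \<in> sets (PiM {Suc t} (\<lambda>_. borel))"
      by (rule measurable_sets[OF measurable_component_singleton[of "Suc t" "{Suc t}" "\<lambda>_. borel"] A]) simp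
    moreover have "noise P t -` A \<inter> space M = (\<lambda>\<omega>. restrict (\<lambda>i. ?X i \<omega>) {Suc t}) -`
        ((\<lambda>f. f (Suc t)) -` A \<inter> space (PiM {Suc t} (\<lambda>_. borel))) \<inter> space M"
      by (auto simp: space_PiM)
    ultimately show "\<exists>B. noise P t -` A \<inter> space M = (\<lambda>\<omega>. restrict (\<lambda>i. ?X i \<omega>) {Suc t}) -` B \<inter> space M
        \<and> B \<in> sets (PiM {Suc t} (\<lambda>_. borel))"
      by blast
  qed
  then have "?gen borel (noise P t) \<subseteq> sigma_sets (space M) (?gen (PiM {Suc t} (\<lambda>_. borel)) (\<lambda>\<omega>. restrict (\<lambda>i. ?X i \<omega>) {Suc t}))"
    by (meson sigma_sets_superset_generator order_trans)
  moreover have "sets (past t) = sigma_sets (space M) (?gen (PiM {..t} (\<lambda>_. borel)) (\<lambda>\<omega>. restrict (\<lambda>i. ?X i \<omega>) {..t}))"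
    unfolding past_def sets_vimage_algebra ..
  ultimately show ?thesis
    using ind unfolding indep_var_eq indep_sets2_eq by (metis (no_types, lifting) subset_iff)
qed

text \<open>
  The Markov property in the form in which dynamic programming uses it: the noise at time \<open>t\<close> may be
  replaced by an independent copy, because its joint law with anything from the past is a product.
\<close>
lemma integrate_out_noise:
  assumes t: "t \<le> T" and Y: "Y \<in> past t \<rightarrow>\<^sub>M N" and g: "g \<in> borel_measurable (N \<Otimes>\<^sub>M borel)"
  shows "(\<integral>\<^sup>+\<omega>. g (Y \<omega>, noise P t \<omega>) \<partial>M) = (\<integral>\<^sup>+\<omega>. (\<integral>\<^sup>+\<omega>'. g (Y \<omega>, noise P t \<omega>') \<partial>M) \<partial>M)"
proof -
  have Y'[measurable]: "Y \<in> M \<rightarrow>\<^sub>M N" using from_past[OF Y] t by simp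
  have w[measurable]: "noise P t \<in> borel_measurable M" using t by simp
  interpret dw: prob_space "distr M borel (noise P t)" by (rule prob_space_distr[OF w])
  interpret dY: prob_space "distr M N Y" by (rule prob_space_distr[OF Y'])
  have eq: "distr M N Y \<Otimes>\<^sub>M distr M borel (noise P t) = distr M (N \<Otimes>\<^sub>M borel) (\<lambda>\<omega>. (Y \<omega>, noise P t \<omega>))"
  proof (rule pair_measure_eqI)
    show "sigma_finite_measure (distr M N Y)" "sigma_finite_measure (distr M borel (noise P t))" ..
    show "sets (distr M N Y \<Otimes>\<^sub>M distr M borel (noise P t)) = sets (distr M (N \<Otimes>\<^sub>M borel) (\<lambda>\<omega>. (Y \<omega>, noise P t \<omega>)))"
      by (simp cong: sets_pair_measure_cong)
    fix A B assume "A \<in> sets (distr M N Y)" "B \<in> sets (distr M borel (noise P t))"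
    then have A: "A \<in> sets N" and B: "B \<in> sets borel" by auto
    have "Y -` A \<inter> space M \<in> sets (past t)" using measurable_sets[OF Y A] by simp
    then have "measure M ((Y -` A \<inter> space M) \<inter> (noise P t -` B \<inter> space M))
        = measure M (Y -` A \<inter> space M) * measure M (noise P t -` B \<inter> space M)"
      using noise_indep_past[OF t] B unfolding indep_sets2_eq by blast
    moreover have "(\<lambda>\<omega>. (Y \<omega>, noise P t \<omega>)) -` (A \<times> B) \<inter> space M
        = (Y -` A \<inter> space M) \<inter> (noise P t -` B \<inter> space M)" by auto
    moreover have "A \<times> B \<in> sets (N \<Otimes>\<^sub>M borel)" using A B by simp
    ultimately show "emeasure (distr M N Y) A * emeasure (distr M borel (noise P t)) B
        = emeasure (distr M (N \<Otimes>\<^sub>M borel) (\<lambda>\<omega>. (Y \<omega>, noise P t \<omega>))) (A \<times> B)"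
      using A B by (simp add: emeasure_distr emeasure_eq_measure ennreal_mult)
  qed
  have "(\<integral>\<^sup>+\<omega>. g (Y \<omega>, noise P t \<omega>) \<partial>M) = (\<integral>\<^sup>+x. g x \<partial>distr M (N \<Otimes>\<^sub>M borel) (\<lambda>\<omega>. (Y \<omega>, noise P t \<omega>)))"
    using g by (subst nn_integral_distr) auto
  also have "\<dots> = (\<integral>\<^sup>+y. (\<integral>\<^sup>+v. g (y, v) \<partial>distr M borel (noise P t)) \<partial>distr M N Y)"
    unfolding eq[symmetric] using g by (subst dw.nn_integral_fst[symmetric]) (auto cong: measurable_cong_sets)
  also have "\<dots> = (\<integral>\<^sup>+\<omega>. (\<integral>\<^sup>+v. g (Y \<omega>, v) \<partial>distr M borel (noise P t)) \<partial>M)"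
    using g by (intro nn_integral_distr[OF Y']) (auto intro!: dw.borel_measurable_nn_integral cong: measurable_cong_sets)
  also have "\<dots> = (\<integral>\<^sup>+\<omega>. (\<integral>\<^sup>+\<omega>'. g (Y \<omega>, noise P t \<omega>') \<partial>M) \<partial>M)"
  proof (rule nn_integral_cong)
    fix \<omega> assume "\<omega> \<in> space M"
    then have "Y \<omega> \<in> space N" using Y' by (auto simp: measurable_def)
    then show "(\<integral>\<^sup>+v. g (Y \<omega>, v) \<partial>distr M borel (noise P t)) = (\<integral>\<^sup>+\<omega>'. g (Y \<omega>, noise P t \<omega>') \<partial>M)"
      using g by (subst nn_integral_distr) auto
  qed
  finally show ?thesis .
qed

lemma Int_stable_vimage: "Int_stable {X -` A \<inter> space M | A. A \<in> sets borel}" for X :: "'w \<Rightarrow> real"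
proof (rule Int_stableI, clarify)
  fix A B :: "real set" assume "A \<in> sets borel" "B \<in> sets borel"
  then show "\<exists>C. X -` A \<inter> space M \<inter> (X -` B \<inter> space M) = X -` C \<inter> space M \<and> C \<in> sets borel"
    by (intro exI[of _ "A \<inter> B"]) auto
qed

lemma noise_orthogonal:
  assumes t: "t \<le> T" and Y: "Y \<in> borel_measurable (past t)" and "integrable M (Y :: 'w \<Rightarrow> real)"
  shows "integrable M (\<lambda>\<omega>. Y \<omega> * noise P t \<omega>)" "(\<integral>\<omega>. Y \<omega> * noise P t \<omega> \<partial>M) = 0"
proof -
  have w: "integrable M (noise P t)" using square_integrable_imp_integrable[OF _ noise_L2[OF t]] t by simp
  have sig: "{Y -` A \<inter> space M | A. A \<in> sets borel} \<subseteq> sets (past t)"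
    using measurable_sets[OF Y] by auto
  have ind: "indep_var borel Y borel (noise P t)"
    unfolding indep_var_eq
  proof (intro conjI indep_set_sigma_sets)
    show "indep_set {Y -` A \<inter> space M | A. A \<in> sets borel} {noise P t -` A \<inter> space M | A. A \<in> sets borel}"
      using noise_indep_past[OF t] sig unfolding indep_sets2_eq by (metis (no_types, lifting) subset_iff)
  qed (use from_past[OF Y] t Int_stable_vimage in auto)
  show "integrable M (\<lambda>\<omega>. Y \<omega> * noise P t \<omega>)" by (rule indep_var_integrable[OF ind assms(3) w])
  show "(\<integral>\<omega>. Y \<omega> * noise P t \<omega> \<partial>M) = 0"
    using indep_var_lebesgue_integral[OF ind assms(3) w] noise_mean[OF t] by simp
qed

section \<open>Output histories\<close>

text \<open>
  Histories of outputs are functions on \<open>{..<t}\<close>, as in the loop. There are only countably many, so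
  joint measurability in a history and a real argument reduces to measurability for each fixed history.
\<close>
definition words :: "nat \<Rightarrow> (nat \<Rightarrow> sym) set" where
  "words t = ({..<t} \<rightarrow>\<^sub>E symbols)"

lemma countable_words: "countable (words t)"
  unfolding words_def by (rule countable_PiE) simp_all

lemma words_upd: "z \<in> words t \<Longrightarrow> s \<in> symbols \<Longrightarrow> z(t := s) \<in> words (Suc t)"
  unfolding words_def lessThan_Suc by (rule PiE_fun_upd)

definition hist :: "(nat \<Rightarrow> 'w \<Rightarrow> sym) \<Rightarrow> nat \<Rightarrow> 'w \<Rightarrow> nat \<Rightarrow> sym" where
  "hist Z t \<omega> = (\<lambda>i\<in>{..<t}. Z i \<omega>)"

lemma hist_Suc: "hist Z (Suc t) \<omega> = (hist Z t \<omega>)(t := Z t \<omega>)"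
  unfolding hist_def lessThan_Suc by (rule restrict_insert_upd[symmetric]) simp

lemma hist_0: "hist Z 0 \<omega> = (\<lambda>_. undefined)"
  by (simp add: hist_def restrict_def)

text \<open>
  An output process is treated abstractly, without reference to the encoder and controller that
  generate it. Any admissible design gives one (\<open>chan_adapted\<close>), and so does any quantization strategy
  (\<open>outputs_adapted\<close>).
\<close>
definition adapted :: "(nat \<Rightarrow> 'w \<Rightarrow> sym) \<Rightarrow> bool" where
  "adapted Z \<longleftrightarrow> (\<forall>t\<le>T. Z t \<in> past t \<rightarrow>\<^sub>M count_space UNIV \<and> (\<forall>\<omega>. Z t \<omega> \<in> symbols))"

lemma hist_words: "adapted Z \<Longrightarrow> t \<le> Suc T \<Longrightarrow> hist Z t \<omega> \<in> words t"
  by (simp add: hist_def words_def adapted_def restrict_PiE_iff)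

lemma hist_measurable_of_outputs:
  assumes Z: "\<And>i. i < t \<Longrightarrow> Z i \<in> N \<rightarrow>\<^sub>M count_space UNIV" "\<And>i \<omega>. i < t \<Longrightarrow> Z i \<omega> \<in> symbols"
  shows "hist Z t \<in> N \<rightarrow>\<^sub>M count_space (words t)"
proof (subst measurable_count_space_eq_countable[OF countable_words], intro conjI ballI)
  show "hist Z t \<in> space N \<rightarrow> words t" using Z(2) by (simp add: hist_def words_def restrict_PiE_iff)
  fix z assume z: "z \<in> words t"
  have "hist Z t -` {z} \<inter> space N = {\<omega>\<in>space N. \<forall>i\<in>{..<t}. Z i \<omega> = z i}"
    using z by (auto simp: hist_def words_def fun_eq_iff PiE_def extensional_def) 
  also have "\<dots> \<in> sets N"
  proof (rule sets.sets_Collect_finite_All)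
    fix i assume "i \<in> {..<t}"
    then have "Z i -` {z i} \<inter> space N \<in> sets N" using Z(1)[of i] by (simp add: measurable_sets)
    also have "Z i -` {z i} \<inter> space N = {\<omega>\<in>space N. Z i \<omega> = z i}" by auto
    finally show "{\<omega>\<in>space N. Z i \<omega> = z i} \<in> sets N" .
  qed simp
  finally show "hist Z t -` {z} \<inter> space N \<in> sets N" .
qed

lemma hist_past:
  assumes Z: "adapted Z" and t: "t \<le> Suc s" "t \<le> Suc T"
  shows "hist Z t \<in> past s \<rightarrow>\<^sub>M count_space (words t)"
proof (rule hist_measurable_of_outputs)
  fix i assume "i < t"
  then show "Z i \<in> past s \<rightarrow>\<^sub>M count_space UNIV"
    using Z t past_later[of "Z i" i _ s] by (simp add: adapted_def)
  from \<open>i < t\<close> show "Z i \<omega> \<in> symbols" for \<omega> using Z t by (simp add: adapted_def)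
qed

lemma hist_measurable: "adapted Z \<Longrightarrow> t \<le> Suc T \<Longrightarrow> hist Z t \<in> M \<rightarrow>\<^sub>M count_space (words t)"
  by (rule from_past[OF hist_past[of Z t T]]) simp_all

section \<open>Signals of an admissible loop\<close>

lemma chan_symbols:
  assumes "admissible_encoder P E" "t \<le> T"
  shows "chan P E K t \<omega> \<in> symbols"
proof -
  have "E t x z Ks \<in> symbols" for x z Ks
    using assms unfolding admissible_encoder_def by blast
  then show ?thesis by (subst chan_eq)
qed

lemma ctrl_measurable_step:
  assumes E: "admissible_encoder P E" and K: "admissible_controller P K" and t: "t \<le> T"
    and z: "\<And>i. i \<le> t \<Longrightarrow> chan P E K i \<in> N \<rightarrow>\<^sub>M count_space UNIV"
    and u: "\<And>i. i < t \<Longrightarrow> ctrl P E K i \<in> borel_measurable N"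
  shows "ctrl P E K t \<in> borel_measurable N"
proof -
  have [measurable]: "(\<lambda>\<omega>. \<lambda>i\<in>{..<t}. ctrl P E K i \<omega>) \<in> N \<rightarrow>\<^sub>M PiM {..<t} (\<lambda>_. borel)"
    using u by (auto intro!: measurable_restrict)
  have h: "hist (chan P E K) (Suc t) \<in> N \<rightarrow>\<^sub>M count_space (words (Suc t))"
    by (rule hist_measurable_of_outputs) (use z t chan_symbols[OF E] in \<open>simp_all add: less_Suc_eq_le\<close>)
  have "(\<lambda>\<omega>. K t (hist (chan P E K) (Suc t) \<omega>) (\<lambda>i\<in>{..<t}. ctrl P E K i \<omega>)) \<in> borel_measurable N"
  proof (rule measurable_compose_countable'[OF _ h countable_words])
    fix z
    have [measurable]: "K t z \<in> borel_measurable (PiM {..<t} (\<lambda>_. borel))"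
      using K t by (simp add: admissible_controller_def)
    show "(\<lambda>\<omega>. K t z (\<lambda>i\<in>{..<t}. ctrl P E K i \<omega>)) \<in> borel_measurable N"
      by measurable
  qed
  then show ?thesis
    unfolding hist_def lessThan_Suc_atMost by (subst (asm) ctrl_eq[symmetric])
qed

lemma loop_measurable_step:
  assumes E: "admissible_encoder P E" and K: "admissible_controller P K" and t: "t \<le> T"
    and x: "\<And>i. i \<le> t \<Longrightarrow> state P E K i \<in> borel_measurable N"
    and z: "\<And>i. i < t \<Longrightarrow> chan P E K i \<in> N \<rightarrow>\<^sub>M count_space UNIV"
    and u: "\<And>i. i < t \<Longrightarrow> ctrl P E K i \<in> borel_measurable N"
  shows "chan P E K t \<in> N \<rightarrow>\<^sub>M count_space UNIV" "ctrl P E K t \<in> borel_measurable N"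
proof -
  have sym: "chan P E K i \<omega> \<in> symbols" if "i \<le> T" for i \<omega>
    by (rule chan_symbols[OF E that])
  have h: "hist (chan P E K) t \<in> N \<rightarrow>\<^sub>M count_space (words t)"
    by (rule hist_measurable_of_outputs) (use z t sym in auto)
  have [measurable]: "(\<lambda>\<omega>. \<lambda>i\<in>{..t}. state P E K i \<omega>) \<in> N \<rightarrow>\<^sub>M PiM {..t} (\<lambda>_. borel)"
    using x by (auto intro!: measurable_restrict)
  have "(\<lambda>\<omega>. E t (\<lambda>i\<in>{..t}. state P E K i \<omega>) (hist (chan P E K) t \<omega>) (restrict K {..<t})) \<in> N \<rightarrow>\<^sub>M count_space UNIV"
  proof (rule measurable_compose_countable'[OF _ h countable_words])
    fix z
    have [measurable]: "(\<lambda>x. E t x z (restrict K {..<t})) \<in> PiM {..t} (\<lambda>_. borel) \<rightarrow>\<^sub>M count_space UNIV"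
      using E t by (simp add: admissible_encoder_def)
    show "(\<lambda>\<omega>. E t (\<lambda>i\<in>{..t}. state P E K i \<omega>) z (restrict K {..<t})) \<in> N \<rightarrow>\<^sub>M count_space UNIV"
      by measurable
  qed
  then show c: "chan P E K t \<in> N \<rightarrow>\<^sub>M count_space UNIV"
    unfolding hist_def by (subst (asm) chan_eq[symmetric])
  show "ctrl P E K t \<in> borel_measurable N"
    by (rule ctrl_measurable_step[OF E K t _ u]) (use z c in \<open>auto simp: le_less\<close>)
qed

text \<open>
  The encoder depends measurably on the states and the controller on the controls, for each fixed output
  word; countability of the words makes all signals of the loop functions of the past.
\<close>
lemma loop_past:
  assumes E: "admissible_encoder P E" and K: "admissible_controller P K"
  shows "t \<le> Suc T \<Longrightarrow> t \<le> s \<Longrightarrow> state P E K t \<in> borel_measurable (past s)"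
    and "t \<le> T \<Longrightarrow> t \<le> s \<Longrightarrow> chan P E K t \<in> past s \<rightarrow>\<^sub>M count_space UNIV"
    and "t \<le> T \<Longrightarrow> t \<le> s \<Longrightarrow> ctrl P E K t \<in> borel_measurable (past s)"
proof -
  have main: "(t \<le> Suc T \<longrightarrow> state P E K t \<in> borel_measurable (past t)) \<and>
     (t \<le> T \<longrightarrow> chan P E K t \<in> past t \<rightarrow>\<^sub>M count_space UNIV \<and> ctrl P E K t \<in> borel_measurable (past t))" for t
  proof (induction t rule: less_induct)
    case (less t)
    have "state P E K t \<in> borel_measurable (past t)" if "t \<le> Suc T"
    proof (cases t)
      case 0
      then show ?thesis using init_past by (simp add: state_0 cong: measurable_cong)
    next
      case (Suc r)
      then have [measurable]: "state P E K r \<in> borel_measurable (past t)" "ctrl P E K r \<in> borel_measurable (past t)"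
        "noise P r \<in> borel_measurable (past t)"
        using less[of r] that past_later[of _ r _ t] noise_past[of r t] by auto
      have "(\<lambda>\<omega>. a * state P E K r \<omega> + ctrl P E K r \<omega> + noise P r \<omega>) \<in> borel_measurable (past t)"
        by measurable
      then show ?thesis unfolding Suc state_Suc[symmetric] .
    qed
    note st = this
    have before: "state P E K i \<in> borel_measurable (past t)"
      "chan P E K i \<in> past t \<rightarrow>\<^sub>M count_space UNIV" "ctrl P E K i \<in> borel_measurable (past t)"
      if "i < t" "t \<le> T" for i
    proof -
      have *: "i \<le> Suc T" "i \<le> T" using that by simp_all
      note IH = less[OF \<open>i < t\<close>]
      show "state P E K i \<in> borel_measurable (past t)"
        by (rule past_later[OF IH[THEN conjunct1, rule_format, OF *(1)]]) (use that in simp)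
      show "chan P E K i \<in> past t \<rightarrow>\<^sub>M count_space UNIV"
        by (rule past_later[OF IH[THEN conjunct2, rule_format, OF *(2), THEN conjunct1]]) (use that in simp)
      show "ctrl P E K i \<in> borel_measurable (past t)"
        by (rule past_later[OF IH[THEN conjunct2, rule_format, OF *(2), THEN conjunct2]]) (use that in simp)
    qed
    have x: "state P E K i \<in> borel_measurable (past t)" if "i \<le> t" "t \<le> T" for i
    proof (cases "i = t")
      case True
      then show ?thesis using st that by simp
    next
      case False
      then show ?thesis using before(1)[of i] that by simp
    qed
    show ?case
    proof (intro conjI impI)
      show "state P E K t \<in> borel_measurable (past t)" if "t \<le> Suc T" by (rule st[OF that])
      assume "t \<le> T"
      show "chan P E K t \<in> past t \<rightarrow>\<^sub>M count_space UNIV"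
        by (rule loop_measurable_step(1)[OF E K \<open>t \<le> T\<close> x before(2) before(3)]) (simp_all add: \<open>t \<le> T\<close>)
      show "ctrl P E K t \<in> borel_measurable (past t)"
        by (rule loop_measurable_step(2)[OF E K \<open>t \<le> T\<close> x before(2) before(3)]) (simp_all add: \<open>t \<le> T\<close>)
    qed
  qed
  show "state P E K t \<in> borel_measurable (past s)" if "t \<le> Suc T" "t \<le> s"
    by (rule past_later[OF _ that(2)]) (simp only: main that)
  show "chan P E K t \<in> past s \<rightarrow>\<^sub>M count_space UNIV" if "t \<le> T" "t \<le> s"
    by (rule past_later[OF _ that(2)]) (simp only: main that)
  show "ctrl P E K t \<in> borel_measurable (past s)" if "t \<le> T" "t \<le> s"
    by (rule past_later[OF _ that(2)]) (simp only: main that)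
qed

lemma chan_adapted:
  assumes E: "admissible_encoder P E" and K: "admissible_controller P K"
  shows "adapted (chan P E K)"
  unfolding adapted_def
proof (intro allI impI conjI)
  fix t \<omega> assume t: "t \<le> T"
  show "chan P E K t \<in> past t \<rightarrow>\<^sub>M count_space UNIV" using loop_past(2)[OF E K t] by simp
  show "chan P E K t \<omega> \<in> symbols" by (rule chan_symbols[OF E t])
qed

section \<open>Dynamic programming against a fixed decoder\<close>

text \<open>
  The alphabet that a process of finite cost can use; the rate constraint rules out all other symbols.
\<close>
definition letters :: "sym set" where
  "letters = {s \<in> symbols. fst s \<le> max_alph P}"

lemma finite_letters: "finite letters"
proof (rule finite_subset)
  show "letters \<subseteq> {..max_alph P} \<times> {..max_alph P}" by (auto simp: letters_def symbols_def)
qed simp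

lemma one_letter: "(1, 1) \<in> letters"
  using alphabet by (simp add: letters_def symbols_def)

lemma letters_symbols: "s \<in> letters \<Longrightarrow> s \<in> symbols"
  by (simp add: letters_def)

text \<open>
  The almost sure rate constraint as an additive cost: its integral is \<open>0\<close> if the constraint holds almost surely
  and \<open>\<top>\<close> otherwise. This lets dynamic programming treat the constraint as a terminal cost.
\<close>
definition penalty :: "(nat \<Rightarrow> sym) \<Rightarrow> ennreal" where
  "penalty z = (if (\<Sum>i\<le>T. phi P (fst (z i))) \<le> rate_budget P then 0 else \<top>)"

definition decoding_cost :: "(nat \<Rightarrow> (nat \<Rightarrow> sym) \<Rightarrow> real) \<Rightarrow> nat \<Rightarrow> real \<Rightarrow> (nat \<Rightarrow> sym) \<Rightarrow> ennreal" where
  "decoding_cost D t \<zeta> z = ennreal (lam P t * (\<zeta> - D t z)\<^sup>2) + ennreal (wt_comm P) * phi P (fst (z t))"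

text \<open>
  The optimal cost of encoding against the decoder \<open>D\<close>, by recursion on the number of stages left. The encoder
  observes \<open>\<zeta>\<close>, so the value is a function of the current \<open>\<zeta>\<close> and the output word alone, and no
  conditional expectation occurs.
\<close>
primrec cost_to_go_left :: "(nat \<Rightarrow> (nat \<Rightarrow> sym) \<Rightarrow> real) \<Rightarrow> nat \<Rightarrow> real \<Rightarrow> (nat \<Rightarrow> sym) \<Rightarrow> ennreal" where
  "cost_to_go_left D 0 \<zeta> z = penalty z"
| "cost_to_go_left D (Suc k) \<zeta> z = (INF s\<in>letters. decoding_cost D (T - k) \<zeta> (z(T - k := s))
     + (\<integral>\<^sup>+\<omega>. cost_to_go_left D k (a * \<zeta> + noise P (T - k) \<omega>) (z(T - k := s)) \<partial>M))"

definition cost_to_go where "cost_to_go D t = cost_to_go_left D (Suc T - t)"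

definition expected_to_go where
  "expected_to_go D t \<zeta> z = (\<integral>\<^sup>+\<omega>. cost_to_go D (Suc t) (a * \<zeta> + noise P t \<omega>) z \<partial>M)"

lemma cost_to_go_end: "cost_to_go D (Suc T) \<zeta> z = penalty z"
  by (simp add: cost_to_go_def)

lemma cost_to_go_step:
  assumes "t \<le> T"
  shows "cost_to_go D t \<zeta> z = (INF s\<in>letters. decoding_cost D t \<zeta> (z(t := s)) + expected_to_go D t \<zeta> (z(t := s)))"
proof -
  have *: "Suc T - t = Suc (T - t)" "T - (T - t) = t" using assms by auto
  show ?thesis
    unfolding cost_to_go_def expected_to_go_def diff_Suc_Suc * cost_to_go_left.simps ..
qed

lemma decoding_cost_measurable: "(\<lambda>\<zeta>. decoding_cost D t \<zeta> z) \<in> borel_measurable borel"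
  unfolding decoding_cost_def by measurable

lemma cost_to_go_measurable:
  assumes "t \<le> Suc T"
  shows "(\<lambda>\<zeta>. cost_to_go D t \<zeta> z) \<in> borel_measurable borel"
  using assms
proof (induction t arbitrary: z rule: inc_induct)
  case base
  show ?case by (simp add: cost_to_go_end)
next
  case (step t)
  then have t: "t \<le> T" by simp
  note step.IH[measurable] noise_measurable[OF t, measurable] decoding_cost_measurable[measurable]
  have [measurable]: "(\<lambda>\<zeta>. expected_to_go D t \<zeta> z) \<in> borel_measurable borel" for z
    unfolding expected_to_go_def by measurable
  show ?case unfolding cost_to_go_step[OF t]
    by (intro borel_measurable_INF countable_finite finite_letters) measurable
qed

lemma expected_to_go_measurable:
  assumes t: "t \<le> T"
  shows "(\<lambda>\<zeta>. expected_to_go D t \<zeta> z) \<in> borel_measurable borel"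
proof -
  have [measurable]: "noise P t \<in> borel_measurable M" "(\<lambda>\<zeta>. cost_to_go D (Suc t) \<zeta> z) \<in> borel_measurable borel"
    using noise_measurable[OF t] cost_to_go_measurable[of "Suc t"] t by simp_all
  show ?thesis unfolding expected_to_go_def by measurable
qed

lemma measurable_of_word:
  assumes Z: "adapted Z" and t: "t \<le> Suc T" and f: "\<And>z. z \<in> words t \<Longrightarrow> f z \<in> M \<rightarrow>\<^sub>M N"
  shows "(\<lambda>\<omega>. f (hist Z t \<omega>) \<omega>) \<in> M \<rightarrow>\<^sub>M N"
  by (rule measurable_compose_countable'[OF f hist_measurable[OF Z t] countable_words])

text \<open>
  The output word through time \<open>t\<close> and \<open>\<zeta>\<^bsub>t\<^esub>\<close> belong to the past of the noise that drives
  \<open>\<zeta>\<close> to its next value, so that noise can be integrated out first.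
\<close>
lemma cost_to_go_past:
  assumes Z: "adapted Z" and t: "t \<le> T"
  shows "(\<integral>\<^sup>+\<omega>. cost_to_go D (Suc t) (zeta P (Suc t) \<omega>) (hist Z (Suc t) \<omega>) \<partial>M)
    = (\<integral>\<^sup>+\<omega>. expected_to_go D t (zeta P t \<omega>) (hist Z (Suc t) \<omega>) \<partial>M)"
proof -
  let ?Y = "\<lambda>\<omega>. (hist Z (Suc t) \<omega>, zeta P t \<omega>)"
  let ?N = "count_space (words (Suc t)) \<Otimes>\<^sub>M (borel :: real measure)"
  let ?g = "\<lambda>((z, \<zeta>), v). cost_to_go D (Suc t) (a * \<zeta> + v) z"
  have Y: "?Y \<in> past t \<rightarrow>\<^sub>M ?N"
    by (intro measurable_Pair hist_past[OF Z] zeta_past) (use t in auto)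
  have vm: "(\<lambda>x. cost_to_go D (Suc t) x z) \<in> borel_measurable borel" for z
    using t by (intro cost_to_go_measurable) simp
  have "(\<lambda>x. cost_to_go D (Suc t) (a * snd (fst x) + snd x) (fst (fst x))) \<in> borel_measurable (?N \<Otimes>\<^sub>M borel)"
  proof (rule measurable_compose_countable'[OF _ _ countable_words])
    show "(\<lambda>x. fst (fst x)) \<in> ?N \<Otimes>\<^sub>M (borel::real measure) \<rightarrow>\<^sub>M count_space (words (Suc t))" by measurable
    show "(\<lambda>x. cost_to_go D (Suc t) (a * snd (fst x) + snd x) z) \<in> borel_measurable (?N \<Otimes>\<^sub>M borel)" for z
      by (rule measurable_compose[OF _ vm]) measurable
  qed
  then have g: "?g \<in> borel_measurable (?N \<Otimes>\<^sub>M borel)" by (simp add: split_beta')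
  show ?thesis
    using integrate_out_noise[OF t Y g] by (simp add: expected_to_go_def)
qed

definition running_cost where
  "running_cost D Z t \<omega> = decoding_cost D t (zeta P t \<omega>) (hist Z (Suc t) \<omega>)"

lemma running_cost_measurable:
  "adapted Z \<Longrightarrow> t \<le> T \<Longrightarrow> running_cost D Z t \<in> borel_measurable M"
  unfolding running_cost_def
  by (rule measurable_of_word[where f = "\<lambda>z \<omega>. decoding_cost D t (zeta P t \<omega>) z"])
     (auto intro: measurable_compose[OF _ decoding_cost_measurable])

lemma process_expected_to_go_measurable:
  "adapted Z \<Longrightarrow> t \<le> T \<Longrightarrow> (\<lambda>\<omega>. expected_to_go D t (zeta P t \<omega>) (hist Z (Suc t) \<omega>)) \<in> borel_measurable M"
  by (rule measurable_of_word[where f = "\<lambda>z \<omega>. expected_to_go D t (zeta P t \<omega>) z"])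
     (auto intro: measurable_compose[OF _ expected_to_go_measurable])

definition process_cost where
  "process_cost D Z = (\<integral>\<^sup>+\<omega>. (\<Sum>t\<le>T. running_cost D Z t \<omega>) + penalty (hist Z (Suc T) \<omega>) \<partial>M)"

lemma penalty_measurable:
  assumes "adapted Z" shows "(\<lambda>\<omega>. penalty (hist Z (Suc T) \<omega>)) \<in> borel_measurable M"
  by (rule measurable_of_word[OF assms le_refl, where f = "\<lambda>z \<omega>. penalty z"]) simp

lemma process_cost_split:
  assumes Z: "adapted Z"
  shows "process_cost D Z = (\<Sum>t\<le>T. \<integral>\<^sup>+\<omega>. running_cost D Z t \<omega> \<partial>M)
    + (\<integral>\<^sup>+\<omega>. cost_to_go D (Suc T) (zeta P (Suc T) \<omega>) (hist Z (Suc T) \<omega>) \<partial>M)"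
proof -
  have "(\<lambda>\<omega>. \<Sum>t\<le>T. running_cost D Z t \<omega>) \<in> borel_measurable M"
    by (intro borel_measurable_sum running_cost_measurable Z) simp
  then have "process_cost D Z = (\<integral>\<^sup>+\<omega>. (\<Sum>t\<le>T. running_cost D Z t \<omega>) \<partial>M) + (\<integral>\<^sup>+\<omega>. penalty (hist Z (Suc T) \<omega>) \<partial>M)"
    unfolding process_cost_def by (rule nn_integral_add[OF _ penalty_measurable[OF Z]])
  also have "(\<integral>\<^sup>+\<omega>. (\<Sum>t\<le>T. running_cost D Z t \<omega>) \<partial>M) = (\<Sum>t\<le>T. \<integral>\<^sup>+\<omega>. running_cost D Z t \<omega> \<partial>M)"
    by (rule nn_integral_sum) (simp add: running_cost_measurable Z)
  finally show ?thesis by (simp add: cost_to_go_end)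
qed

lemma nn_integral_process_step:
  assumes Z: "adapted Z" and t: "t \<le> T"
  shows "(\<integral>\<^sup>+\<omega>. running_cost D Z t \<omega> + expected_to_go D t (zeta P t \<omega>) (hist Z (Suc t) \<omega>) \<partial>M)
    = (\<integral>\<^sup>+\<omega>. running_cost D Z t \<omega> \<partial>M) + (\<integral>\<^sup>+\<omega>. cost_to_go D (Suc t) (zeta P (Suc t) \<omega>) (hist Z (Suc t) \<omega>) \<partial>M)"
  unfolding cost_to_go_past[OF Z t]
  by (rule nn_integral_add[OF running_cost_measurable[OF Z t] process_expected_to_go_measurable[OF Z t]])

text \<open>
  Verification: however the process chooses its letters, even with access to the whole past, it pays
  at least the minimum over letters at each stage. The bound accumulates forward in time.
\<close>
lemma cost_to_go_le_process_cost:
  assumes Z: "adapted Z" and letters: "AE \<omega> in M. \<forall>t\<le>T. Z t \<omega> \<in> letters"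
  shows "(\<integral>\<^sup>+\<omega>. cost_to_go D 0 (zeta P 0 \<omega>) (\<lambda>_. undefined) \<partial>M) \<le> process_cost D Z"
proof -
  have "(\<integral>\<^sup>+\<omega>. cost_to_go D 0 (zeta P 0 \<omega>) (\<lambda>_. undefined) \<partial>M)
      \<le> (\<Sum>s<t. \<integral>\<^sup>+\<omega>. running_cost D Z s \<omega> \<partial>M) + (\<integral>\<^sup>+\<omega>. cost_to_go D t (zeta P t \<omega>) (hist Z t \<omega>) \<partial>M)"
    if "t \<le> Suc T" for t
    using that
  proof (induction t)
    case 0
    then show ?case by (simp add: hist_0)
  next
    case (Suc t)
    then have t: "t \<le> T" by simp
    have "(\<integral>\<^sup>+\<omega>. cost_to_go D t (zeta P t \<omega>) (hist Z t \<omega>) \<partial>M)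
        \<le> (\<integral>\<^sup>+\<omega>. running_cost D Z t \<omega> + expected_to_go D t (zeta P t \<omega>) (hist Z (Suc t) \<omega>) \<partial>M)"
    proof (rule nn_integral_mono_AE)
      show "AE \<omega> in M. cost_to_go D t (zeta P t \<omega>) (hist Z t \<omega>)
          \<le> running_cost D Z t \<omega> + expected_to_go D t (zeta P t \<omega>) (hist Z (Suc t) \<omega>)"
        using letters
      proof eventually_elim
        case (elim \<omega>)
        show ?case unfolding cost_to_go_step[OF t] running_cost_def hist_Suc
          by (rule INF_lower) (use elim t in simp)
      qed
    qed
    then show ?case
      using Suc.IH t unfolding nn_integral_process_step[OF Z t]
      by (simp add: add.assoc) (meson add_left_mono order_trans)
  qed
  from this[of "Suc T"] show ?thesis
    unfolding process_cost_split[OF Z] lessThan_Suc_atMost by simp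
qed

text \<open>
  The same accumulation with equalities, for a process that picks a minimizing letter at each stage.
\<close>
lemma process_cost_eq_cost_to_go:
  assumes Z: "adapted Z"
    and opt: "\<And>t \<omega>. t \<le> T \<Longrightarrow> cost_to_go D t (zeta P t \<omega>) (hist Z t \<omega>)
       = running_cost D Z t \<omega> + expected_to_go D t (zeta P t \<omega>) (hist Z (Suc t) \<omega>)"
  shows "process_cost D Z = (\<integral>\<^sup>+\<omega>. cost_to_go D 0 (zeta P 0 \<omega>) (\<lambda>_. undefined) \<partial>M)"
proof -
  have "(\<integral>\<^sup>+\<omega>. cost_to_go D 0 (zeta P 0 \<omega>) (\<lambda>_. undefined) \<partial>M)
      = (\<Sum>s<t. \<integral>\<^sup>+\<omega>. running_cost D Z s \<omega> \<partial>M) + (\<integral>\<^sup>+\<omega>. cost_to_go D t (zeta P t \<omega>) (hist Z t \<omega>) \<partial>M)"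
    if "t \<le> Suc T" for t
    using that
  proof (induction t)
    case 0
    then show ?case by (simp add: hist_0)
  next
    case (Suc t)
    then have t: "t \<le> T" by simp
    have "(\<integral>\<^sup>+\<omega>. cost_to_go D t (zeta P t \<omega>) (hist Z t \<omega>) \<partial>M)
        = (\<integral>\<^sup>+\<omega>. running_cost D Z t \<omega> + expected_to_go D t (zeta P t \<omega>) (hist Z (Suc t) \<omega>) \<partial>M)"
      by (rule nn_integral_cong) (rule opt[OF t])
    then show ?case
      using Suc.IH t unfolding nn_integral_process_step[OF Z t]
      by (simp add: add.assoc)
  qed
  from this[of "Suc T"] show ?thesis
    unfolding process_cost_split[OF Z] lessThan_Suc_atMost by simp
qed

section \<open>Controls-forgetting strategies\<close>

text \<open>
  A strategy acts on \<open>\<zeta>\<close> only, so its outputs can be generated without a controller. That the closed loop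
  produces the same outputs under every controller is \<open>chan_forget_outputs\<close>.
\<close>
primrec strategy_word :: "strategy \<Rightarrow> nat \<Rightarrow> 'w \<Rightarrow> nat \<Rightarrow> sym" where
  "strategy_word \<epsilon> 0 \<omega> = (\<lambda>_. undefined)"
| "strategy_word \<epsilon> (Suc t) \<omega> = (strategy_word \<epsilon> t \<omega>)(t := \<epsilon> t (strategy_word \<epsilon> t \<omega>) (zeta P t \<omega>))"

definition outputs :: "strategy \<Rightarrow> nat \<Rightarrow> 'w \<Rightarrow> sym" where
  "outputs \<epsilon> t \<omega> = \<epsilon> t (strategy_word \<epsilon> t \<omega>) (zeta P t \<omega>)"

lemma strategy_word_eq: "strategy_word \<epsilon> t \<omega> = hist (outputs \<epsilon>) t \<omega>"
  by (induction t) (simp_all only: strategy_word.simps hist_0 hist_Suc outputs_def)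

lemma outputs_eq: "outputs \<epsilon> t \<omega> = \<epsilon> t (hist (outputs \<epsilon>) t \<omega>) (zeta P t \<omega>)"
  unfolding outputs_def[of \<epsilon> t] strategy_word_eq ..

lemma chan_forget_outputs: "chan P (forget_enc P \<epsilon>) K t \<omega> = outputs \<epsilon> t \<omega>"
proof (induction t rule: less_induct)
  case (less t)
  then have "(\<lambda>i\<in>{..<t}. chan P (forget_enc P \<epsilon>) K i \<omega>) = hist (outputs \<epsilon>) t \<omega>"
    unfolding hist_def by (intro restrict_ext) simp
  then show ?case
    unfolding chan_forget_enc[of P \<epsilon> K t \<omega>] outputs_eq[of \<epsilon> t \<omega>] by simp
qed

lemma quant_strategy_map: 
  assumes "quant_strategy P \<epsilon>" "t \<le> T"
  shows "\<epsilon> t z \<in> borel \<rightarrow>\<^sub>M count_space UNIV" "\<epsilon> t z x \<in> symbols"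
proof -
  have "\<epsilon> t z \<in> quant_maps" using assms by (simp add: quant_strategy_def)
  then show "\<epsilon> t z \<in> borel \<rightarrow>\<^sub>M count_space UNIV" "\<epsilon> t z x \<in> symbols"
    unfolding quant_maps_def by auto
qed

lemma outputs_adapted:
  assumes \<epsilon>: "quant_strategy P \<epsilon>"
  shows "adapted (outputs \<epsilon>)"
  unfolding adapted_def
proof (intro allI impI conjI)
  fix t \<omega> assume t: "t \<le> T"
  show "outputs \<epsilon> t \<omega> \<in> symbols" unfolding outputs_def by (rule quant_strategy_map(2)[OF \<epsilon> t])
  show "outputs \<epsilon> t \<in> past t \<rightarrow>\<^sub>M count_space UNIV" using t
  proof (induction t rule: less_induct)
    case (less t)
    have h: "hist (outputs \<epsilon>) t \<in> past t \<rightarrow>\<^sub>M count_space (words t)"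
    proof (rule hist_measurable_of_outputs)
      fix i assume i: "i < t"
      then have iT: "i \<le> T" using less.prems by simp
      show "outputs \<epsilon> i \<in> past t \<rightarrow>\<^sub>M count_space UNIV"
        by (rule past_later[OF less.IH[OF i iT]]) (use i in simp)
      show "outputs \<epsilon> i \<omega> \<in> symbols" for \<omega>
        unfolding outputs_def by (rule quant_strategy_map(2)[OF \<epsilon> iT])
    qed
    have "(\<lambda>\<omega>. \<epsilon> t (hist (outputs \<epsilon>) t \<omega>) (zeta P t \<omega>)) \<in> past t \<rightarrow>\<^sub>M count_space UNIV"
      by (rule measurable_compose_countable'[OF _ h countable_words])
         (rule measurable_compose[OF zeta_past[OF le_refl] quant_strategy_map(1)[OF \<epsilon> less.prems]])
    then show ?case unfolding outputs_eq[symmetric] .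
  qed
qed

definition best_map where
  "best_map D t z = (SOME e. e \<in> quant_maps \<and> range e \<subseteq> letters \<and>
     (\<forall>\<zeta>. \<forall>s\<in>letters. decoding_cost D t \<zeta> (z(t := e \<zeta>)) + expected_to_go D t \<zeta> (z(t := e \<zeta>))
        \<le> decoding_cost D t \<zeta> (z(t := s)) + expected_to_go D t \<zeta> (z(t := s))))"

lemma best_map:
  assumes t: "t \<le> T"
  shows "best_map D t z \<in> quant_maps"
    and "cost_to_go D t \<zeta> z = decoding_cost D t \<zeta> (z(t := best_map D t z \<zeta>)) + expected_to_go D t \<zeta> (z(t := best_map D t z \<zeta>))"
proof -
  let ?g = "\<lambda>s \<zeta>. decoding_cost D t \<zeta> (z(t := s)) + expected_to_go D t \<zeta> (z(t := s))"
  have "\<exists>e \<in> borel \<rightarrow>\<^sub>M count_space UNIV. range e \<subseteq> letters \<and> (\<forall>x. \<forall>s\<in>letters. ?g (e x) x \<le> ?g s x)"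
    by (rule finite_measurable_argmin[OF finite_letters])
       (use one_letter in \<open>auto intro!: borel_measurable_add decoding_cost_measurable expected_to_go_measurable[OF t]\<close>)
  then have "\<exists>e. e \<in> quant_maps \<and> range e \<subseteq> letters \<and> (\<forall>x. \<forall>s\<in>letters. ?g (e x) x \<le> ?g s x)"
    unfolding quant_maps_def using letters_symbols by blast
  from someI_ex[OF this, folded best_map_def]
  have *: "best_map D t z \<in> quant_maps" "range (best_map D t z) \<subseteq> letters"
    "\<And>x s. s \<in> letters \<Longrightarrow> ?g (best_map D t z x) x \<le> ?g s x" by blast+
  show "best_map D t z \<in> quant_maps" by fact
  show "cost_to_go D t \<zeta> z = ?g (best_map D t z \<zeta>) \<zeta>"
    unfolding cost_to_go_step[OF t]
    by (rule antisym) (use * in \<open>auto intro!: INF_lower INF_greatest\<close>)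
qed

text \<open>
  A single symbol outside the alphabet already makes the communication sum infinite, hence larger than
  the budget.
\<close>
lemma penalty_finite_letters:
  assumes Z: "adapted Z" and fin: "process_cost D Z < \<top>"
  shows "AE \<omega> in M. penalty (hist Z (Suc T) \<omega>) = 0" "AE \<omega> in M. \<forall>t\<le>T. Z t \<omega> \<in> letters"
proof -
  have "(\<integral>\<^sup>+\<omega>. penalty (hist Z (Suc T) \<omega>) \<partial>M) \<le> process_cost D Z"
    unfolding process_cost_def by (intro nn_integral_mono) simp
  then have "AE \<omega> in M. penalty (hist Z (Suc T) \<omega>) \<noteq> \<infinity>"
    using fin by (intro nn_integral_PInf_AE penalty_measurable Z) (auto simp: top_unique)
  then show *: "AE \<omega> in M. penalty (hist Z (Suc T) \<omega>) = 0"
    by eventually_elim (simp add: penalty_def split: if_splits)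
  then show "AE \<omega> in M. \<forall>t\<le>T. Z t \<omega> \<in> letters"
  proof eventually_elim
    case (elim \<omega>)
    have fin: "(\<Sum>i\<le>T. phi P (fst (Z i \<omega>))) < \<top>"
    proof -
      have "(\<Sum>i\<le>T. phi P (fst (Z i \<omega>))) = (\<Sum>i\<le>T. phi P (fst (hist Z (Suc T) \<omega> i)))"
        by (rule sum.cong) (simp_all add: hist_def)
      also have "\<dots> \<le> rate_budget P" using elim by (simp add: penalty_def split: if_splits)
      also have "\<dots> < \<top>" by (simp add: rate_budget_def)
      finally show ?thesis .
    qed
    show ?case
    proof (intro allI impI)
      fix t assume t: "t \<le> T"
      have "phi P (fst (Z t \<omega>)) \<le> (\<Sum>i\<le>T. phi P (fst (Z i \<omega>)))"
        using t by (intro member_le_sum) auto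
      then have "phi P (fst (Z t \<omega>)) < \<top>" using fin by (rule order.strict_trans1)
      then have "fst (Z t \<omega>) \<le> max_alph P" by (simp add: phi_def split: if_splits)
      moreover have "Z t \<omega> \<in> symbols" using Z t by (simp add: adapted_def)
      ultimately show "Z t \<omega> \<in> letters" by (simp add: letters_def)
    qed
  qed
qed

text \<open>
  The decoder stays fixed while the encoder improves. An encoder with memory has no advantage against a fixed
  decoder, since the future cost depends on the past only through \<open>\<zeta>\<^bsub>t\<^esub>\<close> and the output word.
\<close>
lemma forgetting_encoder_suffices:
  assumes Z: "adapted Z"
  shows "\<exists>\<epsilon>. quant_strategy P \<epsilon> \<and> process_cost D (outputs \<epsilon>) \<le> process_cost D Z"
proof (cases "process_cost D Z < \<top>")
  case True
  let ?\<epsilon> = "best_map D"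
  have \<epsilon>: "quant_strategy P ?\<epsilon>" unfolding quant_strategy_def using best_map(1) by blast
  have "process_cost D (outputs ?\<epsilon>) = (\<integral>\<^sup>+\<omega>. cost_to_go D 0 (zeta P 0 \<omega>) (\<lambda>_. undefined) \<partial>M)"
  proof (rule process_cost_eq_cost_to_go[OF outputs_adapted[OF \<epsilon>]])
    fix t \<omega> assume t: "t \<le> T"
    show "cost_to_go D t (zeta P t \<omega>) (hist (outputs ?\<epsilon>) t \<omega>) = running_cost D (outputs ?\<epsilon>) t \<omega>
        + expected_to_go D t (zeta P t \<omega>) (hist (outputs ?\<epsilon>) (Suc t) \<omega>)"
      unfolding running_cost_def hist_Suc outputs_eq[of ?\<epsilon> t \<omega>] by (rule best_map(2)[OF t])
  qed
  also have "\<dots> \<le> process_cost D Z"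
    by (rule cost_to_go_le_process_cost[OF Z penalty_finite_letters(2)[OF Z True]])
  finally show ?thesis using \<epsilon> by blast
next
  case False
  have "quant_strategy P (\<lambda>_ _ _. (1, 1))"
    by (auto simp: quant_strategy_def quant_maps_def symbols_def)
  then show ?thesis using False by (metis not_less_iff_gr_or_eq top.not_eq_extremum top_greatest)
qed

section \<open>Completing the squares\<close>

lemma beta_end: "beta P (Suc T) = 1"
  by (subst beta.simps) simp

lemma beta_step:
  "t \<le> T \<Longrightarrow> beta P t = wt_state P + a\<^sup>2 * wt_ctrl P * beta P (Suc t) / (wt_ctrl P + beta P (Suc t))"
  by (subst beta.simps) simp

lemma beta_pos: "t \<le> Suc T \<Longrightarrow> beta P t > 0"
proof (induction t rule: inc_induct)
  case base
  then show ?case by (simp add: beta_end)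
next
  case (step t)
  then have "0 \<le> a\<^sup>2 * wt_ctrl P * beta P (Suc t) / (wt_ctrl P + beta P (Suc t))"
    using wt_ctrl_pos by (intro divide_nonneg_pos mult_nonneg_nonneg add_pos_pos) auto
  then show ?case using step wt_state_pos by (subst beta_step) auto
qed

lemma lam_nonneg: "t \<le> T \<Longrightarrow> lam P t \<ge> 0"
  unfolding lam_def using beta_pos[of "Suc t"] wt_ctrl_pos
  by (intro divide_nonneg_pos mult_nonneg_nonneg add_pos_pos) auto

lemma lam_eq: "t \<le> T \<Longrightarrow> lam P t = (wt_ctrl P + beta P (Suc t)) * (kgain P t)\<^sup>2"
  unfolding lam_def kgain_def using beta_pos[of "Suc t"] wt_ctrl_pos
  by (simp add: power_divide power_mult_distrib power2_eq_square)

text \<open>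
  One stage of the Riccati recursion: the coefficient of \<open>x\<^sup>2\<close> on the right is \<open>beta\<close> at time \<open>t\<close> when
  \<open>b\<close> is \<open>beta\<close> at time \<open>t + 1\<close>.
\<close>
lemma one_step_square:
  fixes q b p x u w c :: real
  assumes "q + b \<noteq> 0"
  shows "p * x\<^sup>2 + q * u\<^sup>2 + b * (c * x + u + w)\<^sup>2
    = (p + c\<^sup>2 * q * b / (q + b)) * x\<^sup>2 + (q + b) * (u + c * b / (q + b) * x)\<^sup>2
      + 2 * b * ((c * x + u) * w) + b * w\<^sup>2"
proof -
  let ?s = "q + b"
  define d where "d = c * b / ?s"
  have "?s * d = c * b" using assms by (simp add: d_def)
  moreover have "c\<^sup>2 * b\<^sup>2 / ?s = ?s * d\<^sup>2"
    using assms by (simp add: d_def power_divide power_mult_distrib) (simp add: power2_eq_square)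
  moreover have "?s * (u + d * x)\<^sup>2 = ?s * u\<^sup>2 + 2 * (?s * d) * x * u + (?s * d\<^sup>2) * x\<^sup>2"
    by (simp add: power2_eq_square algebra_simps)
  ultimately have "?s * (u + c * b / ?s * x)\<^sup>2 = ?s * u\<^sup>2 + 2 * c * b * x * u + c\<^sup>2 * b\<^sup>2 / ?s * x\<^sup>2"
    unfolding d_def[symmetric] by simp
  moreover have "c\<^sup>2 * q * b / ?s + c\<^sup>2 * b\<^sup>2 / ?s = c\<^sup>2 * b"
    using assms by (simp add: add_divide_distrib[symmetric] divide_eq_eq power2_eq_square algebra_simps)
  then have "c\<^sup>2 * q * b / ?s * x\<^sup>2 + c\<^sup>2 * b\<^sup>2 / ?s * x\<^sup>2 = c\<^sup>2 * b * x\<^sup>2"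
    by (metis distrib_right)
  ultimately show ?thesis
    by (simp add: power2_sum power_mult_distrib algebra_simps)
qed

lemma complete_squares:
  fixes x u w :: "nat \<Rightarrow> real"
  assumes dyn: "\<And>t. t \<le> T \<Longrightarrow> x (Suc t) = a * x t + u t + w t"
  shows "quad_cost P x u = (beta P 0 - wt_state P) * (x 0)\<^sup>2
    + (\<Sum>t\<le>T. (wt_ctrl P + beta P (Suc t)) * (u t + kgain P t * x t)\<^sup>2
        + 2 * beta P (Suc t) * ((a * x t + u t) * w t) + beta P (Suc t) * (w t)\<^sup>2)"
proof -
  have step: "wt_state P * (x t)\<^sup>2 + wt_ctrl P * (u t)\<^sup>2 + beta P (Suc t) * (x (Suc t))\<^sup>2
      = beta P t * (x t)\<^sup>2 + ((wt_ctrl P + beta P (Suc t)) * (u t + kgain P t * x t)\<^sup>2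
        + 2 * beta P (Suc t) * ((a * x t + u t) * w t) + beta P (Suc t) * (w t)\<^sup>2)" if t: "t \<le> T" for t
  proof -
    have "wt_ctrl P + beta P (Suc t) \<noteq> 0" using beta_pos[of "Suc t"] wt_ctrl_pos t by simp
    from one_step_square[OF this, of "wt_state P" "x t" "u t" a "w t"] show ?thesis
      unfolding dyn[OF t] beta_step[OF t] kgain_def by (simp add: add.assoc)
  qed
  \<comment> \<open>Summing the stages telescopes. The cost has no term in the initial state, hence the subtracted
    state weight in front of its square.\<close>
  have tel: "(\<Sum>t\<le>T. beta P (Suc t) * (x (Suc t))\<^sup>2 - beta P t * (x t)\<^sup>2)
      = beta P (Suc T) * (x (Suc T))\<^sup>2 - beta P 0 * (x 0)\<^sup>2"
    using sum_lessThan_telescope[of "\<lambda>t. beta P t * (x t)\<^sup>2" "Suc T"] by (simp add: lessThan_Suc_atMost)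
  have "(\<Sum>i\<le>T. (x i)\<^sup>2) = (x 0)\<^sup>2 + (\<Sum>i=1..T. (x i)\<^sup>2)"
    by (simp add: atMost_atLeast0 sum.atLeast_Suc_atMost)
  then have "quad_cost P x u = beta P (Suc T) * (x (Suc T))\<^sup>2 - wt_state P * (x 0)\<^sup>2
      + (\<Sum>t\<le>T. wt_state P * (x t)\<^sup>2 + wt_ctrl P * (u t)\<^sup>2)"
    by (simp add: quad_cost_def beta_end sum.distrib sum_distrib_left[symmetric] algebra_simps)
  also have "\<dots> = (beta P 0 - wt_state P) * (x 0)\<^sup>2
      + (\<Sum>t\<le>T. (wt_state P * (x t)\<^sup>2 + wt_ctrl P * (u t)\<^sup>2 + beta P (Suc t) * (x (Suc t))\<^sup>2) - beta P t * (x t)\<^sup>2)"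
    using tel by (simp add: sum.distrib sum_subtractf algebra_simps)
  also have "\<dots> = (beta P 0 - wt_state P) * (x 0)\<^sup>2
    + (\<Sum>t\<le>T. (wt_ctrl P + beta P (Suc t)) * (u t + kgain P t * x t)\<^sup>2
        + 2 * beta P (Suc t) * ((a * x t + u t) * w t) + beta P (Suc t) * (w t)\<^sup>2)"
    by (intro arg_cong2[where f = "(+)"] refl sum.cong) (use step in auto)
  finally show ?thesis .
qed

lemma quad_cost_nonneg: "quad_cost P x u \<ge> 0"
  unfolding quad_cost_def using wt_state_pos wt_ctrl_pos
  by (intro add_nonneg_nonneg mult_nonneg_nonneg sum_nonneg) auto

section \<open>The expected quadratic cost\<close>

text \<open>
  Square integrability is the invariant of all signals of finite cost: it is preserved by the plant
  and by conditional means, and it makes the cross terms with the noise integrable.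
\<close>
definition L2 :: "('w \<Rightarrow> real) \<Rightarrow> bool" where
  "L2 f \<longleftrightarrow> f \<in> borel_measurable M \<and> integrable M (\<lambda>\<omega>. (f \<omega>)\<^sup>2)"

lemma L2_add: "L2 f \<Longrightarrow> L2 g \<Longrightarrow> L2 (\<lambda>\<omega>. f \<omega> + g \<omega>)"
proof -
  assume fg: "L2 f" "L2 g"
  then have [measurable]: "f \<in> borel_measurable M" "g \<in> borel_measurable M"
    and i: "integrable M (\<lambda>\<omega>. 2 * (f \<omega>)\<^sup>2 + 2 * (g \<omega>)\<^sup>2)"
    by (auto simp: L2_def)
  have "integrable M (\<lambda>\<omega>. (f \<omega> + g \<omega>)\<^sup>2)"
  proof (rule Bochner_Integration.integrable_bound[OF i], measurable, rule AE_I2)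
    fix \<omega>
    have "(f \<omega> + g \<omega>)\<^sup>2 \<le> 2 * (f \<omega>)\<^sup>2 + 2 * (g \<omega>)\<^sup>2"
      using sum_squares_ge_zero[of "f \<omega> - g \<omega>" 0] by (simp add: power2_eq_square algebra_simps)
    then show "norm ((f \<omega> + g \<omega>)\<^sup>2) \<le> norm (2 * (f \<omega>)\<^sup>2 + 2 * (g \<omega>)\<^sup>2)" by simp
  qed
  then show ?thesis by (simp add: L2_def)
qed

lemma L2_cmult: "L2 f \<Longrightarrow> L2 (\<lambda>\<omega>. c * f \<omega>)"
  by (auto simp: L2_def power_mult_distrib)

lemma L2_const: "L2 (\<lambda>\<omega>. c)"
  by (simp add: L2_def)

lemma L2_sum: "(\<And>i. i \<in> I \<Longrightarrow> L2 (f i)) \<Longrightarrow> L2 (\<lambda>\<omega>. \<Sum>i\<in>I. f i \<omega>)"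
  by (induction I rule: infinite_finite_induct) (auto intro: L2_add simp: L2_const)

lemma L2_imp_integrable: "L2 f \<Longrightarrow> integrable M f"
  by (simp add: L2_def square_integrable_imp_integrable)

lemma L2_AE_cong: "L2 f \<Longrightarrow> AE \<omega> in M. f \<omega> = g \<omega> \<Longrightarrow> g \<in> borel_measurable M \<Longrightarrow> L2 g"
proof -
  assume f: "L2 f" and ae: "AE \<omega> in M. f \<omega> = g \<omega>" and [measurable]: "g \<in> borel_measurable M"
  have "integrable M (\<lambda>\<omega>. (g \<omega>)\<^sup>2)"
    by (rule integrable_cong_AE_imp[of _ "\<lambda>\<omega>. (f \<omega>)\<^sup>2"]) (use f ae in \<open>auto simp: L2_def\<close>)
  then show ?thesis by (simp add: L2_def)
qed

lemma L2_init: "L2 (init P)"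
  using init_L2 by (simp add: L2_def)

lemma L2_noise: "t \<le> T \<Longrightarrow> L2 (noise P t)"
  using noise_L2 by (simp add: L2_def)

lemma L2_zeta: "t \<le> Suc T \<Longrightarrow> L2 (zeta P t)"
proof (induction t)
  case 0
  have "zeta P 0 = init P" by (rule ext) simp
  then show ?case using L2_init by simp
next
  case (Suc t)
  then have "L2 (\<lambda>\<omega>. a * zeta P t \<omega> + noise P t \<omega>)" by (intro L2_add L2_cmult L2_noise) auto
  moreover have "zeta P (Suc t) = (\<lambda>\<omega>. a * zeta P t \<omega> + noise P t \<omega>)" by (rule ext) simp
  ultimately show ?case by simp
qed

lemma state_from_zeta:
  "state P E K t \<omega> = zeta P t \<omega> + (\<Sum>j<t. a ^ (t - 1 - j) * ctrl P E K j \<omega>)"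
  using state_minus_controls[of P t \<omega> E K] by simp

lemma L2_state:
  assumes "t \<le> Suc T" "\<And>j. j < t \<Longrightarrow> L2 (ctrl P E K j)"
  shows "L2 (state P E K t)"
proof -
  have "L2 (\<lambda>\<omega>. zeta P t \<omega> + (\<Sum>j<t. a ^ (t - 1 - j) * ctrl P E K j \<omega>))"
    using assms by (intro L2_add L2_zeta L2_sum L2_cmult) auto
  moreover have "state P E K t = (\<lambda>\<omega>. zeta P t \<omega> + (\<Sum>j<t. a ^ (t - 1 - j) * ctrl P E K j \<omega>))"
    by (rule ext) (rule state_from_zeta)
  ultimately show ?thesis by simp
qed

text \<open>
  The part of the quadratic cost that no design can influence; it is the full-information optimum.
\<close>
definition base_cost :: real where
  "base_cost = (beta P 0 - wt_state P) * (\<integral>\<omega>. (init P \<omega>)\<^sup>2 \<partial>M)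
     + (\<Sum>t\<le>T. beta P (Suc t) * (\<integral>\<omega>. (noise P t \<omega>)\<^sup>2 \<partial>M))"

lemma base_cost_nonneg: "base_cost \<ge> 0"
proof -
  have "beta P 0 - wt_state P \<ge> 0"
    using beta_step[of 0] beta_pos[of "Suc 0"] wt_ctrl_pos by simp
  then show ?thesis
    unfolding base_cost_def
    by (intro add_nonneg_nonneg mult_nonneg_nonneg sum_nonneg) (auto intro: less_imp_le beta_pos)
qed

text \<open>
  The penalty for deviating at time \<open>t\<close> from the control that is optimal when the state is known.
\<close>
definition excess :: "encoder \<Rightarrow> controller \<Rightarrow> nat \<Rightarrow> 'w \<Rightarrow> real" where
  "excess E K t \<omega> = (wt_ctrl P + beta P (Suc t)) * (ctrl P E K t \<omega> + kgain P t * state P E K t \<omega>)\<^sup>2"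

lemma excess_nonneg: "t \<le> T \<Longrightarrow> excess E K t \<omega> \<ge> 0"
  unfolding excess_def using beta_pos[of "Suc t"] wt_ctrl_pos by simp

text \<open>
  After completing the squares, the only terms without a sign are products of the noise with functions of its
  past, and these have mean zero.
\<close>
lemma expected_quad_cost:
  assumes E: "admissible_encoder P E" and K: "admissible_controller P K"
    and u: "\<And>t. t \<le> T \<Longrightarrow> L2 (ctrl P E K t)"
  shows "(\<integral>\<^sup>+\<omega>. ennreal (quad_cost P (\<lambda>i. state P E K i \<omega>) (\<lambda>i. ctrl P E K i \<omega>)) \<partial>M)
    = ennreal base_cost + (\<integral>\<^sup>+\<omega>. (\<Sum>t\<le>T. ennreal (excess E K t \<omega>)) \<partial>M)"
proof -
  let ?x = "\<lambda>t. state P E K t" and ?u = "\<lambda>t. ctrl P E K t" and ?b = "\<lambda>t. beta P (Suc t)"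
  let ?cross = "\<lambda>t \<omega>. (a * ?x t \<omega> + ?u t \<omega>) * noise P t \<omega>"
  have x: "L2 (?x t)" if "t \<le> T" for t using that u by (intro L2_state) auto
  have cross: "integrable M (?cross t)" "(\<integral>\<omega>. ?cross t \<omega> \<partial>M) = 0" if t: "t \<le> T" for t
  proof -
    have m: "(\<lambda>\<omega>. a * ?x t \<omega> + ?u t \<omega>) \<in> borel_measurable (past t)"
      using loop_past(1,3)[OF E K _ le_refl, of t] t
      by (intro borel_measurable_add borel_measurable_times borel_measurable_const) auto
    have i: "integrable M (\<lambda>\<omega>. a * ?x t \<omega> + ?u t \<omega>)"
      using x u t by (intro L2_imp_integrable L2_add L2_cmult) auto
    show "integrable M (?cross t)" "(\<integral>\<omega>. ?cross t \<omega> \<partial>M) = 0"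
      by (rule noise_orthogonal[OF t m i])+
  qed
  have exc: "integrable M (excess E K t)" if t: "t \<le> T" for t
  proof -
    have "L2 (\<lambda>\<omega>. ?u t \<omega> + kgain P t * ?x t \<omega>)" using x u t by (intro L2_add L2_cmult) auto
    then show ?thesis unfolding excess_def L2_def by simp
  qed
  have eq: "quad_cost P (\<lambda>i. ?x i \<omega>) (\<lambda>i. ?u i \<omega>) = (beta P 0 - wt_state P) * (init P \<omega>)\<^sup>2
      + (\<Sum>t\<le>T. excess E K t \<omega> + 2 * ?b t * ?cross t \<omega> + ?b t * (noise P t \<omega>)\<^sup>2)" for \<omega>
    using complete_squares[of "\<lambda>i. ?x i \<omega>" "\<lambda>i. ?u i \<omega>" "\<lambda>i. noise P i \<omega>"]
    by (simp add: state_Suc state_0 excess_def)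
  have int: "integrable M (\<lambda>\<omega>. quad_cost P (\<lambda>i. ?x i \<omega>) (\<lambda>i. ?u i \<omega>))"
    unfolding eq using exc cross noise_L2 init_L2
    by (intro Bochner_Integration.integrable_add Bochner_Integration.integrable_sum integrable_mult_right) auto
  have one: "(\<integral>\<omega>. excess E K t \<omega> + 2 * ?b t * ?cross t \<omega> + ?b t * (noise P t \<omega>)\<^sup>2 \<partial>M)
      = (\<integral>\<omega>. excess E K t \<omega> \<partial>M) + ?b t * (\<integral>\<omega>. (noise P t \<omega>)\<^sup>2 \<partial>M)" if t: "t \<le> T" for t
    using exc[OF t] cross[OF t] noise_L2[OF t] by simp
  have "(\<integral>\<omega>. quad_cost P (\<lambda>i. ?x i \<omega>) (\<lambda>i. ?u i \<omega>) \<partial>M)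
      = (\<integral>\<omega>. (beta P 0 - wt_state P) * (init P \<omega>)\<^sup>2 \<partial>M)
       + (\<integral>\<omega>. (\<Sum>t\<le>T. excess E K t \<omega> + 2 * ?b t * ?cross t \<omega> + ?b t * (noise P t \<omega>)\<^sup>2) \<partial>M)"
    unfolding eq using exc cross noise_L2 init_L2
    by (intro Bochner_Integration.integral_add Bochner_Integration.integrable_add
        Bochner_Integration.integrable_sum integrable_mult_right) auto
  also have "(\<integral>\<omega>. (\<Sum>t\<le>T. excess E K t \<omega> + 2 * ?b t * ?cross t \<omega> + ?b t * (noise P t \<omega>)\<^sup>2) \<partial>M)
      = (\<Sum>t\<le>T. \<integral>\<omega>. excess E K t \<omega> + 2 * ?b t * ?cross t \<omega> + ?b t * (noise P t \<omega>)\<^sup>2 \<partial>M)"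
    using exc cross noise_L2
    by (intro Bochner_Integration.integral_sum Bochner_Integration.integrable_add integrable_mult_right) auto
  also have "\<dots> = (\<Sum>t\<le>T. (\<integral>\<omega>. excess E K t \<omega> \<partial>M) + ?b t * (\<integral>\<omega>. (noise P t \<omega>)\<^sup>2 \<partial>M))"
    by (intro sum.cong refl one) simp
  finally have E_eq: "(\<integral>\<omega>. quad_cost P (\<lambda>i. ?x i \<omega>) (\<lambda>i. ?u i \<omega>) \<partial>M)
      = base_cost + (\<Sum>t\<le>T. \<integral>\<omega>. excess E K t \<omega> \<partial>M)"
    by (simp add: base_cost_def sum.distrib)
  have "(\<integral>\<^sup>+\<omega>. ennreal (quad_cost P (\<lambda>i. ?x i \<omega>) (\<lambda>i. ?u i \<omega>)) \<partial>M)
      = ennreal (\<integral>\<omega>. quad_cost P (\<lambda>i. ?x i \<omega>) (\<lambda>i. ?u i \<omega>) \<partial>M)"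
    using quad_cost_nonneg by (intro nn_integral_eq_integral[OF int]) simp
  also have "\<dots> = ennreal base_cost + (\<Sum>t\<le>T. ennreal (\<integral>\<omega>. excess E K t \<omega> \<partial>M))"
    unfolding E_eq using base_cost_nonneg excess_nonneg
    by (subst ennreal_plus) (auto intro!: sum_nonneg Bochner_Integration.integral_nonneg sum_ennreal[symmetric])
  also have "(\<Sum>t\<le>T. ennreal (\<integral>\<omega>. excess E K t \<omega> \<partial>M)) = (\<Sum>t\<le>T. \<integral>\<^sup>+\<omega>. ennreal (excess E K t \<omega>) \<partial>M)"
    using exc excess_nonneg by (intro sum.cong refl nn_integral_eq_integral[symmetric]) auto
  also have "\<dots> = (\<integral>\<^sup>+\<omega>. (\<Sum>t\<le>T. ennreal (excess E K t \<omega>)) \<partial>M)"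
    using exc by (intro nn_integral_sum[symmetric]) auto
  finally show ?thesis .
qed

text \<open>
  Since \<open>q > 0\<close>, finite cost bounds the second moments of the controls; the states then follow from the plant
  equation.
\<close>
lemma finite_quad_cost_L2:
  assumes E: "admissible_encoder P E" and K: "admissible_controller P K" and t: "t \<le> T"
    and fin: "(\<integral>\<^sup>+\<omega>. ennreal (quad_cost P (\<lambda>i. state P E K i \<omega>) (\<lambda>i. ctrl P E K i \<omega>)) \<partial>M) < \<top>"
  shows "L2 (ctrl P E K t)"
proof -
  have [measurable]: "ctrl P E K t \<in> borel_measurable M"
    using loop_past(3)[OF E K t le_refl] from_past t by (metis le_Suc_eq)
  have "(\<integral>\<^sup>+\<omega>. ennreal (wt_ctrl P * (ctrl P E K t \<omega>)\<^sup>2) \<partial>M)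
      \<le> (\<integral>\<^sup>+\<omega>. ennreal (quad_cost P (\<lambda>i. state P E K i \<omega>) (\<lambda>i. ctrl P E K i \<omega>)) \<partial>M)"
  proof (intro nn_integral_mono ennreal_leI)
    fix \<omega>
    have "(ctrl P E K t \<omega>)\<^sup>2 \<le> (\<Sum>i\<le>T. (ctrl P E K i \<omega>)\<^sup>2)" using t by (intro member_le_sum) auto
    then have "wt_ctrl P * (ctrl P E K t \<omega>)\<^sup>2 \<le> wt_ctrl P * (\<Sum>i\<le>T. (ctrl P E K i \<omega>)\<^sup>2)"
      using wt_ctrl_pos by (intro mult_left_mono) auto
    moreover have "0 \<le> (state P E K (Suc T) \<omega>)\<^sup>2 + wt_state P * (\<Sum>i=1..T. (state P E K i \<omega>)\<^sup>2)"
      using wt_state_pos by (intro add_nonneg_nonneg mult_nonneg_nonneg sum_nonneg) auto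
    ultimately show "wt_ctrl P * (ctrl P E K t \<omega>)\<^sup>2 \<le> quad_cost P (\<lambda>i. state P E K i \<omega>) (\<lambda>i. ctrl P E K i \<omega>)"
      unfolding quad_cost_def by linarith
  qed
  then have "(\<integral>\<^sup>+\<omega>. ennreal (wt_ctrl P * (ctrl P E K t \<omega>)\<^sup>2) \<partial>M) < \<infinity>" using fin by simp
  then have "integrable M (\<lambda>\<omega>. wt_ctrl P * (ctrl P E K t \<omega>)\<^sup>2)"
    using wt_ctrl_pos by (intro integrableI_nonneg) auto
  then show ?thesis using wt_ctrl_pos by (simp add: L2_def)
qed

section \<open>The communication cost\<close>

definition comm_integral where
  "comm_integral Z = (\<integral>\<^sup>+\<omega>. (\<Sum>t\<le>T. ennreal (wt_comm P) * phi P (fst (Z t \<omega>))) + penalty (hist Z (Suc T) \<omega>) \<partial>M)"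

lemma output_measurable: "adapted Z \<Longrightarrow> t \<le> T \<Longrightarrow> Z t \<in> M \<rightarrow>\<^sub>M count_space UNIV"
  by (rule from_past[of _ t]) (auto simp: adapted_def)

lemma phi_measurable:
  assumes "adapted Z" "t \<le> T"
  shows "(\<lambda>\<omega>. phi P (fst (Z t \<omega>))) \<in> borel_measurable M"
  by (rule measurable_compose[OF output_measurable[OF assms]]) simp

lemma penalty_hist:
  "penalty (hist Z (Suc T) \<omega>) = (if (\<Sum>i\<le>T. phi P (fst (Z i \<omega>))) \<le> rate_budget P then 0 else \<top>)"
proof -
  have "(\<Sum>i\<le>T. phi P (fst (hist Z (Suc T) \<omega> i))) = (\<Sum>i\<le>T. phi P (fst (Z i \<omega>)))"
    by (rule sum.cong) (auto simp: hist_def)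
  then show ?thesis by (simp add: penalty_def)
qed

lemma comm_cost_eq:
  assumes Z: "adapted (chan P E K)"
  shows "comm_cost P E K = comm_integral (chan P E K)"
proof (cases "AE \<omega> in M. (\<Sum>i\<le>T. phi P (fst (chan P E K i \<omega>))) \<le> rate_budget P")
  case True
  have "comm_integral (chan P E K) = (\<integral>\<^sup>+\<omega>. ennreal (wt_comm P) * (\<Sum>t\<le>T. phi P (fst (chan P E K t \<omega>))) \<partial>M)"
    unfolding comm_integral_def penalty_hist
    using True by (intro nn_integral_cong_AE) (auto simp: sum_distrib_left elim: eventually_mono)
  also have "\<dots> = comm_cost P E K"
    using True unfolding comm_cost_def
    by (subst nn_integral_cmult) (auto intro!: borel_measurable_sum phi_measurable[OF Z])
  finally show ?thesis ..
next
  case False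
  have "comm_integral (chan P E K) = \<top>"
  proof (rule ccontr)
    assume fin: "comm_integral (chan P E K) \<noteq> \<top>"
    have "(\<integral>\<^sup>+\<omega>. penalty (hist (chan P E K) (Suc T) \<omega>) \<partial>M) \<le> comm_integral (chan P E K)"
      unfolding comm_integral_def by (intro nn_integral_mono) simp
    then have "AE \<omega> in M. penalty (hist (chan P E K) (Suc T) \<omega>) \<noteq> \<infinity>"
      using fin by (intro nn_integral_PInf_AE penalty_measurable Z) (auto simp: top_unique)
    then show False using False unfolding penalty_hist by (auto elim: eventually_mono split: if_splits)
  qed
  then show ?thesis using False by (simp add: comm_cost_def)
qed

lemma process_cost_eq:
  assumes Z: "adapted Z"
  shows "process_cost D Z = (\<integral>\<^sup>+\<omega>. (\<Sum>t\<le>T. ennreal (lam P t * (zeta P t \<omega> - D t (hist Z (Suc t) \<omega>))\<^sup>2)) \<partial>M)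
    + comm_integral Z"
proof -
  have err: "(\<lambda>\<omega>. ennreal (lam P t * (zeta P t \<omega> - D t (hist Z (Suc t) \<omega>))\<^sup>2)) \<in> borel_measurable M"
    if t: "t \<le> T" for t
  proof (rule measurable_of_word[OF Z, where f = "\<lambda>z \<omega>. ennreal (lam P t * (zeta P t \<omega> - D t z)\<^sup>2)"])
    have [measurable]: "zeta P t \<in> borel_measurable M" using t by simp
    show "(\<lambda>\<omega>. ennreal (lam P t * (zeta P t \<omega> - D t z)\<^sup>2)) \<in> borel_measurable M" for z by measurable
  qed (use t in simp)
  have com: "(\<lambda>\<omega>. (\<Sum>t\<le>T. ennreal (wt_comm P) * phi P (fst (Z t \<omega>))) + penalty (hist Z (Suc T) \<omega>)) \<in> borel_measurable M"
    by (intro borel_measurable_add penalty_measurable[OF Z] borel_measurable_sum borel_measurable_times_ennreal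
        phi_measurable[OF Z]) auto
  have "process_cost D Z = (\<integral>\<^sup>+\<omega>. (\<Sum>t\<le>T. ennreal (lam P t * (zeta P t \<omega> - D t (hist Z (Suc t) \<omega>))\<^sup>2))
      + ((\<Sum>t\<le>T. ennreal (wt_comm P) * phi P (fst (Z t \<omega>))) + penalty (hist Z (Suc T) \<omega>)) \<partial>M)"
    unfolding process_cost_def running_cost_def decoding_cost_def
    by (intro nn_integral_cong) (simp add: sum.distrib hist_def add.assoc)
  also have "\<dots> = (\<integral>\<^sup>+\<omega>. (\<Sum>t\<le>T. ennreal (lam P t * (zeta P t \<omega> - D t (hist Z (Suc t) \<omega>))\<^sup>2)) \<partial>M)
    + comm_integral Z"
    unfolding comm_integral_def
    by (rule nn_integral_add[OF _ com]) (intro borel_measurable_sum err, simp)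
  finally show ?thesis .
qed

section \<open>The decoder implied by a controller\<close>

text \<open>
  The value of \<open>\<zeta>\<^bsub>t\<^esub>\<close> for which the control at time \<open>t\<close> would be the optimal one. The controls are
  recomputed from the output word, so this is a function of the word. If the gain is \<open>0\<close> then so is \<open>lam\<close>, and the
  value \<open>0\<close> of the quotient serves as well as any other.
\<close>
definition implied_decoder :: "controller \<Rightarrow> nat \<Rightarrow> (nat \<Rightarrow> sym) \<Rightarrow> real" where
  "implied_decoder K t z = (let U = replay (restrict K {..<Suc t}) z (Suc t) in
     - (U t + kgain P t * (\<Sum>j<t. a ^ (t - 1 - j) * U j)) / kgain P t)"

lemma excess_implied_decoder:
  assumes t: "t \<le> T"
  shows "excess E K t \<omega> \<ge> lam P t * (zeta P t \<omega> - implied_decoder K t (hist (chan P E K) (Suc t) \<omega>))\<^sup>2"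
proof (cases "kgain P t = 0")
  case True
  then show ?thesis using excess_nonneg[OF t] lam_eq[OF t] by simp
next
  case False
  have U: "replay (restrict K {..<Suc t}) (hist (chan P E K) (Suc t) \<omega>) (Suc t) = (\<lambda>i\<in>{..<Suc t}. ctrl P E K i \<omega>)"
    unfolding hist_def by (rule replay_eq) simp
  have D: "implied_decoder K t (hist (chan P E K) (Suc t) \<omega>)
      = - (ctrl P E K t \<omega> + kgain P t * (\<Sum>j<t. a ^ (t - 1 - j) * ctrl P E K j \<omega>)) / kgain P t"
  proof -
    have "(\<Sum>j<t. a ^ (t - 1 - j) * (\<lambda>i\<in>{..<Suc t}. ctrl P E K i \<omega>) j) = (\<Sum>j<t. a ^ (t - 1 - j) * ctrl P E K j \<omega>)"
      by (rule sum.cong) auto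
    then show ?thesis unfolding implied_decoder_def U Let_def by simp
  qed
  have "ctrl P E K t \<omega> + kgain P t * state P E K t \<omega>
      = kgain P t * (zeta P t \<omega> - implied_decoder K t (hist (chan P E K) (Suc t) \<omega>))"
    unfolding D state_from_zeta[of E K t \<omega>] using False by (simp add: field_simps)
  then show ?thesis
    unfolding excess_def lam_eq[OF t] by (simp add: power_mult_distrib)
qed

text \<open>
  This separates the design problem: the controller enters the bound only as a decoder of the control-free
  state, and the encoder only through its outputs.
\<close>
lemma design_cost_lower_bound:
  assumes E: "admissible_encoder P E" and K: "admissible_controller P K"
  shows "ennreal base_cost + process_cost (implied_decoder K) (chan P E K) \<le> total_cost P E K"
proof (cases "total_cost P E K < \<top>")
  case True
  have Z: "adapted (chan P E K)" by (rule chan_adapted[OF E K])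
  have fin: "(\<integral>\<^sup>+\<omega>. ennreal (quad_cost P (\<lambda>i. state P E K i \<omega>) (\<lambda>i. ctrl P E K i \<omega>)) \<partial>M) < \<top>"
    using True unfolding total_cost_def by simp
  have "(\<integral>\<^sup>+\<omega>. (\<Sum>t\<le>T. ennreal (lam P t * (zeta P t \<omega> - implied_decoder K t (hist (chan P E K) (Suc t) \<omega>))\<^sup>2)) \<partial>M)
      \<le> (\<integral>\<^sup>+\<omega>. (\<Sum>t\<le>T. ennreal (excess E K t \<omega>)) \<partial>M)"
    by (intro nn_integral_mono sum_mono ennreal_leI excess_implied_decoder) simp
  moreover have "(\<integral>\<^sup>+\<omega>. ennreal (quad_cost P (\<lambda>i. state P E K i \<omega>) (\<lambda>i. ctrl P E K i \<omega>)) \<partial>M)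
      = ennreal base_cost + (\<integral>\<^sup>+\<omega>. (\<Sum>t\<le>T. ennreal (excess E K t \<omega>)) \<partial>M)"
    by (rule expected_quad_cost[OF E K finite_quad_cost_L2[OF E K _ fin]])
  ultimately show ?thesis
    unfolding total_cost_def process_cost_eq[OF Z] comm_cost_eq[OF Z]
    by (simp only: add.assoc[symmetric] add_left_mono add_right_mono)
next
  case False
  then show ?thesis by (simp add: less_top[symmetric])
qed

section \<open>Conditioning on an output word\<close>

definition cell :: "(nat \<Rightarrow> 'w \<Rightarrow> sym) \<Rightarrow> nat \<Rightarrow> (nat \<Rightarrow> sym) \<Rightarrow> 'w set" where
  "cell Z t z = {\<omega> \<in> space M. hist Z t \<omega> = z}"

definition given :: "(nat \<Rightarrow> 'w \<Rightarrow> sym) \<Rightarrow> nat \<Rightarrow> (nat \<Rightarrow> sym) \<Rightarrow> 'w measure" where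
  "given Z t z = uniform_measure M (cell Z t z)"

lemma cell_measurable:
  assumes "adapted Z" "t \<le> Suc T" "z \<in> words t"
  shows "cell Z t z \<in> sets M"
proof -
  have "hist Z t -` {z} \<inter> space M \<in> sets M"
    by (rule measurable_sets[OF hist_measurable[OF assms(1,2)]]) (use assms(3) in simp)
  also have "hist Z t -` {z} \<inter> space M = cell Z t z" by (auto simp: cell_def)
  finally show ?thesis .
qed

text \<open>
  The words partition the sample space into countably many cells.
\<close>
lemma integral_by_word:
  assumes Z: "adapted Z" and t: "t \<le> Suc T" and f[measurable]: "f \<in> borel_measurable M"
  shows "(\<integral>\<^sup>+\<omega>. f \<omega> \<partial>M) = (\<integral>\<^sup>+z. (\<integral>\<^sup>+\<omega>. f \<omega> * indicator (cell Z t z) \<omega> \<partial>M) \<partial>count_space (words t))"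
proof -
  have "(\<integral>\<^sup>+z. (\<integral>\<^sup>+\<omega>. f \<omega> * indicator (cell Z t z) \<omega> \<partial>M) \<partial>count_space (words t))
      = (\<integral>\<^sup>+\<omega>. (\<integral>\<^sup>+z. f \<omega> * indicator (cell Z t z) \<omega> \<partial>count_space (words t)) \<partial>M)"
    by (rule nn_integral_count_space_nn_integral[symmetric, OF countable_words])
       (intro borel_measurable_times_ennreal f borel_measurable_indicator cell_measurable[OF Z t])
  also have "\<dots> = (\<integral>\<^sup>+\<omega>. f \<omega> \<partial>M)"
  proof (rule nn_integral_cong)
    fix \<omega> assume \<omega>: "\<omega> \<in> space M"
    have h: "hist Z t \<omega> \<in> words t" by (rule hist_words[OF Z t])
    have "(\<integral>\<^sup>+z. f \<omega> * indicator (cell Z t z) \<omega> \<partial>count_space (words t))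
        = (\<integral>\<^sup>+z. f \<omega> * indicator {hist Z t \<omega>} z \<partial>count_space (words t))"
      using \<omega> by (intro nn_integral_cong) (auto simp: cell_def indicator_def)
    also have "\<dots> = f \<omega>" using h by (subst nn_integral_indicator_singleton) auto
    finally show "(\<integral>\<^sup>+z. f \<omega> * indicator (cell Z t z) \<omega> \<partial>count_space (words t)) = f \<omega>" .
  qed
  finally show ?thesis ..
qed

lemma nn_integral_given:
  assumes Z: "adapted Z" and t: "t \<le> Suc T" and z: "z \<in> words t" and f[measurable]: "f \<in> borel_measurable M"
  shows "(\<integral>\<^sup>+\<omega>. f \<omega> \<partial>given Z t z) * emeasure M (cell Z t z) = (\<integral>\<^sup>+\<omega>. f \<omega> * indicator (cell Z t z) \<omega> \<partial>M)"
proof (cases "emeasure M (cell Z t z) = 0")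
  case True
  have [measurable]: "cell Z t z \<in> sets M" by (rule cell_measurable[OF Z t z])
  have "AE \<omega> in M. \<omega> \<notin> cell Z t z" using True by (intro AE_not_in) auto
  then have "(\<integral>\<^sup>+\<omega>. f \<omega> * indicator (cell Z t z) \<omega> \<partial>M) = (\<integral>\<^sup>+\<omega>. 0 \<partial>M)"
    by (intro nn_integral_cong_AE) (auto elim: eventually_mono)
  then show ?thesis using True by simp
next
  case False
  then show ?thesis
    unfolding given_def nn_integral_uniform_measure[OF f cell_measurable[OF Z t z]]
    by (subst ennreal_divide_times) (simp add: ennreal_divide_self ennreal_times_divide emeasure_eq_measure mult.commute)
qed

lemma given_null:
  assumes Z: "adapted Z" and t: "t \<le> Suc T" and z: "z \<in> words t"
    and null: "emeasure M (cell Z t z) = 0" and f[measurable]: "f \<in> borel_measurable M"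
  shows "(\<integral>\<^sup>+\<omega>. f \<omega> \<partial>given Z t z) = 0"
proof -
  have [measurable]: "cell Z t z \<in> sets M" by (rule cell_measurable[OF Z t z])
  have "AE \<omega> in M. \<omega> \<notin> cell Z t z" using null by (intro AE_not_in) auto
  then have "(\<integral>\<^sup>+\<omega>. f \<omega> * indicator (cell Z t z) \<omega> \<partial>M) = (\<integral>\<^sup>+\<omega>. 0 \<partial>M)"
    by (intro nn_integral_cong_AE) (auto elim: eventually_mono)
  then show ?thesis
    unfolding given_def nn_integral_uniform_measure[OF f cell_measurable[OF Z t z]] using null by simp
qed

text \<open>
  The tower property for the countable partition into output words. Null cells contribute zero on both sides,
  so the zero measure that \<open>given\<close> yields there does no harm.
\<close>
lemma tower:
  assumes Z: "adapted Z" and t: "t \<le> Suc T" and F: "\<And>z. z \<in> words t \<Longrightarrow> F z \<in> borel_measurable M"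
  shows "(\<integral>\<^sup>+\<omega>. (\<integral>\<^sup>+\<omega>'. F (hist Z t \<omega>) \<omega>' \<partial>given Z t (hist Z t \<omega>)) \<partial>M) = (\<integral>\<^sup>+\<omega>. F (hist Z t \<omega>) \<omega> \<partial>M)"
proof -
  let ?G = "\<lambda>z. \<integral>\<^sup>+\<omega>'. F z \<omega>' \<partial>given Z t z"
  have G: "(\<lambda>\<omega>. ?G (hist Z t \<omega>)) \<in> borel_measurable M"
    by (rule measurable_of_word[OF Z t, where f = "\<lambda>z \<omega>. ?G z"]) simp
  have F': "(\<lambda>\<omega>. F (hist Z t \<omega>) \<omega>) \<in> borel_measurable M"
    by (rule measurable_of_word[OF Z t F])
  have "(\<integral>\<^sup>+\<omega>. ?G (hist Z t \<omega>) * indicator (cell Z t z) \<omega> \<partial>M) = (\<integral>\<^sup>+\<omega>. F (hist Z t \<omega>) \<omega> * indicator (cell Z t z) \<omega> \<partial>M)"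
    if z: "z \<in> words t" for z
  proof -
    have "(\<integral>\<^sup>+\<omega>. ?G (hist Z t \<omega>) * indicator (cell Z t z) \<omega> \<partial>M) = (\<integral>\<^sup>+\<omega>. ?G z * indicator (cell Z t z) \<omega> \<partial>M)"
      by (intro nn_integral_cong) (auto simp: cell_def indicator_def)
    also have "\<dots> = ?G z * emeasure M (cell Z t z)"
      by (rule nn_integral_cmult_indicator[OF cell_measurable[OF Z t z]])
    also have "\<dots> = (\<integral>\<^sup>+\<omega>. F z \<omega> * indicator (cell Z t z) \<omega> \<partial>M)"
      by (rule nn_integral_given[OF Z t z F[OF z]])
    also have "\<dots> = (\<integral>\<^sup>+\<omega>. F (hist Z t \<omega>) \<omega> * indicator (cell Z t z) \<omega> \<partial>M)"
      by (intro nn_integral_cong) (auto simp: cell_def indicator_def)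
    finally show ?thesis .
  qed
  then show ?thesis
    unfolding integral_by_word[OF Z t G] integral_by_word[OF Z t F']
    by (rule nn_integral_cong) simp
qed

definition cmean :: "(nat \<Rightarrow> 'w \<Rightarrow> sym) \<Rightarrow> nat \<Rightarrow> (nat \<Rightarrow> sym) \<Rightarrow> real" where
  "cmean Z t z = (\<integral>\<omega>. zeta P t \<omega> \<partial>given Z (Suc t) z)"

text \<open>
  Jensen's inequality and the least-squares property of the mean, both read off from the decomposition of
  the second moment around an arbitrary point. On a null cell all integrals vanish.
\<close>
lemma cmean_word:
  assumes Z: "adapted Z" and t: "t \<le> T" and z: "z \<in> words (Suc t)"
  shows "ennreal ((cmean Z t z)\<^sup>2) \<le> (\<integral>\<^sup>+\<omega>. ennreal ((zeta P t \<omega>)\<^sup>2) \<partial>given Z (Suc t) z)"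
    and "(\<integral>\<^sup>+\<omega>. ennreal ((zeta P t \<omega> - cmean Z t z)\<^sup>2) \<partial>given Z (Suc t) z)
      \<le> (\<integral>\<^sup>+\<omega>. ennreal ((zeta P t \<omega> - d)\<^sup>2) \<partial>given Z (Suc t) z)"
proof -
  let ?U = "given Z (Suc t) z" and ?A = "cell Z (Suc t) z"
  have t': "Suc t \<le> Suc T" using t by simp
  have zm[measurable]: "zeta P t \<in> borel_measurable M" using t by simp
  have A[measurable]: "?A \<in> sets M" by (rule cell_measurable[OF Z t' z])
  have zU[measurable]: "zeta P t \<in> borel_measurable ?U"
    unfolding given_def using zm by (simp cong: measurable_cong_sets)
  have "ennreal ((cmean Z t z)\<^sup>2) \<le> (\<integral>\<^sup>+\<omega>. ennreal ((zeta P t \<omega>)\<^sup>2) \<partial>?U) \<and>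
     (\<integral>\<^sup>+\<omega>. ennreal ((zeta P t \<omega> - cmean Z t z)\<^sup>2) \<partial>?U) \<le> (\<integral>\<^sup>+\<omega>. ennreal ((zeta P t \<omega> - d)\<^sup>2) \<partial>?U)"
  proof (cases "emeasure M ?A = 0")
    case True
    have "AE \<omega> in M. \<omega> \<notin> ?A" using True A by (intro AE_not_in) auto
    then have "AE \<omega> in ?U. False"
      unfolding given_def by (intro AE_uniform_measureI[OF A]) simp
    then have "cmean Z t z = (\<integral>\<omega>. 0 \<partial>?U)"
      unfolding cmean_def by (intro integral_cong_AE) (auto elim: eventually_mono)
    then have "cmean Z t z = 0" by simp
    moreover have "(\<integral>\<^sup>+\<omega>. ennreal ((zeta P t \<omega> - c)\<^sup>2) \<partial>?U) = 0" for c
      by (rule given_null[OF Z t' z True]) measurable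
    from this[of 0] this[of d] this[of "cmean Z t z"] calculation show ?thesis by simp
  next
    case False
    interpret U: prob_space ?U
      unfolding given_def by (rule prob_space_uniform_measure) (use False in auto)
    have "(\<integral>\<^sup>+\<omega>. ennreal ((zeta P t \<omega>)\<^sup>2) \<partial>?U) < \<infinity>"
    proof -
      have "(\<integral>\<^sup>+\<omega>. ennreal ((zeta P t \<omega>)\<^sup>2) * indicator ?A \<omega> \<partial>M) \<le> (\<integral>\<^sup>+\<omega>. ennreal ((zeta P t \<omega>)\<^sup>2) \<partial>M)"
        by (intro nn_integral_mono) (auto simp: indicator_def)
      also have "\<dots> < \<infinity>" using L2_zeta[of t] t by (simp add: L2_def integrable_iff_bounded)
      finally have "(\<integral>\<^sup>+\<omega>. ennreal ((zeta P t \<omega>)\<^sup>2) * indicator ?A \<omega> \<partial>M) / emeasure M ?A < \<infinity>"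
        using False by (simp add: ennreal_divide_eq_top_iff less_top[symmetric])
      moreover have "(\<integral>\<^sup>+\<omega>. ennreal ((zeta P t \<omega>)\<^sup>2) \<partial>?U) = (\<integral>\<^sup>+\<omega>. ennreal ((zeta P t \<omega>)\<^sup>2) * indicator ?A \<omega> \<partial>M) / emeasure M ?A"
        unfolding given_def by (rule nn_integral_uniform_measure[OF _ A]) measurable
      ultimately show ?thesis by simp
    qed
    then have sq: "integrable ?U (\<lambda>\<omega>. (zeta P t \<omega>)\<^sup>2)"
      by (intro integrableI_nonneg) auto
    then have int: "integrable ?U (zeta P t)"
      by (rule U.square_integrable_imp_integrable[rotated]) measurable
    have sqd: "integrable ?U (\<lambda>\<omega>. (zeta P t \<omega> - c)\<^sup>2)" for c
      using sq int by (simp add: power2_diff)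
    have val: "(\<integral>\<omega>. (zeta P t \<omega> - c)\<^sup>2 \<partial>?U) = (\<integral>\<omega>. (zeta P t \<omega>)\<^sup>2 \<partial>?U) - (cmean Z t z)\<^sup>2 + (cmean Z t z - c)\<^sup>2" for c
      using sq int unfolding cmean_def
      by (simp add: power2_diff U.prob_space)
    have nn: "(\<integral>\<^sup>+\<omega>. ennreal ((zeta P t \<omega> - c)\<^sup>2) \<partial>?U) = ennreal (\<integral>\<omega>. (zeta P t \<omega> - c)\<^sup>2 \<partial>?U)" for c
      by (rule nn_integral_eq_integral[OF sqd]) simp
    have "0 \<le> (\<integral>\<omega>. (zeta P t \<omega> - cmean Z t z)\<^sup>2 \<partial>?U)" by (intro Bochner_Integration.integral_nonneg) simp
    then have "(cmean Z t z)\<^sup>2 \<le> (\<integral>\<omega>. (zeta P t \<omega> - 0)\<^sup>2 \<partial>?U)"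
      unfolding val[of "cmean Z t z"] by simp
    moreover have "(\<integral>\<omega>. (zeta P t \<omega> - cmean Z t z)\<^sup>2 \<partial>?U) \<le> (\<integral>\<omega>. (zeta P t \<omega> - d)\<^sup>2 \<partial>?U)"
      unfolding val by simp
    ultimately show ?thesis using nn[of 0] nn[of d] nn[of "cmean Z t z"] by (auto intro: ennreal_leI)
  qed
  then show "ennreal ((cmean Z t z)\<^sup>2) \<le> (\<integral>\<^sup>+\<omega>. ennreal ((zeta P t \<omega>)\<^sup>2) \<partial>?U)"
    "(\<integral>\<^sup>+\<omega>. ennreal ((zeta P t \<omega> - cmean Z t z)\<^sup>2) \<partial>?U) \<le> (\<integral>\<^sup>+\<omega>. ennreal ((zeta P t \<omega> - d)\<^sup>2) \<partial>?U)"
    by blast+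
qed

lemma cmean_least_error:
  assumes Z: "adapted Z" and t: "t \<le> T"
  shows "(\<integral>\<^sup>+\<omega>. ennreal ((zeta P t \<omega> - cmean Z t (hist Z (Suc t) \<omega>))\<^sup>2) \<partial>M)
    \<le> (\<integral>\<^sup>+\<omega>. ennreal ((zeta P t \<omega> - d (hist Z (Suc t) \<omega>))\<^sup>2) \<partial>M)"
proof -
  have t': "Suc t \<le> Suc T" using t by simp
  have [measurable]: "zeta P t \<in> borel_measurable M" using t by simp
  have *: "(\<integral>\<^sup>+\<omega>. ennreal ((zeta P t \<omega> - c (hist Z (Suc t) \<omega>))\<^sup>2) \<partial>M)
      = (\<integral>\<^sup>+\<omega>. (\<integral>\<^sup>+\<omega>'. ennreal ((zeta P t \<omega>' - c (hist Z (Suc t) \<omega>))\<^sup>2) \<partial>given Z (Suc t) (hist Z (Suc t) \<omega>)) \<partial>M)" for c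
    by (rule tower[OF Z t', symmetric, where F = "\<lambda>z \<omega>'. ennreal ((zeta P t \<omega>' - c z)\<^sup>2)"]) measurable
  show ?thesis unfolding *
    by (intro nn_integral_mono cmean_word(2)[OF Z t] hist_words[OF Z t'])
qed

lemma word_measurable_real:
  assumes Z: "adapted Z" and t: "t \<le> T"
  shows "(\<lambda>\<omega>. c (hist Z (Suc t) \<omega>) :: real) \<in> borel_measurable M"
  by (rule measurable_of_word[OF Z, where f = "\<lambda>z \<omega>. c z"]) (use t in auto)

lemma L2_cmean:
  assumes Z: "adapted Z" and t: "t \<le> T"
  shows "L2 (\<lambda>\<omega>. cmean Z t (hist Z (Suc t) \<omega>))"
proof -
  have t': "Suc t \<le> Suc T" using t by simp
  have [measurable]: "zeta P t \<in> borel_measurable M" using t by simp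
  note word_measurable_real[OF Z t, of "cmean Z t", measurable]
  have "(\<integral>\<^sup>+\<omega>. ennreal ((cmean Z t (hist Z (Suc t) \<omega>))\<^sup>2) \<partial>M)
      \<le> (\<integral>\<^sup>+\<omega>. (\<integral>\<^sup>+\<omega>'. ennreal ((zeta P t \<omega>')\<^sup>2) \<partial>given Z (Suc t) (hist Z (Suc t) \<omega>)) \<partial>M)"
    by (intro nn_integral_mono cmean_word(1)[OF Z t] hist_words[OF Z t'])
  also have "\<dots> = (\<integral>\<^sup>+\<omega>. ennreal ((zeta P t \<omega>)\<^sup>2) \<partial>M)"
    by (rule tower[OF Z t', where F = "\<lambda>z \<omega>'. ennreal ((zeta P t \<omega>')\<^sup>2)"]) measurable
  also have "\<dots> < \<infinity>" using L2_zeta[of t] t by (simp add: L2_def integrable_iff_bounded)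
  finally have "integrable M (\<lambda>\<omega>. (cmean Z t (hist Z (Suc t) \<omega>))\<^sup>2)"
    by (intro integrableI_nonneg) auto
  then show ?thesis by (simp add: L2_def)
qed

text \<open>
  Orthogonality follows from minimality: perturbing the conditional mean by a multiple of an
  event of words cannot lower the squared error. This identifies the elementary conditional mean with the
  abstract conditional expectation in \<open>state_est_eq\<close>.
\<close>
lemma cmean_orthogonal:
  assumes Z: "adapted Z" and t: "t \<le> T"
  shows "(\<integral>\<omega>. indicator B (hist Z (Suc t) \<omega>) * (zeta P t \<omega> - cmean Z t (hist Z (Suc t) \<omega>)) \<partial>M) = 0"
proof -
  define b where "b = (\<lambda>\<omega>. indicator B (hist Z (Suc t) \<omega>) :: real)"
  define e where "e = (\<lambda>\<omega>. zeta P t \<omega> - cmean Z t (hist Z (Suc t) \<omega>))"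
  have b[measurable]: "b \<in> borel_measurable M" unfolding b_def by (rule word_measurable_real[OF Z t])
  have "L2 (\<lambda>\<omega>. zeta P t \<omega> + (-1) * cmean Z t (hist Z (Suc t) \<omega>))"
    using t by (intro L2_add L2_cmult L2_cmean[OF Z t] L2_zeta) simp
  then have e: "L2 e" by (simp add: e_def)
  then have [measurable]: "e \<in> borel_measurable M" and e2: "integrable M (\<lambda>\<omega>. (e \<omega>)\<^sup>2)" by (auto simp: L2_def)
  have bb: "b \<omega> * b \<omega> = b \<omega>" for \<omega> by (simp add: b_def indicator_def)
  have bi: "integrable M b" by (rule integrable_const_bound[OF _ b, of 1]) (simp add: b_def indicator_def)
  have be: "integrable M (\<lambda>\<omega>. b \<omega> * e \<omega>)"
  proof (rule Bochner_Integration.integrable_bound[OF L2_imp_integrable[OF e]])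
    show "(\<lambda>\<omega>. b \<omega> * e \<omega>) \<in> borel_measurable M" by measurable
  qed (simp add: b_def indicator_def)
  have b1: "(\<integral>\<omega>. b \<omega> \<partial>M) \<le> 1"
    using integral_mono[OF bi integrable_const[of 1]] by (simp add: b_def indicator_def prob_space)
  define X where "X = (\<integral>\<omega>. b \<omega> * e \<omega> \<partial>M)"
  have expand: "(e \<omega> - c * b \<omega>)\<^sup>2 = (e \<omega>)\<^sup>2 - 2 * c * (b \<omega> * e \<omega>) + c\<^sup>2 * b \<omega>" for c \<omega>
  proof -
    have "(e \<omega> - c * b \<omega>)\<^sup>2 = (e \<omega>)\<^sup>2 - 2 * c * (b \<omega> * e \<omega>) + c\<^sup>2 * (b \<omega> * b \<omega>)"
      by (simp add: power2_eq_square algebra_simps)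
    then show ?thesis by (simp add: bb)
  qed
  have int: "integrable M (\<lambda>\<omega>. (e \<omega> - c * b \<omega>)\<^sup>2)" for c
    unfolding expand using e2 be bi by simp
  have val: "(\<integral>\<omega>. (e \<omega> - c * b \<omega>)\<^sup>2 \<partial>M) = (\<integral>\<omega>. (e \<omega>)\<^sup>2 \<partial>M) - 2 * c * X + c\<^sup>2 * (\<integral>\<omega>. b \<omega> \<partial>M)" for c
    unfolding expand X_def using e2 be bi by simp
  have "(\<integral>\<^sup>+\<omega>. ennreal ((e \<omega>)\<^sup>2) \<partial>M) \<le> (\<integral>\<^sup>+\<omega>. ennreal ((e \<omega> - X * b \<omega>)\<^sup>2) \<partial>M)"
    \<comment> \<open>The perturbation has size X, the correlation to be shown zero. As the event has probability at most 1,
      the linear term -2 X^2 would outweigh the quadratic term, which is at most X^2.\<close>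
    using cmean_least_error[OF Z t, of "\<lambda>z. cmean Z t z + X * indicator B z"]
    unfolding e_def b_def by (simp add: algebra_simps)
  then have "(\<integral>\<omega>. (e \<omega>)\<^sup>2 \<partial>M) \<le> (\<integral>\<omega>. (e \<omega> - X * b \<omega>)\<^sup>2 \<partial>M)"
    using e2 int[of X] by (simp add: nn_integral_eq_integral)
  then have "2 * X * X \<le> X\<^sup>2 * (\<integral>\<omega>. b \<omega> \<partial>M)" unfolding val by simp
  also have "\<dots> \<le> X\<^sup>2 * 1" by (intro mult_left_mono b1) simp
  finally have "X\<^sup>2 \<le> 0" by (simp add: power2_eq_square)
  then have "X = 0" by simp
  then show ?thesis by (simp add: X_def b_def e_def)
qed

lemma process_cost_cmean_least:
  assumes Z: "adapted Z"
  shows "process_cost (cmean Z) Z \<le> process_cost D Z"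
proof -
  have *: "(\<integral>\<^sup>+\<omega>. (\<Sum>t\<le>T. ennreal (lam P t * (zeta P t \<omega> - D t (hist Z (Suc t) \<omega>))\<^sup>2)) \<partial>M)
      = (\<Sum>t\<le>T. ennreal (lam P t) * (\<integral>\<^sup>+\<omega>. ennreal ((zeta P t \<omega> - D t (hist Z (Suc t) \<omega>))\<^sup>2) \<partial>M))" for D
  proof -
    have m: "(\<lambda>\<omega>. ennreal ((zeta P t \<omega> - D t (hist Z (Suc t) \<omega>))\<^sup>2)) \<in> borel_measurable M" if t: "t \<le> T" for t
    proof -
      have [measurable]: "zeta P t \<in> borel_measurable M" using t by simp
      note word_measurable_real[OF Z t, of "D t", measurable]
      show ?thesis by measurable
    qed
    have "(\<integral>\<^sup>+\<omega>. (\<Sum>t\<le>T. ennreal (lam P t * (zeta P t \<omega> - D t (hist Z (Suc t) \<omega>))\<^sup>2)) \<partial>M)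
        = (\<integral>\<^sup>+\<omega>. (\<Sum>t\<le>T. ennreal (lam P t) * ennreal ((zeta P t \<omega> - D t (hist Z (Suc t) \<omega>))\<^sup>2)) \<partial>M)"
      by (intro nn_integral_cong sum.cong refl ennreal_mult) (auto simp: lam_nonneg)
    also have "\<dots> = (\<Sum>t\<le>T. \<integral>\<^sup>+\<omega>. ennreal (lam P t) * ennreal ((zeta P t \<omega> - D t (hist Z (Suc t) \<omega>))\<^sup>2) \<partial>M)"
      by (intro nn_integral_sum borel_measurable_times_ennreal m) auto
    also have "\<dots> = (\<Sum>t\<le>T. ennreal (lam P t) * (\<integral>\<^sup>+\<omega>. ennreal ((zeta P t \<omega> - D t (hist Z (Suc t) \<omega>))\<^sup>2) \<partial>M))"
      by (intro sum.cong refl nn_integral_cmult m) simp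
    finally show ?thesis .
  qed
  show ?thesis
    unfolding process_cost_eq[OF Z] *
    by (intro add_right_mono sum_mono mult_left_mono cmean_least_error[OF Z]) auto
qed

section \<open>The information of the controller\<close>

lemma space_ctrl_info: "space (ctrl_info P E K t) = space M"
  by (simp add: ctrl_info_def)

lemma L2_integrable_on: "A \<in> sets M \<Longrightarrow> L2 f \<Longrightarrow> integrable M (\<lambda>\<omega>. indicator A \<omega> * f \<omega>)"
  using integrable_mult_indicator[OF _ L2_imp_integrable] by simp

context
  fixes E :: encoder and K :: controller
  assumes E: "admissible_encoder P E" and K: "admissible_controller P K"
begin

lemma ctrl_info_projections:
  shows "i \<le> t \<Longrightarrow> chan P E K i \<in> ctrl_info P E K t \<rightarrow>\<^sub>M count_space UNIV"
    and "j < t \<Longrightarrow> ctrl P E K j \<in> borel_measurable (ctrl_info P E K t)"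
proof -
  let ?N = "PiM {..t} (\<lambda>_. count_space UNIV :: sym measure) \<Otimes>\<^sub>M PiM {..<t} (\<lambda>_. borel :: real measure)"
  let ?p = "\<lambda>\<omega>. (\<lambda>i\<in>{..t}. chan P E K i \<omega>, \<lambda>i\<in>{..<t}. ctrl P E K i \<omega>)"
  have p: "?p \<in> ctrl_info P E K t \<rightarrow>\<^sub>M ?N"
    unfolding ctrl_info_def
    by (rule measurable_vimage_algebra1) (auto simp: space_pair_measure space_PiM)
  have pf: "(\<lambda>\<omega>. fst (?p \<omega>)) \<in> ctrl_info P E K t \<rightarrow>\<^sub>M PiM {..t} (\<lambda>_. count_space UNIV)"
    by (rule measurable_compose[OF p measurable_fst])
  have ps: "(\<lambda>\<omega>. snd (?p \<omega>)) \<in> ctrl_info P E K t \<rightarrow>\<^sub>M PiM {..<t} (\<lambda>_. borel)"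
    by (rule measurable_compose[OF p measurable_snd])
  show "chan P E K i \<in> ctrl_info P E K t \<rightarrow>\<^sub>M count_space UNIV" if "i \<le> t"
    using measurable_compose[OF pf measurable_component_singleton[of i "{..t}"]] that by simp
  show "ctrl P E K j \<in> borel_measurable (ctrl_info P E K t)" if "j < t"
    using measurable_compose[OF ps measurable_component_singleton[of j "{..<t}"]] that by simp
qed

lemma ctrl_info_ctrl: "t \<le> T \<Longrightarrow> ctrl P E K t \<in> borel_measurable (ctrl_info P E K t)"
  by (rule ctrl_measurable_step[OF E K]) (simp_all add: ctrl_info_projections)

lemma ctrl_info_word:
  assumes t: "t \<le> T"
  shows "hist (chan P E K) (Suc t) \<in> ctrl_info P E K t \<rightarrow>\<^sub>M count_space (words (Suc t))"
  by (rule hist_measurable_of_outputs)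
     (use t chan_symbols[OF E] in \<open>simp_all add: ctrl_info_projections less_Suc_eq_le\<close>)

lemma ctrl_info_image:
  assumes N: "space N = space M"
    and z: "\<And>i. i \<le> t \<Longrightarrow> chan P E K i \<in> N \<rightarrow>\<^sub>M count_space UNIV"
    and u: "\<And>i. i < t \<Longrightarrow> ctrl P E K i \<in> borel_measurable N"
  shows "sets (ctrl_info P E K t) \<subseteq> sets N"
  unfolding ctrl_info_def
  by (rule sets_image_in_sets[OF N]) (use z u in \<open>auto intro!: measurable_Pair measurable_restrict\<close>)

lemma ctrl_info_past: "t \<le> T \<Longrightarrow> sets (ctrl_info P E K t) \<subseteq> sets (past t)"
  by (rule ctrl_info_image) (use loop_past(2,3)[OF E K] in auto)

lemma ctrl_info_subalgebra: "t \<le> T \<Longrightarrow> subalgebra M (ctrl_info P E K t)"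
  using ctrl_info_past[of t] past_le[of t] by (auto simp: subalgebra_def ctrl_info_def)

lemma ctrl_info_mono: "sets (ctrl_info P E K t) \<subseteq> sets (ctrl_info P E K (Suc t))"
  by (rule ctrl_info_image) (simp_all add: ctrl_info_projections space_ctrl_info)

text \<open>
  The controls are a function of the output word, so the data of the controller carry no more information than
  the word.
\<close>
lemma ctrl_info_event:
  assumes A: "A \<in> sets (ctrl_info P E K t)"
  obtains B where "A = {\<omega> \<in> space M. hist (chan P E K) (Suc t) \<omega> \<in> B}"
proof -
  let ?N = "PiM {..t} (\<lambda>_. count_space UNIV :: sym measure) \<Otimes>\<^sub>M PiM {..<t} (\<lambda>_. borel :: real measure)"
  let ?p = "\<lambda>\<omega>. (\<lambda>i\<in>{..t}. chan P E K i \<omega>, \<lambda>i\<in>{..<t}. ctrl P E K i \<omega>)"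
  let ?J = "\<lambda>h. (h, replay (restrict K {..<Suc t}) h t)"
  have p: "?p \<omega> = ?J (hist (chan P E K) (Suc t) \<omega>)" for \<omega>
    unfolding hist_def by (subst replay_eq) (simp_all add: lessThan_Suc_atMost)
  have "?p \<in> space M \<rightarrow> space ?N" by (auto simp: space_pair_measure space_PiM)
  then obtain C where "A = ?p -` C \<inter> space M"
    using A unfolding ctrl_info_def by (auto simp: sets_vimage_algebra2)
  then have "A = {\<omega> \<in> space M. hist (chan P E K) (Suc t) \<omega> \<in> ?J -` C}" unfolding p by auto
  then show ?thesis by (rule that)
qed

text \<open>
  The controller knows its own controls, so the estimation error of the state is that of the
  control-free part, given the same output word.
\<close>
lemma state_est_eq:
  assumes t: "t \<le> T" and u: "\<And>j. j < t \<Longrightarrow> L2 (ctrl P E K j)"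
  shows "AE \<omega> in M. state_est P E K t \<omega>
    = cmean (chan P E K) t (hist (chan P E K) (Suc t) \<omega>) + (\<Sum>j<t. a ^ (t - 1 - j) * ctrl P E K j \<omega>)"
proof -
  let ?Z = "chan P E K" and ?F = "ctrl_info P E K t"
  let ?m = "\<lambda>\<omega>. cmean ?Z t (hist ?Z (Suc t) \<omega>)" and ?s = "\<lambda>\<omega>. \<Sum>j<t. a ^ (t - 1 - j) * ctrl P E K j \<omega>"
  have Z: "adapted ?Z" by (rule chan_adapted[OF E K])
  interpret F: finite_measure_subalgebra M ?F
    by unfold_locales (rule ctrl_info_subalgebra[OF t])
  have s: "L2 ?s" using u by (intro L2_sum L2_cmult) auto
  have g: "L2 (\<lambda>\<omega>. ?m \<omega> + ?s \<omega>)" by (rule L2_add[OF L2_cmean[OF Z t] s])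
  have f: "L2 (state P E K t)" by (rule L2_state) (use t u in auto)
  show ?thesis unfolding state_est_def
  proof (rule F.real_cond_exp_charact)
    show "integrable M (state P E K t)" "integrable M (\<lambda>\<omega>. ?m \<omega> + ?s \<omega>)"
      using f g by (auto intro: L2_imp_integrable)
    have "?m \<in> borel_measurable ?F"
      by (rule measurable_compose[OF ctrl_info_word[OF t]]) simp
    moreover have "?s \<in> borel_measurable ?F"
      by (intro borel_measurable_sum borel_measurable_times borel_measurable_const ctrl_info_projections) simp
    ultimately show "(\<lambda>\<omega>. ?m \<omega> + ?s \<omega>) \<in> borel_measurable ?F" by (rule borel_measurable_add)
  next
    fix A assume A: "A \<in> sets ?F"
    then have Am[measurable]: "A \<in> sets M" using ctrl_info_subalgebra[OF t] by (auto simp: subalgebra_def)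
    from A obtain B where B: "A = {\<omega> \<in> space M. hist ?Z (Suc t) \<omega> \<in> B}" by (rule ctrl_info_event)
    have "(\<integral>\<omega>. indicator A \<omega> * state P E K t \<omega> \<partial>M) - (\<integral>\<omega>. indicator A \<omega> * (?m \<omega> + ?s \<omega>) \<partial>M)
        = (\<integral>\<omega>. indicator A \<omega> * state P E K t \<omega> - indicator A \<omega> * (?m \<omega> + ?s \<omega>) \<partial>M)"
      by (rule Bochner_Integration.integral_diff[symmetric])
         (intro L2_integrable_on f g Am)+
    also have "\<dots> = (\<integral>\<omega>. indicator B (hist ?Z (Suc t) \<omega>) * (zeta P t \<omega> - ?m \<omega>) \<partial>M)"
      by (intro Bochner_Integration.integral_cong refl) (auto simp: B state_from_zeta[of E K t] indicator_def)
    also have "\<dots> = 0" by (rule cmean_orthogonal[OF Z t])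
    finally show "(\<integral>\<omega>\<in>A. state P E K t \<omega> \<partial>M) = (\<integral>\<omega>\<in>A. (?m \<omega> + ?s \<omega>) \<partial>M)"
      by (simp add: set_lebesgue_integral_def)
  qed
qed

lemma L2_state_est:
  assumes t: "t \<le> T" and u: "\<And>j. j < t \<Longrightarrow> L2 (ctrl P E K j)"
  shows "L2 (state_est P E K t)"
proof -
  have "L2 (\<lambda>\<omega>. cmean (chan P E K) t (hist (chan P E K) (Suc t) \<omega>) + (\<Sum>j<t. a ^ (t - 1 - j) * ctrl P E K j \<omega>))"
    using u t by (intro L2_add L2_cmean L2_sum L2_cmult chan_adapted[OF E K]) auto
  then show ?thesis
  proof (rule L2_AE_cong)
    show "AE \<omega> in M. cmean (chan P E K) t (hist (chan P E K) (Suc t) \<omega>) + (\<Sum>j<t. a ^ (t - 1 - j) * ctrl P E K j \<omega>)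
        = state_est P E K t \<omega>"
      using state_est_eq[OF t u] by (auto elim: eventually_mono)
    show "state_est P E K t \<in> borel_measurable M" unfolding state_est_def by simp
  qed
qed

end

section \<open>Linear control laws\<close>

context
  fixes E :: encoder and K :: controller
  assumes E: "admissible_encoder P E" and K: "admissible_controller P K" and lin: "linear_law P E K"
begin

text \<open>
  Square integrability cannot be assumed here, because a linear law is defined through conditional expectations, which
  are meaningful only for integrable states. It is propagated forward, from the controls before \<open>t\<close> to the
  estimate at \<open>t\<close> and then to the control at \<open>t\<close>.
\<close>
lemma linear_law_L2: "t \<le> T \<Longrightarrow> L2 (ctrl P E K t)"
proof (induction t rule: less_induct)
  case (less t)
  have "L2 (\<lambda>\<omega>. - kgain P t * state_est P E K t \<omega>)"
    using less by (intro L2_cmult L2_state_est[OF E K]) auto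
  then show ?case
  proof (rule L2_AE_cong)
    show "AE \<omega> in M. - kgain P t * state_est P E K t \<omega> = ctrl P E K t \<omega>"
      using lin less.prems unfolding linear_law_def by (auto elim: eventually_mono)
    show "ctrl P E K t \<in> borel_measurable M"
      by (rule from_past[OF loop_past(3)[OF E K less.prems le_refl]]) (use less.prems in simp)
  qed
qed

text \<open>
  Under the linear law the deviation \<open>u + k x\<close> is the gain times the estimation error of \<open>\<zeta>\<close>, so the lower
  bound for designs is attained with the conditional mean as decoder.
\<close>
lemma linear_law_cost:
  "total_cost P E K = ennreal base_cost + process_cost (cmean (chan P E K)) (chan P E K)"
proof -
  have Z: "adapted (chan P E K)" by (rule chan_adapted[OF E K])
  have "AE \<omega> in M. \<forall>t\<in>{..T}. excess E K t \<omega>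
      = lam P t * (zeta P t \<omega> - cmean (chan P E K) t (hist (chan P E K) (Suc t) \<omega>))\<^sup>2"
  proof (rule AE_finite_allI)
    fix t assume "t \<in> {..T}"
    then have t: "t \<le> T" by simp
    have "AE \<omega> in M. ctrl P E K t \<omega> = - kgain P t * state_est P E K t \<omega>"
      using lin t by (simp add: linear_law_def)
    moreover have "AE \<omega> in M. state_est P E K t \<omega>
        = cmean (chan P E K) t (hist (chan P E K) (Suc t) \<omega>) + (\<Sum>j<t. a ^ (t - 1 - j) * ctrl P E K j \<omega>)"
      by (rule state_est_eq[OF E K t linear_law_L2]) (use t in auto)
    ultimately show "AE \<omega> in M. excess E K t \<omega>
      = lam P t * (zeta P t \<omega> - cmean (chan P E K) t (hist (chan P E K) (Suc t) \<omega>))\<^sup>2"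
    proof eventually_elim
      case (elim \<omega>)
      have "ctrl P E K t \<omega> + kgain P t * state P E K t \<omega>
          = kgain P t * (zeta P t \<omega> - cmean (chan P E K) t (hist (chan P E K) (Suc t) \<omega>))"
        using elim unfolding state_from_zeta[of E K t \<omega>] by (simp add: algebra_simps)
      then show ?case unfolding excess_def lam_eq[OF t] by (simp add: power_mult_distrib)
    qed
  qed simp
  then have "(\<integral>\<^sup>+\<omega>. (\<Sum>t\<le>T. ennreal (excess E K t \<omega>)) \<partial>M)
      = (\<integral>\<^sup>+\<omega>. (\<Sum>t\<le>T. ennreal (lam P t * (zeta P t \<omega> - cmean (chan P E K) t (hist (chan P E K) (Suc t) \<omega>))\<^sup>2)) \<partial>M)"
    by (intro nn_integral_cong_AE) (auto elim!: eventually_mono intro!: sum.cong)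
  moreover have "(\<integral>\<^sup>+\<omega>. ennreal (quad_cost P (\<lambda>i. state P E K i \<omega>) (\<lambda>i. ctrl P E K i \<omega>)) \<partial>M)
      = ennreal base_cost + (\<integral>\<^sup>+\<omega>. (\<Sum>t\<le>T. ennreal (excess E K t \<omega>)) \<partial>M)"
    by (rule expected_quad_cost[OF E K linear_law_L2])
  ultimately show ?thesis
    unfolding total_cost_def process_cost_eq[OF Z] comm_cost_eq[OF Z]
    by (simp add: add.assoc)
qed

section \<open>Certainty equivalence\<close>

definition horizon_weight :: "nat \<Rightarrow> real" where
  "horizon_weight i = (if i = Suc T then 1 else wt_state P)"

lemma trajectory_ctrl: "trajectory P \<omega> (\<lambda>i. ctrl P E K i \<omega>) i = state P E K i \<omega>"
  by (induction i) (simp_all add: state_0 state_Suc)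

lemma trajectory_perturb:
  "trajectory P \<omega> (u(t := v)) i
    = trajectory P \<omega> u i + (if t < i then a ^ (i - 1 - t) * (v - u t) else 0)"
proof (induction i)
  case 0
  then show ?case by simp
next
  case (Suc i)
  have "i - t = Suc (i - 1 - t)" if "t < i" using that by simp
  then show ?case unfolding trajectory.simps Suc.IH
    by (cases "t < i"; cases "t = i") (simp_all add: algebra_simps)
qed

lemma quad_cost_weights:
  "quad_cost P x u = (\<Sum>i=1..Suc T. horizon_weight i * (x i)\<^sup>2) + wt_ctrl P * (\<Sum>i\<le>T. (u i)\<^sup>2)"
proof -
  have "(\<Sum>i=1..T. horizon_weight i * (x i)\<^sup>2) = wt_state P * (\<Sum>i=1..T. (x i)\<^sup>2)"
    unfolding sum_distrib_left by (rule sum.cong) (auto simp: horizon_weight_def)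
  then show ?thesis by (simp add: quad_cost_def horizon_weight_def)
qed

text \<open>
  Half the derivative of the state cost with respect to the control at time \<open>t\<close>, all later controls held
  fixed; adding \<open>q u\<^bsub>t\<^esub>\<close> gives half the derivative of the whole cost.
\<close>
definition costate :: "nat \<Rightarrow> 'w \<Rightarrow> real" where
  "costate t \<omega> = (\<Sum>i=Suc t..Suc T. horizon_weight i * a ^ (i - 1 - t) * state P E K i \<omega>)"

definition curvature :: "nat \<Rightarrow> real" where
  "curvature t = wt_ctrl P + (\<Sum>i=Suc t..Suc T. horizon_weight i * (a ^ (i - 1 - t))\<^sup>2)"

lemma curvature_pos: "curvature t > 0"
  unfolding curvature_def horizon_weight_def using wt_ctrl_pos wt_state_pos
  by (intro add_pos_nonneg sum_nonneg) auto

lemma quad_cost_perturb: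
  assumes t: "t \<le> T"
  shows "(let u = (\<lambda>i. ctrl P E K i \<omega>)(t := v) in quad_cost P (trajectory P \<omega> u) u)
    = quad_cost P (\<lambda>i. state P E K i \<omega>) (\<lambda>i. ctrl P E K i \<omega>)
      + 2 * (wt_ctrl P * ctrl P E K t \<omega> + costate t \<omega>) * (v - ctrl P E K t \<omega>)
      + curvature t * (v - ctrl P E K t \<omega>)\<^sup>2"
proof -
  let ?u = "\<lambda>i. ctrl P E K i \<omega>" and ?x = "\<lambda>i. state P E K i \<omega>"
  define d where "d = v - ?u t"
  have xs: "(\<Sum>i=1..Suc T. horizon_weight i * (trajectory P \<omega> (?u(t := v)) i)\<^sup>2)
      = (\<Sum>i=1..Suc T. horizon_weight i * (?x i)\<^sup>2)
        + (\<Sum>i=1..Suc T. if t < i then 2 * d * (horizon_weight i * a ^ (i - 1 - t) * ?x i)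
            + d\<^sup>2 * (horizon_weight i * (a ^ (i - 1 - t))\<^sup>2) else 0)"
    unfolding trajectory_perturb trajectory_ctrl sum.distrib[symmetric] d_def[symmetric]
    by (intro sum.cong refl) (auto simp: power2_eq_square algebra_simps)
  have "(\<Sum>i=1..Suc T. if t < i then 2 * d * (horizon_weight i * a ^ (i - 1 - t) * ?x i)
            + d\<^sup>2 * (horizon_weight i * (a ^ (i - 1 - t))\<^sup>2) else 0)
      = (\<Sum>i=Suc t..Suc T. 2 * d * (horizon_weight i * a ^ (i - 1 - t) * ?x i)
            + d\<^sup>2 * (horizon_weight i * (a ^ (i - 1 - t))\<^sup>2))"
    by (rule sum.mono_neutral_cong_right) auto
  also have "\<dots> = 2 * d * costate t \<omega> + d\<^sup>2 * (curvature t - wt_ctrl P)"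
    unfolding sum.distrib costate_def curvature_def sum_distrib_left[symmetric] by simp
  finally have tail: "(\<Sum>i=1..Suc T. if t < i then 2 * d * (horizon_weight i * a ^ (i - 1 - t) * ?x i)
            + d\<^sup>2 * (horizon_weight i * (a ^ (i - 1 - t))\<^sup>2) else 0)
      = 2 * d * costate t \<omega> + d\<^sup>2 * (curvature t - wt_ctrl P)" .
  have "(\<Sum>i\<le>T. ((?u(t := v)) i)\<^sup>2) = (\<Sum>i\<le>T. (?u i)\<^sup>2) + (\<Sum>i\<le>T. if i = t then 2 * d * ?u t + d\<^sup>2 else 0)"
    unfolding sum.distrib[symmetric] d_def by (intro sum.cong refl) (auto simp: power2_eq_square algebra_simps)
  then have us: "(\<Sum>i\<le>T. ((?u(t := v)) i)\<^sup>2) = (\<Sum>i\<le>T. (?u i)\<^sup>2) + (2 * d * ?u t + d\<^sup>2)"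
    using t by simp
  show ?thesis
    unfolding Let_def quad_cost_weights xs tail us d_def[symmetric] by (simp add: algebra_simps)
qed

lemma L2_signal: "t \<le> Suc T \<Longrightarrow> L2 (state P E K t)"
  by (rule L2_state) (simp_all add: linear_law_L2)

lemma L2_costate: "L2 (costate t)"
  unfolding costate_def by (intro L2_sum L2_cmult L2_signal) auto

context
  fixes t A assumes t: "t \<le> T" and A: "A \<in> sets (ctrl_info P E K t)"
begin

lemma info_event: "A \<in> sets M"
  using A ctrl_info_subalgebra[OF E K t] by (auto simp: subalgebra_def)

lemma integrable_on_event: "L2 f \<Longrightarrow> integrable M (\<lambda>\<omega>. indicator A \<omega> * f \<omega>)"
  by (rule L2_integrable_on[OF info_event])

lemma event_ctrl:
  "(\<integral>\<omega>. indicator A \<omega> * ctrl P E K t \<omega> \<partial>M) = - kgain P t * (\<integral>\<omega>. indicator A \<omega> * state P E K t \<omega> \<partial>M)"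
proof -
  interpret F: finite_measure_subalgebra M "ctrl_info P E K t"
    by unfold_locales (rule ctrl_info_subalgebra[OF E K t])
  note [measurable] = info_event
  have x: "L2 (state P E K t)" using t by (intro L2_signal) simp
  have [measurable]: "ctrl P E K t \<in> borel_measurable M" using linear_law_L2[OF t] by (simp add: L2_def)
  have "(\<integral>\<omega>. indicator A \<omega> * ctrl P E K t \<omega> \<partial>M) = (\<integral>\<omega>. - kgain P t * (indicator A \<omega> * state_est P E K t \<omega>) \<partial>M)"
    using lin t unfolding linear_law_def
    by (intro integral_cong_AE) (auto simp: state_est_def elim!: eventually_mono)
  also have "\<dots> = - kgain P t * (\<integral>\<omega>. indicator A \<omega> * state_est P E K t \<omega> \<partial>M)" by simp
  also have "(\<integral>\<omega>. indicator A \<omega> * state_est P E K t \<omega> \<partial>M) = (\<integral>\<omega>. indicator A \<omega> * state P E K t \<omega> \<partial>M)"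
    using F.real_cond_exp_intA[OF L2_imp_integrable[OF x] A]
    by (simp add: state_est_def set_lebesgue_integral_def)
  finally show ?thesis .
qed

text \<open>
  On an event known to the controller the noise averages out and the control acts as a multiple of the
  state itself, although it only sees the estimate.
\<close>
lemma event_next_state:
  "(\<integral>\<omega>. indicator A \<omega> * state P E K (Suc t) \<omega> \<partial>M) = (a - kgain P t) * (\<integral>\<omega>. indicator A \<omega> * state P E K t \<omega> \<partial>M)"
proof -
  have "indicator A \<in> borel_measurable (past t)" using A ctrl_info_past[OF E K t] by auto
  moreover have "integrable M (indicator A :: 'w \<Rightarrow> real)" using L2_integrable_on[OF info_event L2_const[of 1]] by simp
  ultimately have w: "(\<integral>\<omega>. indicator A \<omega> * noise P t \<omega> \<partial>M) = 0"
    by (rule noise_orthogonal(2)[OF t])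
  have i: "integrable M (\<lambda>\<omega>. indicator A \<omega> * state P E K t \<omega>)" "integrable M (\<lambda>\<omega>. indicator A \<omega> * ctrl P E K t \<omega>)"
    "integrable M (\<lambda>\<omega>. indicator A \<omega> * noise P t \<omega>)"
    using t by (auto intro!: integrable_on_event L2_signal linear_law_L2 L2_noise)
  have "(\<integral>\<omega>. indicator A \<omega> * state P E K (Suc t) \<omega> \<partial>M)
      = (\<integral>\<omega>. a * (indicator A \<omega> * state P E K t \<omega>) + indicator A \<omega> * ctrl P E K t \<omega> + indicator A \<omega> * noise P t \<omega> \<partial>M)"
    by (simp add: state_Suc algebra_simps)
  also have "\<dots> = a * (\<integral>\<omega>. indicator A \<omega> * state P E K t \<omega> \<partial>M) + (\<integral>\<omega>. indicator A \<omega> * ctrl P E K t \<omega> \<partial>M)"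
    using i w by simp
  finally show ?thesis unfolding event_ctrl by (simp add: algebra_simps)
qed

end

text \<open>
  The conditional mean of the costate is \<open>beta\<close> times that of the next state, tested on events. Going back one
  step uses that the controller does not forget, so an event known at time \<open>t\<close> is still known at time
  \<open>t + 1\<close>; the coefficients then satisfy the Riccati recursion.
\<close>
lemma event_costate:
  assumes "t \<le> T" "A \<in> sets (ctrl_info P E K t)"
  shows "(\<integral>\<omega>. indicator A \<omega> * costate t \<omega> \<partial>M) = beta P (Suc t) * (\<integral>\<omega>. indicator A \<omega> * state P E K (Suc t) \<omega> \<partial>M)"
  using assms
proof (induction t rule: inc_induct)
  case base
  have "costate T \<omega> = state P E K (Suc T) \<omega>" for \<omega> by (simp add: costate_def horizon_weight_def)
  then show ?case by (simp add: beta_end)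
next
  case (step t)
  let ?b = "beta P (Suc (Suc t))" and ?q = "wt_ctrl P"
  have t: "t \<le> T" "Suc t \<le> T" using step.hyps by auto
  have A: "A \<in> sets (ctrl_info P E K (Suc t))" using step.prems ctrl_info_mono[OF E K, of t] by blast
  have rec: "costate t \<omega> = wt_state P * state P E K (Suc t) \<omega> + a * costate (Suc t) \<omega>" for \<omega>
  proof -
    have "costate t \<omega> = horizon_weight (Suc t) * state P E K (Suc t) \<omega>
        + (\<Sum>i=Suc (Suc t)..Suc T. horizon_weight i * a ^ (i - 1 - t) * state P E K i \<omega>)"
      unfolding costate_def using t by (subst sum.atLeast_Suc_atMost) auto
    also have "(\<Sum>i=Suc (Suc t)..Suc T. horizon_weight i * a ^ (i - 1 - t) * state P E K i \<omega>) = a * costate (Suc t) \<omega>"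
      unfolding costate_def sum_distrib_left
    proof (intro sum.cong refl)
      fix i assume "i \<in> {Suc (Suc t)..Suc T}"
      then have "i - 1 - t = Suc (i - 1 - Suc t)" by auto
      then show "horizon_weight i * a ^ (i - 1 - t) * state P E K i \<omega>
          = a * (horizon_weight i * a ^ (i - 1 - Suc t) * state P E K i \<omega>)" by simp
    qed
    finally show ?thesis using t by (simp add: horizon_weight_def)
  qed
  have "(\<integral>\<omega>. indicator A \<omega> * costate t \<omega> \<partial>M)
      = (\<integral>\<omega>. wt_state P * (indicator A \<omega> * state P E K (Suc t) \<omega>) + a * (indicator A \<omega> * costate (Suc t) \<omega>) \<partial>M)"
    by (simp add: rec algebra_simps)
  also have "\<dots> = wt_state P * (\<integral>\<omega>. indicator A \<omega> * state P E K (Suc t) \<omega> \<partial>M) + a * (\<integral>\<omega>. indicator A \<omega> * costate (Suc t) \<omega> \<partial>M)"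
    using integrable_on_event[OF t(2) A L2_signal] integrable_on_event[OF t(2) A L2_costate] t by simp
  also have "\<dots> = (wt_state P + a * (?b * (a - kgain P (Suc t)))) * (\<integral>\<omega>. indicator A \<omega> * state P E K (Suc t) \<omega> \<partial>M)"
    unfolding step.IH[OF A] event_next_state[OF t(2) A] by (simp add: algebra_simps)
  also have "wt_state P + a * (?b * (a - kgain P (Suc t))) = beta P (Suc t)"
  proof -
    have "?q + ?b \<noteq> 0" using beta_pos[of "Suc (Suc t)"] wt_ctrl_pos t by simp
    then show ?thesis
      unfolding beta_step[OF t(2)] kgain_def by (simp add: field_simps power2_eq_square)
  qed
  finally show ?case .
qed

text \<open>
  The minimizer of the parabola is the closed-loop control minus a multiple of the derivative there, and the
  derivative has conditional mean zero.
\<close>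
lemma linear_law_certainty_equivalent: "certainty_equivalent P E K"
  unfolding certainty_equivalent_def
proof (intro allI impI)
  fix t assume t: "t \<le> T"
  let ?g = "\<lambda>\<omega>. wt_ctrl P * ctrl P E K t \<omega> + costate t \<omega>" and ?b = "beta P (Suc t)"
  define ustar where "ustar = (\<lambda>\<omega>. ctrl P E K t \<omega> + - inverse (curvature t) * ?g \<omega>)"
  have g: "L2 ?g" by (intro L2_add L2_cmult L2_costate linear_law_L2[OF t])
  have us: "L2 ustar" unfolding ustar_def by (intro L2_add L2_cmult g linear_law_L2[OF t])
  have opt: "is_arg_min (\<lambda>v. let u = (\<lambda>i. ctrl P E K i \<omega>)(t := v) in quad_cost P (trajectory P \<omega> u) u)
      (\<lambda>_. True) (ustar \<omega>)" for \<omega>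
  proof -
    let ?A = "curvature t" and ?G = "?g \<omega>"
    have "2 * ?G * (ustar \<omega> - ctrl P E K t \<omega>) + ?A * (ustar \<omega> - ctrl P E K t \<omega>)\<^sup>2
        \<le> 2 * ?G * d + ?A * d\<^sup>2" for d
    proof -
      have "2 * ?G * d + ?A * d\<^sup>2 = ?A * (d + ?G / ?A)\<^sup>2 - ?G\<^sup>2 / ?A"
        using curvature_pos[of t] by (simp add: field_simps power2_eq_square)
      moreover have "2 * ?G * (ustar \<omega> - ctrl P E K t \<omega>) + ?A * (ustar \<omega> - ctrl P E K t \<omega>)\<^sup>2 = - ?G\<^sup>2 / ?A"
        using curvature_pos[of t] by (simp add: ustar_def field_simps power2_eq_square)
      moreover have "0 \<le> ?A * (d + ?G / ?A)\<^sup>2" using curvature_pos[of t] by simp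
      ultimately show ?thesis by simp
    qed
    then show ?thesis
      unfolding is_arg_min_def quad_cost_perturb[OF t] by (auto simp: not_less add.assoc)
  qed
  interpret F: finite_measure_subalgebra M "ctrl_info P E K t"
    by unfold_locales (rule ctrl_info_subalgebra[OF E K t])
  have "AE \<omega> in M. real_cond_exp M (ctrl_info P E K t) ustar \<omega> = ctrl P E K t \<omega>"
  proof (rule F.real_cond_exp_charact)
    fix A assume A: "A \<in> sets (ctrl_info P E K t)"
    let ?I = "\<lambda>f. \<integral>\<omega>. indicator A \<omega> * f \<omega> \<partial>M"
    note int = integrable_on_event[OF t A]
    have "?I ?g = (\<integral>\<omega>. wt_ctrl P * (indicator A \<omega> * ctrl P E K t \<omega>) + indicator A \<omega> * costate t \<omega> \<partial>M)"
      by (simp add: algebra_simps)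
    also have "\<dots> = wt_ctrl P * ?I (ctrl P E K t) + ?I (costate t)"
      using int[OF linear_law_L2[OF t]] int[OF L2_costate] by simp
    also have "\<dots> = (a * ?b - (wt_ctrl P + ?b) * kgain P t) * ?I (state P E K t)"
      unfolding event_costate[OF t A] event_next_state[OF t A] event_ctrl[OF t A]
      by (simp add: algebra_simps)
    also have "\<dots> = 0"
      using beta_pos[of "Suc t"] wt_ctrl_pos t by (simp add: kgain_def)
    finally have "?I ?g = 0" .
    moreover have "?I ustar = (\<integral>\<omega>. indicator A \<omega> * ctrl P E K t \<omega> + - inverse (curvature t) * (indicator A \<omega> * ?g \<omega>) \<partial>M)"
      unfolding ustar_def by (intro Bochner_Integration.integral_cong refl) (simp add: algebra_simps)
    then have "?I ustar = ?I (ctrl P E K t) + - inverse (curvature t) * ?I ?g"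
      using int[OF linear_law_L2[OF t]] int[OF g] by simp
    ultimately show "(\<integral>\<omega>\<in>A. ustar \<omega> \<partial>M) = (\<integral>\<omega>\<in>A. ctrl P E K t \<omega> \<partial>M)"
      by (simp add: set_lebesgue_integral_def)
  qed (use us linear_law_L2[OF t] L2_imp_integrable ctrl_info_ctrl[OF E K t] in auto)
  then have "AE \<omega> in M. ctrl P E K t \<omega> = real_cond_exp M (ctrl_info P E K t) ustar \<omega>"
    by (auto elim: eventually_mono)
  then show "\<exists>ustar. integrable M ustar \<and>
      (\<forall>\<omega>\<in>space M. is_arg_min (\<lambda>v. let u = (\<lambda>i. ctrl P E K i \<omega>)(t := v) in quad_cost P (trajectory P \<omega> u) u)
          (\<lambda>_. True) (ustar \<omega>)) \<and>
      (AE \<omega> in M. ctrl P E K t \<omega> = real_cond_exp M (ctrl_info P E K t) ustar \<omega>)"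
    using opt L2_imp_integrable[OF us] by blast
qed

end

section \<open>Realizing the linear law\<close>

text \<open>
  The linear law written in terms of the data the controller has: the conditional mean of \<open>\<zeta>\<close> depends on the
  encoder but not on the controls, so there is no circularity in using it to define them.
\<close>
definition linear_controller :: "(nat \<Rightarrow> 'w \<Rightarrow> sym) \<Rightarrow> controller" where
  "linear_controller Z t z u = - kgain P t * (cmean Z t z + (\<Sum>j<t. a ^ (t - 1 - j) * u j))"

lemma linear_controller_admissible: "admissible_controller P (linear_controller Z)"
  unfolding admissible_controller_def
proof (intro allI impI)
  fix t z
  have "(\<lambda>u. - kgain P t * (cmean Z t z + (\<Sum>j<t. a ^ (t - 1 - j) * u j))) \<in> borel_measurable (PiM {..<t} (\<lambda>_. borel))"
    by (intro borel_measurable_times borel_measurable_add borel_measurable_sum borel_measurable_const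
        measurable_component_singleton) simp
  then show "linear_controller Z t z \<in> borel_measurable (PiM {..<t} (\<lambda>_. borel))"
    unfolding linear_controller_def .
qed

lemma linear_controller_linear:
  assumes E: "admissible_encoder P E" and Z: "chan P E (linear_controller Z) = Z"
  shows "linear_law P E (linear_controller Z)"
proof -
  let ?K = "linear_controller Z"
  note K = linear_controller_admissible[of Z]
  have ad: "adapted Z" using chan_adapted[OF E K] by (simp add: Z)
  have u: "ctrl P E ?K t \<omega> = - kgain P t * (cmean Z t (hist Z (Suc t) \<omega>) + (\<Sum>j<t. a ^ (t - 1 - j) * ctrl P E ?K j \<omega>))" for t \<omega>
  proof -
    have "ctrl P E ?K t \<omega> = ?K t (hist Z (Suc t) \<omega>) (\<lambda>i\<in>{..<t}. ctrl P E ?K i \<omega>)"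
      unfolding hist_def lessThan_Suc_atMost using ctrl_eq[of P E ?K t \<omega>] by (simp only: Z)
    then show ?thesis by (simp add: linear_controller_def)
  qed
  have L2u: "t \<le> T \<Longrightarrow> L2 (ctrl P E ?K t)" for t
  proof (induction t rule: less_induct)
    case (less t)
    have "L2 (\<lambda>\<omega>. - kgain P t * (cmean Z t (hist Z (Suc t) \<omega>) + (\<Sum>j<t. a ^ (t - 1 - j) * ctrl P E ?K j \<omega>)))"
      using less by (intro L2_cmult L2_add L2_cmean[OF ad] L2_sum) auto
    moreover have "ctrl P E ?K t = (\<lambda>\<omega>. - kgain P t * (cmean Z t (hist Z (Suc t) \<omega>) + (\<Sum>j<t. a ^ (t - 1 - j) * ctrl P E ?K j \<omega>)))"
      by (rule ext) (rule u)
    ultimately show ?case by simp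
  qed
  show ?thesis unfolding linear_law_def
  proof (intro allI impI)
    fix t assume t: "t \<le> T"
    have "AE \<omega> in M. state_est P E ?K t \<omega> = cmean Z t (hist Z (Suc t) \<omega>) + (\<Sum>j<t. a ^ (t - 1 - j) * ctrl P E ?K j \<omega>)"
      using state_est_eq[OF E K t L2u] t by (simp add: Z)
    then show "AE \<omega> in M. ctrl P E ?K t \<omega> = - kgain P t * state_est P E ?K t \<omega>"
      by eventually_elim (subst u, simp)
  qed
qed

section \<open>The dynamic program over quantization maps\<close>

definition past_maps :: "strategy \<Rightarrow> nat \<Rightarrow> (nat \<Rightarrow> sym) \<Rightarrow> nat \<Rightarrow> real \<Rightarrow> sym" where
  "past_maps \<epsilon> t z = (\<lambda>i\<in>{..<t}. \<epsilon> i (restrict z {..<i}))"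

lemma past_maps_apply: "i < t \<Longrightarrow> past_maps \<epsilon> t z i = \<epsilon> i (restrict z {..<i})"
  unfolding past_maps_def by (rule restrict_apply') simp

lemma past_maps_Suc: "past_maps \<epsilon> (Suc t) z = (past_maps \<epsilon> t z)(t := \<epsilon> t (restrict z {..<t}))"
  unfolding past_maps_def lessThan_Suc by (rule restrict_insert_upd[symmetric]) simp

lemma past_maps_upd:
  assumes z: "z \<in> words t"
  shows "(past_maps \<epsilon> t z)(t := \<epsilon> t z) = past_maps \<epsilon> (Suc t) (z(t := s))"
proof -
  have *: "restrict (z(t := s)) {..<i} = restrict z {..<i}" if "i \<le> t" for i
    using that by (intro restrict_ext) auto
  have "restrict z {..<t} = z" using z by (simp add: words_def PiE_restrict)
  moreover have "past_maps \<epsilon> t (z(t := s)) = past_maps \<epsilon> t z"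
    unfolding past_maps_def by (intro restrict_ext) (simp add: *)
  ultimately show ?thesis unfolding past_maps_Suc by (simp add: *)
qed

text \<open>
  Conditioning on the event that given maps produced given outputs is, along a strategy, conditioning
  on the output word of the strategy.
\<close>
lemma cond_meas_eq:
  assumes z: "z \<in> words t"
  shows "cond_meas P t z (past_maps \<epsilon> t z) = given (outputs \<epsilon>) t z"
proof -
  have "(\<forall>i<t. past_maps \<epsilon> t z i (zeta P i \<omega>) = z i) \<longleftrightarrow> hist (outputs \<epsilon>) t \<omega> = z" for \<omega>
  proof
    assume all: "\<forall>i<t. past_maps \<epsilon> t z i (zeta P i \<omega>) = z i"
    have "n \<le> t \<Longrightarrow> hist (outputs \<epsilon>) n \<omega> = restrict z {..<n}" for n
    proof (induction n)
      case 0
      show ?case by (simp add: hist_def restrict_def)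
    next
      case (Suc n)
      then have n: "n < t" by simp
      have IH: "hist (outputs \<epsilon>) n \<omega> = restrict z {..<n}" by (rule Suc.IH[OF less_imp_le[OF n]])
      have "outputs \<epsilon> n \<omega> = z n"
        using all[rule_format, OF n] unfolding past_maps_apply[OF n] outputs_eq[of \<epsilon> n] IH .
      then show ?case unfolding hist_Suc lessThan_Suc IH by (rule restrict_insert_upd)
    qed
    from this[of t] show "hist (outputs \<epsilon>) t \<omega> = z" using z by (simp add: words_def PiE_restrict)
  next
    assume h: "hist (outputs \<epsilon>) t \<omega> = z"
    show "\<forall>i<t. past_maps \<epsilon> t z i (zeta P i \<omega>) = z i"
    proof (intro allI impI)
      fix i assume i: "i < t"
      have "restrict z {..<i} = hist (outputs \<epsilon>) i \<omega>"
        unfolding h[symmetric] hist_def using i by (auto simp: fun_eq_iff)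
      then have "past_maps \<epsilon> t z i (zeta P i \<omega>) = outputs \<epsilon> i \<omega>"
        unfolding past_maps_apply[OF i] outputs_eq[of \<epsilon> i] by simp
      then show "past_maps \<epsilon> t z i (zeta P i \<omega>) = z i" using i by (simp add: h[symmetric] hist_def)
    qed
  qed
  then show ?thesis unfolding cond_meas_def given_def cell_def by simp
qed

lemma zeta_est_eq:
  "z \<in> words (Suc t) \<Longrightarrow> zeta_est P t z (past_maps \<epsilon> (Suc t) z) = cmean (outputs \<epsilon>) t z"
  unfolding zeta_est_def cmean_def by (simp add: cond_meas_eq)

lemma given_measurable: "f \<in> M \<rightarrow>\<^sub>M N \<Longrightarrow> f \<in> given Z t z \<rightarrow>\<^sub>M N"
  unfolding given_def by (simp cong: measurable_cong_sets)

definition next_word :: "strategy \<Rightarrow> nat \<Rightarrow> (nat \<Rightarrow> sym) \<Rightarrow> 'w \<Rightarrow> nat \<Rightarrow> sym" where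
  "next_word \<epsilon> t z \<omega> = z(t := \<epsilon> t z (zeta P t \<omega>))"

definition step_cost :: "strategy \<Rightarrow> nat \<Rightarrow> (nat \<Rightarrow> sym) \<Rightarrow> 'w \<Rightarrow> ennreal" where
  "step_cost \<epsilon> t z \<omega> = decoding_cost (cmean (outputs \<epsilon>)) t (zeta P t \<omega>) (next_word \<epsilon> t z \<omega>)"

text \<open>
  The optimal value of the dynamic program. Counting the rate penalty as the value after the last
  stage gives all stages the same recursion.
\<close>
definition best :: "nat \<Rightarrow> (nat \<Rightarrow> sym) \<Rightarrow> (nat \<Rightarrow> real \<Rightarrow> sym) \<Rightarrow> ennreal" where
  "best t z es = (if t \<le> T then (INF e\<in>quant_maps. Gamma P t e z es) else penalty z)"

text \<open>
  The recursion of \<open>Gamma\<close> with the map of the strategy in place of each infimum, by recursion on the number of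
  stages left.
\<close>
primrec left_cost :: "strategy \<Rightarrow> nat \<Rightarrow> (nat \<Rightarrow> sym) \<Rightarrow> ennreal" where
  "left_cost \<epsilon> 0 z = penalty z"
| "left_cost \<epsilon> (Suc k) z = (\<integral>\<^sup>+\<omega>. step_cost \<epsilon> (T - k) z \<omega> \<partial>given (outputs \<epsilon>) (T - k) z)
     + (\<integral>\<^sup>+\<omega>. left_cost \<epsilon> k (next_word \<epsilon> (T - k) z \<omega>) \<partial>given (outputs \<epsilon>) (T - k) z)"

definition strategy_cost where "strategy_cost \<epsilon> t = left_cost \<epsilon> (Suc T - t)"

lemma strategy_cost_end: "strategy_cost \<epsilon> (Suc T) z = penalty z"
  by (simp add: strategy_cost_def)

lemma strategy_cost_step:
  assumes "t \<le> T"
  shows "strategy_cost \<epsilon> t z = (\<integral>\<^sup>+\<omega>. step_cost \<epsilon> t z \<omega> \<partial>given (outputs \<epsilon>) t z)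
     + (\<integral>\<^sup>+\<omega>. strategy_cost \<epsilon> (Suc t) (next_word \<epsilon> t z \<omega>) \<partial>given (outputs \<epsilon>) t z)"
proof -
  have *: "Suc T - t = Suc (T - t)" "T - (T - t) = t" using assms by auto
  show ?thesis
    unfolding strategy_cost_def diff_Suc_Suc * left_cost.simps ..
qed

context
  fixes \<epsilon> :: strategy
  assumes \<epsilon>: "quant_strategy P \<epsilon>"
begin

lemma next_letter_measurable: "t \<le> T \<Longrightarrow> (\<lambda>\<omega>. \<epsilon> t z (zeta P t \<omega>)) \<in> M \<rightarrow>\<^sub>M count_space UNIV"
  by (rule measurable_compose[OF zeta_measurable quant_strategy_map(1)[OF \<epsilon>]]) simp_all

lemma next_word_measurable: "t \<le> T \<Longrightarrow> (\<lambda>\<omega>. f (next_word \<epsilon> t z \<omega>) :: ennreal) \<in> borel_measurable M"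
  unfolding next_word_def by (rule measurable_compose[OF next_letter_measurable]) simp_all

lemma next_word_words: "t \<le> T \<Longrightarrow> z \<in> words t \<Longrightarrow> next_word \<epsilon> t z \<omega> \<in> words (Suc t)"
  unfolding next_word_def by (rule words_upd[OF _ quant_strategy_map(2)[OF \<epsilon>]])

lemma step_cost_measurable:
  assumes t: "t \<le> T"
  shows "step_cost \<epsilon> t z \<in> borel_measurable M"
proof -
  have "(\<lambda>\<omega>. decoding_cost (cmean (outputs \<epsilon>)) t (zeta P t \<omega>) (z(t := \<epsilon> t z (zeta P t \<omega>)))) \<in> borel_measurable M"
    by (rule measurable_compose_countable[OF _ next_letter_measurable[OF t],
          where f = "\<lambda>s \<omega>. decoding_cost (cmean (outputs \<epsilon>)) t (zeta P t \<omega>) (z(t := s))"])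
       (rule measurable_compose[OF zeta_measurable decoding_cost_measurable], use t in simp)
  then show ?thesis unfolding step_cost_def next_word_def .
qed

text \<open>
  Along a strategy the conditional measures and estimates of \<open>Gamma\<close> are those of the output process. At the last
  stage the almost sure rate constraint becomes the integral of the penalty.
\<close>
lemma Gamma_eq:
  assumes t: "t \<le> T" and z: "z \<in> words t"
  shows "Gamma P t (\<epsilon> t z) z (past_maps \<epsilon> t z)
    = (\<integral>\<^sup>+\<omega>. step_cost \<epsilon> t z \<omega> \<partial>given (outputs \<epsilon>) t z)
     + (\<integral>\<^sup>+\<omega>. best (Suc t) (next_word \<epsilon> t z \<omega>) (past_maps \<epsilon> (Suc t) (next_word \<epsilon> t z \<omega>)) \<partial>given (outputs \<epsilon>) t z)"
proof -
  let ?U = "given (outputs \<epsilon>) t z"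
  have upd: "(past_maps \<epsilon> t z)(t := \<epsilon> t z) = past_maps \<epsilon> (Suc t) (next_word \<epsilon> t z \<omega>)" for \<omega>
    unfolding next_word_def by (rule past_maps_upd[OF z])
  have stage: "stage_cost P t (\<epsilon> t z) z (past_maps \<epsilon> t z) = (\<integral>\<^sup>+\<omega>. step_cost \<epsilon> t z \<omega> \<partial>?U)"
    unfolding stage_cost_def cond_meas_eq[OF z]
  proof (rule nn_integral_cong)
    fix \<omega>
    have "zeta_est P t (z(t := \<epsilon> t z (zeta P t \<omega>))) ((past_maps \<epsilon> t z)(t := \<epsilon> t z))
        = cmean (outputs \<epsilon>) t (next_word \<epsilon> t z \<omega>)"
      unfolding upd[of \<omega>] next_word_def[symmetric] by (rule zeta_est_eq[OF next_word_words[OF t z]])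
    then show "ennreal (lam P t * (zeta P t \<omega> - zeta_est P t (z(t := \<epsilon> t z (zeta P t \<omega>))) ((past_maps \<epsilon> t z)(t := \<epsilon> t z)))\<^sup>2)
        + ennreal (wt_comm P) * phi P (fst (\<epsilon> t z (zeta P t \<omega>))) = step_cost \<epsilon> t z \<omega>"
      by (simp add: step_cost_def decoding_cost_def next_word_def)
  qed
  show ?thesis
  proof (cases "t < T")
    case True
    have "(\<integral>\<^sup>+\<omega>. (INF e'\<in>quant_maps. Gamma P (Suc t) e' (z(t := \<epsilon> t z (zeta P t \<omega>))) ((past_maps \<epsilon> t z)(t := \<epsilon> t z))) \<partial>?U)
        = (\<integral>\<^sup>+\<omega>. best (Suc t) (next_word \<epsilon> t z \<omega>) (past_maps \<epsilon> (Suc t) (next_word \<epsilon> t z \<omega>)) \<partial>?U)"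
    proof (rule nn_integral_cong)
      fix \<omega>
      show "(INF e'\<in>quant_maps. Gamma P (Suc t) e' (z(t := \<epsilon> t z (zeta P t \<omega>))) ((past_maps \<epsilon> t z)(t := \<epsilon> t z)))
          = best (Suc t) (next_word \<epsilon> t z \<omega>) (past_maps \<epsilon> (Suc t) (next_word \<epsilon> t z \<omega>))"
        unfolding upd[of \<omega>] best_def using True by (simp add: next_word_def)
    qed
    then show ?thesis
      using True by (subst Gamma.simps) (simp only: stage cond_meas_eq[OF z] if_True)
  next
    case False
    then have tT: "t = T" using t by simp
    have pen: "best (Suc t) (next_word \<epsilon> t z \<omega>) es = penalty (next_word \<epsilon> t z \<omega>)" for \<omega> es
      by (simp add: best_def tT)
    have sum: "(\<Sum>i\<le>T. phi P (fst (next_word \<epsilon> t z \<omega> i))) = (\<Sum>i<t. phi P (fst (z i))) + phi P (fst (\<epsilon> t z (zeta P t \<omega>)))" for \<omega>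
      unfolding tT by (simp add: lessThan_Suc_atMost[symmetric] next_word_def)
    let ?ok = "\<lambda>\<omega>. (\<Sum>i<t. phi P (fst (z i))) + phi P (fst (\<epsilon> t z (zeta P t \<omega>))) \<le> rate_budget P"
    have penok: "penalty (next_word \<epsilon> t z \<omega>) = (if ?ok \<omega> then 0 else \<top>)" for \<omega>
      unfolding penalty_def sum ..
    have m: "(\<lambda>\<omega>. penalty (next_word \<epsilon> t z \<omega>)) \<in> borel_measurable ?U"
      by (rule given_measurable[OF next_word_measurable[OF t]])
    show ?thesis
    proof (cases "AE \<omega> in ?U. ?ok \<omega>")
      case True
      then have "(\<integral>\<^sup>+\<omega>. penalty (next_word \<epsilon> t z \<omega>) \<partial>?U) = (\<integral>\<^sup>+\<omega>. 0 \<partial>?U)"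
        by (intro nn_integral_cong_AE) (auto simp: penok elim: eventually_mono)
      also have "\<dots> = 0" by simp
      finally show ?thesis
        using True \<open>\<not> t < T\<close>
        by (subst Gamma.simps) (simp only: stage cond_meas_eq[OF z] pen if_True if_False add_0_right)
    next
      case bad: False
      have "(\<integral>\<^sup>+\<omega>. penalty (next_word \<epsilon> t z \<omega>) \<partial>?U) = \<top>"
      proof (rule ccontr)
        assume "(\<integral>\<^sup>+\<omega>. penalty (next_word \<epsilon> t z \<omega>) \<partial>?U) \<noteq> \<top>"
        then have "AE \<omega> in ?U. penalty (next_word \<epsilon> t z \<omega>) \<noteq> \<infinity>"
          by (intro nn_integral_PInf_AE[OF m]) simp
        then show False using bad unfolding penok by (auto elim: eventually_mono split: if_splits)
      qed
      then show ?thesis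
        using bad \<open>\<not> t < T\<close>
        by (subst Gamma.simps) (simp only: cond_meas_eq[OF z] pen if_False add_top_right_ennreal)
    qed
  qed
qed

lemma best_le_strategy_cost:
  "t \<le> Suc T \<Longrightarrow> z \<in> words t \<Longrightarrow> best t z (past_maps \<epsilon> t z) \<le> strategy_cost \<epsilon> t z"
proof (induction t arbitrary: z rule: inc_induct)
  case base
  show ?case by (simp add: best_def strategy_cost_end)
next
  case (step t)
  then have t: "t \<le> T" by simp
  have "best t z (past_maps \<epsilon> t z) \<le> Gamma P t (\<epsilon> t z) z (past_maps \<epsilon> t z)"
    using t \<epsilon> by (auto simp: best_def quant_strategy_def intro: INF_lower)
  also have "\<dots> \<le> strategy_cost \<epsilon> t z"
    unfolding Gamma_eq[OF t step.prems] strategy_cost_step[OF t]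
    by (intro add_left_mono nn_integral_mono step.IH next_word_words[OF t step.prems])
  finally show ?case .
qed

text \<open>
  Unfolding the nested conditional expectations by the tower property, one stage at a time.
\<close>
lemma strategy_cost_process:
  "strategy_cost \<epsilon> 0 (\<lambda>_. undefined) = process_cost (cmean (outputs \<epsilon>)) (outputs \<epsilon>)"
proof -
  let ?Z = "outputs \<epsilon>" and ?D = "cmean (outputs \<epsilon>)"
  have Z: "adapted ?Z" by (rule outputs_adapted[OF \<epsilon>])
  have nw: "next_word \<epsilon> t (hist ?Z t \<omega>) \<omega> = hist ?Z (Suc t) \<omega>" for t \<omega>
    unfolding next_word_def hist_Suc outputs_eq[symmetric] ..
  have "strategy_cost \<epsilon> 0 (\<lambda>_. undefined)
      = (\<Sum>s<t. \<integral>\<^sup>+\<omega>. running_cost ?D ?Z s \<omega> \<partial>M) + (\<integral>\<^sup>+\<omega>. strategy_cost \<epsilon> t (hist ?Z t \<omega>) \<partial>M)"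
    if "t \<le> Suc T" for t
    using that
  proof (induction t)
    case 0
    then show ?case by (simp add: hist_0 emeasure_space_1)
  next
    case (Suc t)
    then have t: "t \<le> T" "t \<le> Suc T" by auto
    let ?F = "\<lambda>z \<omega>. step_cost \<epsilon> t z \<omega> + strategy_cost \<epsilon> (Suc t) (next_word \<epsilon> t z \<omega>)"
    have sc: "strategy_cost \<epsilon> t z = (\<integral>\<^sup>+\<omega>. ?F z \<omega> \<partial>given ?Z t z)" for z
      unfolding strategy_cost_step[OF t(1)]
      by (rule nn_integral_add[symmetric])
         (intro given_measurable step_cost_measurable next_word_measurable t)+
    have "(\<integral>\<^sup>+\<omega>. strategy_cost \<epsilon> t (hist ?Z t \<omega>) \<partial>M) = (\<integral>\<^sup>+\<omega>. ?F (hist ?Z t \<omega>) \<omega> \<partial>M)"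
      unfolding sc
      by (rule tower[OF Z t(2)]) (intro borel_measurable_add step_cost_measurable next_word_measurable t)
    also have "\<dots> = (\<integral>\<^sup>+\<omega>. running_cost ?D ?Z t \<omega> + strategy_cost \<epsilon> (Suc t) (hist ?Z (Suc t) \<omega>) \<partial>M)"
      unfolding step_cost_def nw running_cost_def ..
    also have "\<dots> = (\<integral>\<^sup>+\<omega>. running_cost ?D ?Z t \<omega> \<partial>M) + (\<integral>\<^sup>+\<omega>. strategy_cost \<epsilon> (Suc t) (hist ?Z (Suc t) \<omega>) \<partial>M)"
      by (rule nn_integral_add[OF running_cost_measurable[OF Z t(1)]])
         (rule measurable_of_word[OF Z, where f = "\<lambda>z \<omega>. strategy_cost \<epsilon> (Suc t) z"], use t in auto)
    finally show ?case using Suc.IH t by (simp add: add.assoc)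
  qed
  from this[of "Suc T"] show ?thesis
    unfolding process_cost_split[OF Z] lessThan_Suc_atMost by (simp add: strategy_cost_end cost_to_go_end)
qed

end

lemma undefined_word: "(\<lambda>_. undefined) \<in> words 0"
  by (simp add: words_def PiE_def extensional_def)

lemma past_maps_0: "past_maps \<epsilon> 0 z = (\<lambda>_. undefined)"
  by (simp add: past_maps_def restrict_def)

text \<open>
  Backward induction: the map of an argmin strategy attains the infimum at every word, so infimum and cost
  agree stage by stage.
\<close>
lemma argmin_strategy_cost:
  assumes am: "argmin_strategy P \<epsilon>"
  shows "t \<le> Suc T \<Longrightarrow> z \<in> words t \<Longrightarrow> strategy_cost \<epsilon> t z = best t z (past_maps \<epsilon> t z)"
proof (induction t arbitrary: z rule: inc_induct)
  case base
  show ?case by (simp add: best_def strategy_cost_end)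
next
  case (step t)
  have \<epsilon>: "quant_strategy P \<epsilon>" using am by (simp add: argmin_strategy_def)
  have t: "t \<le> T" using step.hyps by simp
  have "is_arg_min (\<lambda>e. Gamma P t e z (past_maps \<epsilon> t z)) (\<lambda>e. e \<in> quant_maps) (\<epsilon> t z)"
    using am t step.prems by (simp add: argmin_strategy_def words_def past_maps_def)
  then have "best t z (past_maps \<epsilon> t z) = Gamma P t (\<epsilon> t z) z (past_maps \<epsilon> t z)"
    using t by (auto simp: best_def is_arg_min_def not_less intro!: antisym INF_lower INF_greatest)
  also have "\<dots> = strategy_cost \<epsilon> t z"
    unfolding Gamma_eq[OF \<epsilon> t step.prems] strategy_cost_step[OF t]
    by (intro arg_cong2[where f = "(+)"] refl nn_integral_cong step.IH[symmetric] next_word_words[OF \<epsilon> t step.prems])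
  finally show ?case ..
qed

section \<open>Near-optimal strategies\<close>

lemma one_letter_map: "(\<lambda>_. (1, 1)) \<in> quant_maps"
  by (auto simp: quant_maps_def symbols_def)

lemma near_optimal_map:
  assumes "\<delta> > (0 :: real)"
  shows "\<exists>e\<in>quant_maps. Gamma P t e z es \<le> (INF e\<in>quant_maps. Gamma P t e z es) + ennreal \<delta>"
proof (cases "(INF e\<in>quant_maps. Gamma P t e z es) = \<top>")
  case True
  then show ?thesis using one_letter_map by auto
next
  case False
  then have "(INF e\<in>quant_maps. Gamma P t e z es) < (INF e\<in>quant_maps. Gamma P t e z es) + ennreal \<delta>"
    using assms by (simp add: ennreal_add_left_cancel_less[of _ 0, simplified] less_top)
  then show ?thesis unfolding INF_less_iff by (auto intro: less_imp_le)
qed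

lemma given_mass_le: 
  assumes Z: "adapted Z" and t: "t \<le> Suc T" and z: "z \<in> words t"
  shows "(\<integral>\<^sup>+\<omega>. c \<partial>given Z t z) \<le> c"
proof (cases "emeasure M (cell Z t z) = 0")
  case True
  then show ?thesis using given_null[OF Z t z True, of "\<lambda>_. c"] by auto
next
  case False
  interpret U: prob_space "given Z t z"
    unfolding given_def by (rule prob_space_uniform_measure) (use False in auto)
  show ?thesis by (simp add: U.emeasure_space_1)
qed

text \<open>
  An infimum need not be attained, but a map within \<open>\<delta>\<close> of it always exists. Such maps have to be chosen along
  the history, because \<open>Gamma\<close> at time \<open>t\<close> depends on the maps used before. The errors add up
  over the stages.
\<close>
lemma near_optimal_strategy:
  assumes \<delta>: "\<delta> > (0 :: real)"
  shows "\<exists>\<epsilon>. quant_strategy P \<epsilon> \<and>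
    strategy_cost \<epsilon> 0 (\<lambda>_. undefined) \<le> best 0 (\<lambda>_. undefined) (\<lambda>_. undefined) + of_nat (Suc T) * ennreal \<delta>"
proof -
  define sel where "sel t z es = (SOME e. e \<in> quant_maps \<and>
      Gamma P t e z es \<le> (INF e\<in>quant_maps. Gamma P t e z es) + ennreal \<delta>)" for t z es
  have sel: "sel t z es \<in> quant_maps"
    "Gamma P t (sel t z es) z es \<le> (INF e\<in>quant_maps. Gamma P t e z es) + ennreal \<delta>" for t z es
    using someI_ex[OF near_optimal_map[OF \<delta>, of t z es, unfolded Bex_def], folded sel_def] by auto
  \<comment> \<open>The maps used along the word z, each selected in view of the maps before it.\<close>
  define H where "H z = rec_nat (\<lambda>_. undefined) (\<lambda>t h. h(t := sel t (restrict z {..<t}) h))" for z :: "nat \<Rightarrow> sym"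
  have H0: "H z 0 = (\<lambda>_. undefined)" and HS: "H z (Suc t) = (H z t)(t := sel t (restrict z {..<t}) (H z t))" for z t
    by (simp_all add: H_def)
  define \<epsilon> where "\<epsilon> t z = sel t (restrict z {..<t}) (H z t)" for t z
  have Hres: "H (restrict z {..<n}) i = H z i" if "i \<le> n" for z n i
    using that
  proof (induction i)
    case (Suc i)
    then have eq: "restrict (restrict z {..<n}) {..<i} = restrict z {..<i}" by (auto simp: fun_eq_iff)
    have IH: "H (restrict z {..<n}) i = H z i" by (rule Suc.IH[OF Suc_leD[OF Suc.prems]])
    show ?case unfolding HS eq IH ..
  qed (simp add: H0)
  \<comment> \<open>The strategy built from these selections indeed meets the history for which they were made.\<close>
  have pm: "past_maps \<epsilon> t z = H z t" for t z
  proof (induction t)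
    case 0
    show ?case by (simp add: past_maps_0 H0)
  next
    case (Suc t)
    have "\<epsilon> t (restrict z {..<t}) = sel t (restrict z {..<t}) (H z t)"
      unfolding \<epsilon>_def Hres[OF le_refl] by simp
    then show ?case unfolding past_maps_Suc Suc.IH HS by simp
  qed
  have \<epsilon>: "quant_strategy P \<epsilon>" by (simp add: quant_strategy_def \<epsilon>_def sel)
  have "strategy_cost \<epsilon> t z \<le> best t z (past_maps \<epsilon> t z) + of_nat (Suc T - t) * ennreal \<delta>"
    if "t \<le> Suc T" "z \<in> words t" for t z
    using that
  proof (induction t arbitrary: z rule: inc_induct)
    case base
    show ?case by (simp add: best_def strategy_cost_end)
  next
    case (step t)
    let ?U = "given (outputs \<epsilon>) t z" and ?c = "of_nat (Suc T - Suc t) * ennreal \<delta>"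
    let ?b = "\<lambda>\<omega>. best (Suc t) (next_word \<epsilon> t z \<omega>) (past_maps \<epsilon> (Suc t) (next_word \<epsilon> t z \<omega>))"
    have t: "t \<le> T" "t \<le> Suc T" using step.hyps by auto
    have z: "restrict z {..<t} = z" using step.prems by (simp add: words_def PiE_restrict)
    have "(\<integral>\<^sup>+\<omega>. strategy_cost \<epsilon> (Suc t) (next_word \<epsilon> t z \<omega>) \<partial>?U) \<le> (\<integral>\<^sup>+\<omega>. ?b \<omega> + ?c \<partial>?U)"
      by (intro nn_integral_mono step.IH next_word_words[OF \<epsilon> t(1) step.prems])
    also have "\<dots> = (\<integral>\<^sup>+\<omega>. ?b \<omega> \<partial>?U) + (\<integral>\<^sup>+\<omega>. ?c \<partial>?U)"
      by (rule nn_integral_add)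
         (simp_all add: given_measurable next_word_measurable[OF \<epsilon> t(1), of "\<lambda>y. best (Suc t) y (past_maps \<epsilon> (Suc t) y)"])
    also have "\<dots> \<le> (\<integral>\<^sup>+\<omega>. ?b \<omega> \<partial>?U) + ?c"
      by (intro add_left_mono given_mass_le outputs_adapted[OF \<epsilon>] t step.prems)
    finally have "strategy_cost \<epsilon> t z \<le> Gamma P t (\<epsilon> t z) z (past_maps \<epsilon> t z) + ?c"
      unfolding Gamma_eq[OF \<epsilon> t(1) step.prems] strategy_cost_step[OF t(1)] add.assoc by (rule add_left_mono)
    also have "Gamma P t (\<epsilon> t z) z (past_maps \<epsilon> t z) \<le> best t z (past_maps \<epsilon> t z) + ennreal \<delta>"
      unfolding pm best_def \<epsilon>_def z using sel(2) t by simp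
    also have "best t z (past_maps \<epsilon> t z) + ennreal \<delta> + ?c = best t z (past_maps \<epsilon> t z) + of_nat (Suc T - t) * ennreal \<delta>"
    proof -
      have "Suc T - t = Suc (Suc T - Suc t)" using t by simp
      then show ?thesis by (simp add: distrib_right add.assoc)
    qed
    finally show ?case by (simp add: add_right_mono)
  qed
  from this[of 0, OF _ undefined_word] show ?thesis using \<epsilon> by (auto simp: past_maps_0)
qed

text \<open>
  Near-optimal strategies turn minimality among strategies into equality with the nested infima of the dynamic
  program.
\<close>
lemma best_eq_of_minimal:
  assumes \<epsilon>: "quant_strategy P \<epsilon>"
    and min: "\<And>\<epsilon>'. quant_strategy P \<epsilon>' \<Longrightarrow> strategy_cost \<epsilon> 0 (\<lambda>_. undefined) \<le> strategy_cost \<epsilon>' 0 (\<lambda>_. undefined)"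
  shows "strategy_cost \<epsilon> 0 (\<lambda>_. undefined) = best 0 (\<lambda>_. undefined) (\<lambda>_. undefined)"
proof (rule antisym)
  show "strategy_cost \<epsilon> 0 (\<lambda>_. undefined) \<le> best 0 (\<lambda>_. undefined) (\<lambda>_. undefined)"
  proof (rule ennreal_le_epsilon)
    fix r :: real assume r: "r > 0"
    let ?\<delta> = "r / real (Suc T)"
    obtain \<epsilon>' where "quant_strategy P \<epsilon>'"
      "strategy_cost \<epsilon>' 0 (\<lambda>_. undefined) \<le> best 0 (\<lambda>_. undefined) (\<lambda>_. undefined) + of_nat (Suc T) * ennreal ?\<delta>"
      using near_optimal_strategy[of ?\<delta>] r by auto
    moreover have "of_nat (Suc T) * ennreal ?\<delta> = ennreal r"
      using r by (simp add: ennreal_of_nat_eq_real_of_nat ennreal_mult[symmetric] del: of_nat_Suc)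
    ultimately show "strategy_cost \<epsilon> 0 (\<lambda>_. undefined) \<le> best 0 (\<lambda>_. undefined) (\<lambda>_. undefined) + ennreal r"
      using min[of \<epsilon>'] by simp
  qed
  show "best 0 (\<lambda>_. undefined) (\<lambda>_. undefined) \<le> strategy_cost \<epsilon> 0 (\<lambda>_. undefined)"
    using best_le_strategy_cost[OF \<epsilon> _ undefined_word] by (simp add: past_maps_0)
qed

section \<open>Minimal strategies after every output word\<close>

text \<open>
  The optimal value is at most \<open>Gamma\<close> at the chosen map, which is at most the cost of the strategy. If the ends
  agree and are finite, then so do the integrals over the next words, and the pointwise inequality under
  them is an equality almost surely.
\<close>
lemma sandwich_at_word:
  assumes \<epsilon>: "quant_strategy P \<epsilon>" and t: "t \<le> T" and z: "z \<in> words t"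
    and eq: "strategy_cost \<epsilon> t z = best t z (past_maps \<epsilon> t z)" and fin: "strategy_cost \<epsilon> t z < \<top>"
  shows "Gamma P t (\<epsilon> t z) z (past_maps \<epsilon> t z) = best t z (past_maps \<epsilon> t z)"
    and "AE \<omega> in given (outputs \<epsilon>) t z.
      strategy_cost \<epsilon> (Suc t) (next_word \<epsilon> t z \<omega>) = best (Suc t) (next_word \<epsilon> t z \<omega>) (past_maps \<epsilon> (Suc t) (next_word \<epsilon> t z \<omega>))
      \<and> strategy_cost \<epsilon> (Suc t) (next_word \<epsilon> t z \<omega>) < \<top>"
proof -
  let ?U = "given (outputs \<epsilon>) t z"
  let ?c = "\<integral>\<^sup>+\<omega>. step_cost \<epsilon> t z \<omega> \<partial>?U"
  let ?b = "\<lambda>\<omega>. best (Suc t) (next_word \<epsilon> t z \<omega>) (past_maps \<epsilon> (Suc t) (next_word \<epsilon> t z \<omega>))"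
  let ?s = "\<lambda>\<omega>. strategy_cost \<epsilon> (Suc t) (next_word \<epsilon> t z \<omega>)"
  have ms: "?s \<in> borel_measurable ?U" and mb: "?b \<in> borel_measurable ?U"
    using next_word_measurable[OF \<epsilon> t, of "strategy_cost \<epsilon> (Suc t)"]
      next_word_measurable[OF \<epsilon> t, of "\<lambda>y. best (Suc t) y (past_maps \<epsilon> (Suc t) y)"]
    by (simp_all add: given_measurable)
  have bs: "?b \<omega> \<le> ?s \<omega>" for \<omega>
    using t by (intro best_le_strategy_cost[OF \<epsilon>] next_word_words[OF \<epsilon> t z]) simp
  have G: "Gamma P t (\<epsilon> t z) z (past_maps \<epsilon> t z) = ?c + (\<integral>\<^sup>+\<omega>. ?b \<omega> \<partial>?U)"
    by (rule Gamma_eq[OF \<epsilon> t z])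
  have S: "strategy_cost \<epsilon> t z = ?c + (\<integral>\<^sup>+\<omega>. ?s \<omega> \<partial>?U)" by (rule strategy_cost_step[OF t])
  have "Gamma P t (\<epsilon> t z) z (past_maps \<epsilon> t z) \<le> strategy_cost \<epsilon> t z"
    unfolding G S by (intro add_left_mono nn_integral_mono bs)
  moreover have "best t z (past_maps \<epsilon> t z) \<le> Gamma P t (\<epsilon> t z) z (past_maps \<epsilon> t z)"
    using t \<epsilon> by (auto simp: best_def quant_strategy_def intro: INF_lower)
  ultimately show Gb: "Gamma P t (\<epsilon> t z) z (past_maps \<epsilon> t z) = best t z (past_maps \<epsilon> t z)"
    using eq by simp
  have finS: "?c < \<top>" "(\<integral>\<^sup>+\<omega>. ?s \<omega> \<partial>?U) < \<top>" using fin unfolding S by auto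
  have "?c + (\<integral>\<^sup>+\<omega>. ?s \<omega> \<partial>?U) = ?c + (\<integral>\<^sup>+\<omega>. ?b \<omega> \<partial>?U)" using Gb eq unfolding G S by simp
  then have int: "(\<integral>\<^sup>+\<omega>. ?s \<omega> \<partial>?U) = (\<integral>\<^sup>+\<omega>. ?b \<omega> \<partial>?U)"
    using finS(1) by (auto simp: ennreal_add_left_cancel)
  have "(\<integral>\<^sup>+\<omega>. ?s \<omega> - ?b \<omega> \<partial>?U) = 0"
    using finS(2) int bs by (subst nn_integral_diff[OF ms mb]) auto
  then have "AE \<omega> in ?U. ?s \<omega> - ?b \<omega> = 0"
    using ms mb by (subst (asm) nn_integral_0_iff_AE) auto
  moreover have "AE \<omega> in ?U. ?s \<omega> \<noteq> \<infinity>"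
    using finS(2) by (intro nn_integral_PInf_AE[OF ms]) auto
  ultimately show "AE \<omega> in ?U. ?s \<omega> = ?b \<omega> \<and> ?s \<omega> < \<top>"
  proof eventually_elim
    case (elim \<omega>)
    then have "?s \<omega> \<le> ?b \<omega>" by (simp add: ennreal_minus_eq_0)
    then show ?case using bs[of \<omega>] elim(2) by (simp add: less_top[symmetric])
  qed
qed

text \<open>
  Optimality is inherited forward in time along words of positive probability, because a set of full
  conditional measure meets every such cell.
\<close>
lemma minimal_on_reachable_words:
  assumes \<epsilon>: "quant_strategy P \<epsilon>"
    and root: "strategy_cost \<epsilon> 0 (\<lambda>_. undefined) = best 0 (\<lambda>_. undefined) (\<lambda>_. undefined)"
    and fin: "strategy_cost \<epsilon> 0 (\<lambda>_. undefined) < \<top>"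
  shows "t \<le> Suc T \<Longrightarrow> z \<in> words t \<Longrightarrow> emeasure M (cell (outputs \<epsilon>) t z) \<noteq> 0 \<Longrightarrow>
    strategy_cost \<epsilon> t z = best t z (past_maps \<epsilon> t z) \<and> strategy_cost \<epsilon> t z < \<top>"
proof (induction t arbitrary: z)
  case 0
  then have "z = (\<lambda>_. undefined)" by (simp add: words_def)
  then show ?case using root fin by (simp add: past_maps_0)
next
  case (Suc t)
  let ?Z = "outputs \<epsilon>" and ?y = "restrict z {..<t}"
  have t: "t \<le> T" "t \<le> Suc T" using Suc.prems by auto
  have Z: "adapted ?Z" by (rule outputs_adapted[OF \<epsilon>])
  have y: "?y \<in> words t"
    unfolding words_def restrict_PiE_iff using PiE_mem[OF Suc.prems(2)[unfolded words_def]] by simp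
  have sub: "cell ?Z (Suc t) z \<subseteq> cell ?Z t ?y"
  proof
    fix \<omega> assume \<omega>: "\<omega> \<in> cell ?Z (Suc t) z"
    then have "z = hist ?Z (Suc t) \<omega>" by (simp add: cell_def)
    then have "?y = hist ?Z t \<omega>" by (auto simp: hist_def fun_eq_iff)
    then show "\<omega> \<in> cell ?Z t ?y" using \<omega> by (simp add: cell_def)
  qed
  have cells: "cell ?Z (Suc t) z \<in> sets M" "cell ?Z t ?y \<in> sets M"
    by (rule cell_measurable[OF Z Suc.prems(1,2)]) (rule cell_measurable[OF Z t(2) y])
  have pos: "emeasure M (cell ?Z t ?y) \<noteq> 0"
    using emeasure_mono[OF sub cells(2)] Suc.prems(3) by auto
  note IH = Suc.IH[OF t(2) y pos]
  define ok where "ok x \<longleftrightarrow> strategy_cost \<epsilon> (Suc t) x = best (Suc t) x (past_maps \<epsilon> (Suc t) x) \<and> strategy_cost \<epsilon> (Suc t) x < \<top>" for x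
  have "AE \<omega> in given ?Z t ?y. ok (next_word \<epsilon> t ?y \<omega>)"
    unfolding ok_def using sandwich_at_word(2)[OF \<epsilon> t(1) y] IH by blast
  then have "AE \<omega> in M. \<omega> \<in> cell ?Z t ?y \<longrightarrow> ok (next_word \<epsilon> t ?y \<omega>)"
    unfolding given_def using pos by (subst (asm) AE_uniform_measure) (auto simp: less_top[symmetric])
  then have "AE \<omega> in M. \<omega> \<in> cell ?Z (Suc t) z \<longrightarrow> ok z"
  proof eventually_elim
    case (elim \<omega>)
    show ?case
    proof
      assume \<omega>: "\<omega> \<in> cell ?Z (Suc t) z"
      then have "?y = hist ?Z t \<omega>" using sub by (auto simp: cell_def)
      then have "next_word \<epsilon> t ?y \<omega> = hist ?Z (Suc t) \<omega>"
        unfolding next_word_def hist_Suc outputs_eq[of \<epsilon> t \<omega>] by simp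
      then have "next_word \<epsilon> t ?y \<omega> = z" using \<omega> by (simp add: cell_def)
      then show "ok z" using elim sub \<omega> by auto
    qed
  qed
  then have "ok z"
  proof (rule contrapos_pp)
    assume "\<not> ok z"
    then have "\<not> (AE \<omega> in M. \<omega> \<notin> cell ?Z (Suc t) z)"
      using Suc.prems(3) cells(1) by (simp add: AE_iff_null_sets[symmetric] null_sets_def)
    then show "\<not> (AE \<omega> in M. \<omega> \<in> cell ?Z (Suc t) z \<longrightarrow> ok z)" using \<open>\<not> ok z\<close> by simp
  qed
  then show ?case unfolding ok_def .
qed

lemma minimal_strategy_argmin:
  assumes \<epsilon>: "quant_strategy P \<epsilon>"
    and root: "strategy_cost \<epsilon> 0 (\<lambda>_. undefined) = best 0 (\<lambda>_. undefined) (\<lambda>_. undefined)"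
    and fin: "strategy_cost \<epsilon> 0 (\<lambda>_. undefined) < \<top>"
  shows "argmin_strategy P \<epsilon>"
  unfolding argmin_strategy_def
proof (intro conjI \<epsilon> allI impI ballI)
  fix t z assume t: "t \<le> T" and "z \<in> {..<t} \<rightarrow>\<^sub>E symbols"
  then have z: "z \<in> words t" by (simp add: words_def)
  let ?G = "\<lambda>e. Gamma P t e z (past_maps \<epsilon> t z)"
  have t': "t \<le> Suc T" using t by simp
  have Z: "adapted (outputs \<epsilon>)" by (rule outputs_adapted[OF \<epsilon>])
  have "?G (\<epsilon> t z) \<le> ?G e" if e: "e \<in> quant_maps" for e
  proof (cases "emeasure M (cell (outputs \<epsilon>) t z) = 0")
    case True
    have "?G (\<epsilon> t z) = 0"
      unfolding Gamma_eq[OF \<epsilon> t z]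
      using given_null[OF Z t' z True step_cost_measurable[OF \<epsilon> t]]
        given_null[OF Z t' z True next_word_measurable[OF \<epsilon> t, of "\<lambda>y. best (Suc t) y (past_maps \<epsilon> (Suc t) y)"]]
      by simp
    then show ?thesis by simp
  next
    case False
    have "?G (\<epsilon> t z) = best t z (past_maps \<epsilon> t z)"
      using minimal_on_reachable_words[OF \<epsilon> root fin t' z False] by (intro sandwich_at_word(1)[OF \<epsilon> t z]) auto
    also have "\<dots> \<le> ?G e" using t e by (auto simp: best_def intro: INF_lower)
    finally show ?thesis .
  qed
  then have "is_arg_min ?G (\<lambda>e. e \<in> quant_maps) (\<epsilon> t z)"
    using \<epsilon> t by (auto simp: is_arg_min_def quant_strategy_def not_less)
  then show "is_arg_min (\<lambda>e. Gamma P t e z (\<lambda>i\<in>{..<t}. \<epsilon> i (restrict z {..<i}))) (\<lambda>e. e \<in> quant_maps) (\<epsilon> t z)"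
    unfolding past_maps_def .
qed

section \<open>Separation of encoder and controller\<close>

lemma chan_forget_enc_eq: "chan P (forget_enc P \<epsilon>) K = outputs \<epsilon>"
  by (intro ext chan_forget_outputs)

lemma forget_enc_admissible:
  assumes \<epsilon>: "quant_strategy P \<epsilon>"
  shows "admissible_encoder P (forget_enc P \<epsilon>)"
  unfolding admissible_encoder_def
proof (intro allI impI conjI)
  fix t z Ks x assume t: "t \<le> T"
  have [measurable]: "(\<lambda>x. x t) \<in> borel_measurable (PiM {..t} (\<lambda>_. borel :: real measure))"
    by (rule measurable_component_singleton) simp
  have "(\<lambda>x. x t - (\<Sum>j<t. a ^ (t - 1 - j) * replay Ks z t j)) \<in> borel_measurable (PiM {..t} (\<lambda>_. borel))"
    by measurable
  from measurable_compose[OF this quant_strategy_map(1)[OF \<epsilon> t]]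
  show "(\<lambda>x. forget_enc P \<epsilon> t x z Ks) \<in> PiM {..t} (\<lambda>_. borel) \<rightarrow>\<^sub>M count_space UNIV"
    unfolding forget_enc_def .
  show "forget_enc P \<epsilon> t x z Ks \<in> symbols"
    unfolding forget_enc_def by (rule quant_strategy_map(2)[OF \<epsilon> t])
qed

lemma forgetting_linear_cost:
  assumes \<epsilon>: "quant_strategy P \<epsilon>" and K: "admissible_controller P K" and lin: "linear_law P (forget_enc P \<epsilon>) K"
  shows "total_cost P (forget_enc P \<epsilon>) K = ennreal base_cost + strategy_cost \<epsilon> 0 (\<lambda>_. undefined)"
  unfolding linear_law_cost[OF forget_enc_admissible[OF \<epsilon>] K lin] chan_forget_enc_eq
    strategy_cost_process[OF \<epsilon>] ..

lemma forgetting_linear_law_exists: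
  assumes \<epsilon>: "quant_strategy P \<epsilon>"
  shows "\<exists>K. admissible_controller P K \<and> linear_law P (forget_enc P \<epsilon>) K"
  using linear_controller_admissible linear_controller_linear[OF forget_enc_admissible[OF \<epsilon>] chan_forget_enc_eq]
  by blast

text \<open>
  The passage from an arbitrary design: replace the controller by the decoder it implies, improve the
  encoder against this decoder, then improve the decoder to the conditional mean.
\<close>
lemma design_dominated_by_strategy:
  assumes "admissible_encoder P E" "admissible_controller P K"
  shows "\<exists>\<epsilon>. quant_strategy P \<epsilon> \<and> ennreal base_cost + strategy_cost \<epsilon> 0 (\<lambda>_. undefined) \<le> total_cost P E K"
proof -
  obtain \<epsilon> where \<epsilon>: "quant_strategy P \<epsilon>"
    and le: "process_cost (implied_decoder K) (outputs \<epsilon>) \<le> process_cost (implied_decoder K) (chan P E K)"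
    using forgetting_encoder_suffices[OF chan_adapted[OF assms]] by blast
  have "ennreal base_cost + strategy_cost \<epsilon> 0 (\<lambda>_. undefined)
      \<le> ennreal base_cost + process_cost (implied_decoder K) (chan P E K)"
    unfolding strategy_cost_process[OF \<epsilon>]
    by (intro add_left_mono order_trans[OF process_cost_cmean_least[OF outputs_adapted[OF \<epsilon>]] le])
  also have "\<dots> \<le> total_cost P E K" by (rule design_cost_lower_bound[OF assms])
  finally show ?thesis using \<epsilon> by blast
qed

text \<open>
  With the one-letter alphabet nothing is sent: the communication cost and the rate are zero, and the error
  is bounded by the second moments of \<open>\<zeta>\<close>.
\<close>
lemma some_strategy_finite: "\<exists>\<epsilon>. quant_strategy P \<epsilon> \<and> strategy_cost \<epsilon> 0 (\<lambda>_. undefined) < \<top>"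
proof -
  let ?\<epsilon> = "(\<lambda>_ _ _. (1, 1)) :: strategy"
  have \<epsilon>: "quant_strategy P ?\<epsilon>" using one_letter_map by (simp add: quant_strategy_def)
  have Z: "adapted (outputs ?\<epsilon>)" by (rule outputs_adapted[OF \<epsilon>])
  have phi1: "phi P 1 = 0" using alphabet by (simp add: phi_def)
  have out: "outputs ?\<epsilon> t \<omega> = (1, 1)" for t \<omega> by (simp add: outputs_def)
  have "comm_integral (outputs ?\<epsilon>) = 0"
    unfolding comm_integral_def penalty_hist out by (simp add: phi1[simplified])
  moreover have "(\<integral>\<^sup>+\<omega>. (\<Sum>t\<le>T. ennreal (lam P t * (zeta P t \<omega> - 0)\<^sup>2)) \<partial>M) < \<top>"
  proof -
    have "integrable M (\<lambda>\<omega>. \<Sum>t\<le>T. lam P t * (zeta P t \<omega>)\<^sup>2)"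
      using L2_zeta by (intro Bochner_Integration.integrable_sum integrable_mult_right) (auto simp: L2_def)
    moreover have "(\<Sum>t\<le>T. ennreal (lam P t * (zeta P t \<omega> - 0)\<^sup>2)) = ennreal (norm (\<Sum>t\<le>T. lam P t * (zeta P t \<omega>)\<^sup>2))" for \<omega>
    proof -
      have "0 \<le> (\<Sum>t\<le>T. lam P t * (zeta P t \<omega>)\<^sup>2)" by (intro sum_nonneg) (auto simp: lam_nonneg)
      then show ?thesis by (subst sum_ennreal) (auto simp: lam_nonneg)
    qed
    ultimately show ?thesis by (simp add: integrable_iff_bounded)
  qed
  ultimately have "process_cost (\<lambda>_ _. 0) (outputs ?\<epsilon>) < \<top>"
    unfolding process_cost_eq[OF Z] by simp
  then have "strategy_cost ?\<epsilon> 0 (\<lambda>_. undefined) < \<top>"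
    unfolding strategy_cost_process[OF \<epsilon>] using process_cost_cmean_least[OF Z] by (rule order.strict_trans1[rotated])
  then show ?thesis using \<epsilon> by blast
qed

text \<open>
  Attainment of the infima comes from the optimal design, without any compactness of the set of quantization
  maps: a strategy that dominates the optimal design has least cost among strategies.
\<close>
lemma argmin_strategy_exists:
  assumes "\<exists>E K. optimal_design P E K"
  shows "\<exists>\<epsilon>. argmin_strategy P \<epsilon>"
proof -
  obtain E K where E: "admissible_encoder P E" and K: "admissible_controller P K"
    and opt: "\<And>E' K'. admissible_encoder P E' \<Longrightarrow> admissible_controller P K' \<Longrightarrow> total_cost P E K \<le> total_cost P E' K'"
    using assms unfolding optimal_design_def by blast
  obtain \<epsilon> where \<epsilon>: "quant_strategy P \<epsilon>"
    and le: "ennreal base_cost + strategy_cost \<epsilon> 0 (\<lambda>_. undefined) \<le> total_cost P E K"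
    using design_dominated_by_strategy[OF E K] by blast
  have min: "strategy_cost \<epsilon> 0 (\<lambda>_. undefined) \<le> strategy_cost \<epsilon>' 0 (\<lambda>_. undefined)"
    if \<epsilon>': "quant_strategy P \<epsilon>'" for \<epsilon>'
  proof -
    obtain K' where K': "admissible_controller P K'" and lin: "linear_law P (forget_enc P \<epsilon>') K'"
      using forgetting_linear_law_exists[OF \<epsilon>'] by blast
    have "ennreal base_cost + strategy_cost \<epsilon> 0 (\<lambda>_. undefined) \<le> ennreal base_cost + strategy_cost \<epsilon>' 0 (\<lambda>_. undefined)"
      using le opt[OF forget_enc_admissible[OF \<epsilon>'] K'] unfolding forgetting_linear_cost[OF \<epsilon>' K' lin] by (rule order_trans)
    then show ?thesis by simp
  qed
  have "strategy_cost \<epsilon> 0 (\<lambda>_. undefined) < \<top>"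
    using some_strategy_finite min by (meson order.strict_trans1)
  then show ?thesis
    using minimal_strategy_argmin[OF \<epsilon> best_eq_of_minimal[OF \<epsilon> min]] by blast
qed

lemma argmin_strategy_optimal:
  assumes am: "argmin_strategy P \<epsilon>" and K: "admissible_controller P K" and lin: "linear_law P (forget_enc P \<epsilon>) K"
  shows "optimal_design P (forget_enc P \<epsilon>) K"
  unfolding optimal_design_def
proof (intro conjI allI impI)
  have \<epsilon>: "quant_strategy P \<epsilon>" using am by (simp add: argmin_strategy_def)
  show "admissible_encoder P (forget_enc P \<epsilon>)" "admissible_controller P K"
    by (rule forget_enc_admissible[OF \<epsilon>], rule K)
  fix E' K' assume "admissible_encoder P E' \<and> admissible_controller P K'"
  then obtain \<epsilon>' where \<epsilon>': "quant_strategy P \<epsilon>'"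
    and le: "ennreal base_cost + strategy_cost \<epsilon>' 0 (\<lambda>_. undefined) \<le> total_cost P E' K'"
    using design_dominated_by_strategy by blast
  have "strategy_cost \<epsilon> 0 (\<lambda>_. undefined) = best 0 (\<lambda>_. undefined) (\<lambda>_. undefined)"
    using argmin_strategy_cost[OF am _ undefined_word] by (simp add: past_maps_0)
  also have "\<dots> \<le> strategy_cost \<epsilon>' 0 (\<lambda>_. undefined)"
    using best_le_strategy_cost[OF \<epsilon>' _ undefined_word] by (simp add: past_maps_0)
  finally show "total_cost P (forget_enc P \<epsilon>) K \<le> total_cost P E' K'"
    unfolding forgetting_linear_cost[OF \<epsilon> K lin] using le by (meson add_left_mono order_trans)
qed

lemma forget_enc_controls_forgetting:
  "quant_strategy P \<epsilon> \<Longrightarrow> controls_forgetting P (forget_enc P \<epsilon>)"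
  unfolding controls_forgetting_def
  by (intro exI[of _ \<epsilon>] conjI allI impI) (assumption, rule chan_forget_enc)

end

theorem theorem2:
  fixes P :: "'w lq_problem" and x0_mean \<sigma>0 \<sigma>w :: real
  assumes prob: "prob_space (prob P)"
    and primitives: "prob_space.indep_vars (prob P) (\<lambda>_. borel)
        (case_nat (init P) (noise P)) {..Suc (horizon P)}"
    and init_L2: "integrable (prob P) (\<lambda>\<omega>. (init P \<omega>)\<^sup>2)"
    and init_mean: "prob_space.expectation (prob P) (init P) = x0_mean"
    and init_var: "prob_space.variance (prob P) (init P) = \<sigma>0\<^sup>2"
    and noise_L2: "\<And>t. t \<le> horizon P \<Longrightarrow> integrable (prob P) (\<lambda>\<omega>. (noise P t \<omega>)\<^sup>2)"
    and noise_mean: "\<And>t. t \<le> horizon P \<Longrightarrow> prob_space.expectation (prob P) (noise P t) = 0"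
    and noise_var: "\<And>t. t \<le> horizon P \<Longrightarrow> prob_space.variance (prob P) (noise P t) = \<sigma>w\<^sup>2"
    and weights: "wt_state P > 0" "wt_ctrl P > 0" "wt_comm P \<ge> 0"
    and alphabet: "max_alph P > 0"
    and rate: "rate P > 0" "rate P \<le> real (max_alph P)"
    and minimizers_exist: "\<exists>E K. optimal_design P E K"
  shows "(\<exists>\<epsilon>. argmin_strategy P \<epsilon>) \<and>
    (\<forall>\<epsilon>. argmin_strategy P \<epsilon> \<longrightarrow>
       controls_forgetting P (forget_enc P \<epsilon>) \<and>
       (\<exists>K. admissible_controller P K \<and> linear_law P (forget_enc P \<epsilon>) K) \<and>
       (\<forall>K. admissible_controller P K \<and> linear_law P (forget_enc P \<epsilon>) K \<longrightarrow>
          optimal_design P (forget_enc P \<epsilon>) K \<and>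
          certainty_equivalent P (forget_enc P \<epsilon>) K))"
proof -
  interpret prob_space "prob P" by (rule prob)
  interpret lq_plant P
    by unfold_locales (use primitives init_L2 noise_L2 noise_mean weights alphabet in auto)
  show ?thesis
  proof (intro conjI allI impI argmin_strategy_exists[OF minimizers_exist])
    fix \<epsilon> assume am: "argmin_strategy P \<epsilon>"
    then have \<epsilon>: "quant_strategy P \<epsilon>" by (simp add: argmin_strategy_def)
    show "controls_forgetting P (forget_enc P \<epsilon>)" by (rule forget_enc_controls_forgetting[OF \<epsilon>])
    show "\<exists>K. admissible_controller P K \<and> linear_law P (forget_enc P \<epsilon>) K"
      by (rule forgetting_linear_law_exists[OF \<epsilon>])
    fix K assume K: "admissible_controller P K \<and> linear_law P (forget_enc P \<epsilon>) K"
    show "optimal_design P (forget_enc P \<epsilon>) K"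
      using argmin_strategy_optimal[OF am] K by blast
    show "certainty_equivalent P (forget_enc P \<epsilon>) K"
      using linear_law_certainty_equivalent[OF forget_enc_admissible[OF \<epsilon>]] K by blast
  qed
qed

end
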